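(* For a convex body $\Delta\subset\mathbb{R}^n_q$, $$4r(\Delta)\le\zeta^{\tau_0}(\Delta)\le4R(\Delta).$$ Moreover, if $\Delta$ is centrally symmetric, then $B^n(\bar q,r)\subset\Delta$ (resp. $\Delta\subset\overline{B^n(\bar q,R)}$) implies $B^n(0,r)\subset\Delta$ (resp. $\Delta\subset\overline{B^n(0,R)}$), and also $4r(\Delta)\le\zeta^{\hat\tau_0}(\Delta)\le4R(\Delta)$.
   Context: On $\mathbb{R}^{2n}=\mathbb{R}^n_q\times\mathbb{R}^n_p$ with $\omega_0=dq\wedge dp$: $\tau_0(q,p)=(q,-p)$, $\hat\tau_0(q,p)=(-q,p)$. Symmetric capacity: for an anti-symplectic involution $\tau$ and $\tau$-invariant open $U$ meeting ${\rm Fix}(\tau)$, $c_{\rm HZ,\tau}(U)=\sup\{\max H\}$ over $\tau$-invariant smooth $H:U\to[0,\infty)$ vanishing on a nonempty open set meeting ${\rm Fix}(\tau)$, equal to $\max H$ outside a compact subset of $U$, whose Hamiltonian flow ($\omega_0(X_H,\cdot)=-dH$) has no nonconstant $T$-periodic orbit $x$ with $x(T-t)=x(-t)=\tau(x(t))$, $T\in(0,1]$; for a $\tau$-invariant convex body $C$, $c_{\rm EHZ,\tau}(C)=c_{\rm HZ,\tau}({\rm Int}C,\omega_0)$. Define $\zeta^\tau(\Delta)=c_{\rm EHZ,\tau}(\Delta\times B^n(1))$ whenever $\Delta\times B^n(1)$ is $\tau$-invariant ($B^n(1)$ the closed unit ball in $\mathbb{R}^n_p$). Inradius $r(\Delta)=\max\{r>0\,|\,B^n(q,r)\subset\Delta\text{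 for some }q\}$, circumradius $R(\Delta)=\min\{R>0\,|\,B^n(q,R)\supseteq\Delta\text{ for some }q\}$. Centrally symmetric: $-\Delta=\Delta$. *)

theory Defs
  imports "HOL-Analysis.Analysis" "HOL-Library.Extended_Real"
begin

text \<open>Phase space R^{2n} = R^n_q x R^n_p, realised as pairs (q,p).\<close>
type_synonym 'n phase = "(real^'n) \<times> (real^'n)"

definition omega0 :: "'n::finite phase \<Rightarrow> 'n phase \<Rightarrow> real" where
  "omega0 u v = fst u \<bullet> snd v - snd u \<bullet> fst v"

definition tau0 :: "'n::finite phase \<Rightarrow> 'n phase" where
  "tau0 z = (fst z, - snd z)"

definition hat_tau0 :: "'n::finite phase \<Rightarrow> 'n phase" where
  "hat_tau0 z = (- fst z, snd z)"

definition Fix :: "('a \<Rightarrow> 'a) \<Rightarrow> 'a set" where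
  "Fix f = {z. f z = z}"

definition dderiv :: "'a::real_normed_vector \<Rightarrow> ('a \<Rightarrow> real) \<Rightarrow> 'a \<Rightarrow> real" where
  "dderiv v g x = frechet_derivative g (at x) v"

fun iter_dderiv :: "'a::real_normed_vector list \<Rightarrow> ('a \<Rightarrow> real) \<Rightarrow> 'a \<Rightarrow> real" where
  "iter_dderiv [] g = g"
| "iter_dderiv (v # vs) g = dderiv v (iter_dderiv vs g)"

definition smooth_fun_on :: "'a::real_normed_vector set \<Rightarrow> ('a \<Rightarrow> real) \<Rightarrow> bool" where
  "smooth_fun_on U g \<longleftrightarrow> (\<forall>vs. \<forall>x\<in>U. iter_dderiv vs g differentiable (at x))"

definition ham_orbit :: "('n::finite phase \<Rightarrow> real) \<Rightarrow> 'n phase set \<Rightarrow> (real \<Rightarrow> 'n phase) \<Rightarrow> bool" where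
  "ham_orbit H U x \<longleftrightarrow>
     (\<forall>t. x t \<in> U \<and>
        (\<exists>w. (x has_vector_derivative w) (at t) \<and>
             (\<forall>v. omega0 w v = - frechet_derivative H (at (x t)) v)))"

definition sym_periodic_orbit ::
  "('n::finite phase \<Rightarrow> 'n phase) \<Rightarrow> ('n phase \<Rightarrow> real) \<Rightarrow> 'n phase set \<Rightarrow> real \<Rightarrow> (real \<Rightarrow> 'n phase) \<Rightarrow> bool" where
  "sym_periodic_orbit \<tau> H U T x \<longleftrightarrow>
     ham_orbit H U x \<and> (\<forall>t. x (t + T) = x t) \<and> (\<exists>s t. x s \<noteq> x t) \<and>
     (\<forall>t. x (T - t) = x (- t) \<and> x (- t) = \<tau> (x t))"

definition HZ_admissible ::
  "('n::finite phase \<Rightarrow> 'n phase) \<Rightarrow> 'n phase set \<Rightarrow> ('n phase \<Rightarrow> real) \<Rightarrow> bool" where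
  "HZ_admissible \<tau> U H \<longleftrightarrow>
     (\<forall>z\<in>U. H (\<tau> z) = H z) \<and>
     smooth_fun_on U H \<and>
     (\<forall>z\<in>U. 0 \<le> H z) \<and>
     (\<exists>V. open V \<and> V \<subseteq> U \<and> V \<inter> Fix \<tau> \<noteq> {} \<and> (\<forall>z\<in>V. H z = 0)) \<and>
     (\<exists>K. compact K \<and> K \<subseteq> U \<and> (\<forall>z\<in>U - K. \<forall>y\<in>U. H y \<le> H z)) \<and>
     (\<forall>T x. 0 < T \<and> T \<le> 1 \<longrightarrow> \<not> sym_periodic_orbit \<tau> H U T x)"

definition c_HZ_tau :: "('n::finite phase \<Rightarrow> 'n phase) \<Rightarrow> 'n phase set \<Rightarrow> ereal" where
  "c_HZ_tau \<tau> U =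
     Sup {ereal m | m. \<exists>H. HZ_admissible \<tau> U H \<and> (\<forall>z\<in>U. H z \<le> m) \<and> (\<exists>z\<in>U. H z = m)}"

definition c_EHZ_tau :: "('n::finite phase \<Rightarrow> 'n phase) \<Rightarrow> 'n phase set \<Rightarrow> ereal" where
  "c_EHZ_tau \<tau> C = c_HZ_tau \<tau> (interior C)"

definition zeta :: "('n::finite phase \<Rightarrow> 'n phase) \<Rightarrow> (real^'n) set \<Rightarrow> ereal" where
  "zeta \<tau> \<Delta> = c_EHZ_tau \<tau> (\<Delta> \<times> cball 0 1)"

definition convex_body :: "'a::euclidean_space set \<Rightarrow> bool" where
  "convex_body K \<longleftrightarrow> convex K \<and> compact K \<and> interior K \<noteq> {}"

definition inradius :: "'a::euclidean_space set \<Rightarrow> real" where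
  "inradius K = Sup {r. r > 0 \<and> (\<exists>q. cball q r \<subseteq> K)}"

definition circumradius :: "'a::euclidean_space set \<Rightarrow> real" where
  "circumradius K = Inf {R. R > 0 \<and> (\<exists>q. K \<subseteq> cball q R)}"

end

theory Submission
  imports Defs "HOL-Complex_Analysis.Great_Picard"
begin

text \<open>Upper bounds: an enclosing ball of \<open>\<Delta>\<close> puts the product into a set whose projection to one
  coordinate plane is an open rectangle of area \<open>4R\<close>. A symplectic map of that plane turns the rectangle
  into a disc, and an admissible function of larger maximum would, after extension by a function of a
  quadratic form, have a symmetric \<open>1\<close>-periodic orbit of positive action. Such an orbit is found by
  Hofer--Zehnder linking. Reversible loops \<open>x(-t) = \<tau>\<^sub>0 (x(t))\<close> have Fourier series
  \<open>\<Sum>\<^sub>k (cos(kt) a\<^sub>k, sin(kt) a\<^sub>k)\<close>, so on trigonometric polynomials the action is a function of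
  finitely many real variables; the linking follows from the Poincare--Miranda theorem, and the critical
  points converge as the degree grows. For \<open>\<tau>\<close> reflecting \<open>q\<close> the roles of \<open>q\<close> and \<open>p\<close> are exchanged.

  Lower bounds: for an inscribed ball \<open>B(q\<^sub>0,r)\<close> take a ramp of slope less than \<open>4r\<close> in
  \<open>(|q - q\<^sub>0|\<^bsup>2k\<^esup> / r\<^bsup>2k\<^esup> + |p|\<^bsup>2k\<^esup>)\<^bsup>1/k\<^esup>\<close>, slightly smoothed at \<open>0\<close>. A symmetric orbit meets
  the fixed space of \<open>\<tau>\<close> at times \<open>0\<close> and \<open>T/2\<close>; this forces the motion onto a line, where the period
  is explicitly bounded below, and for large \<open>k\<close> the bound exceeds \<open>1\<close>.\<close>

section \<open>The Poincare--Miranda theorem\<close>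

text \<open>Loops are only ever given by finitely many coefficients: with \<open>2 * N + 1\<close>
  nodes the discrete mean is exact on products of two polynomials of degree \<open>N\<close>, so
  Parseval and Bessel hold without function spaces. The price is that all constants must be
  independent of \<open>N\<close>. For the positive lower bound on the action this is the
  \<open>L^4\<close> estimate on positive modes, in place of an embedding of \<open>H^(1/2)\<close>;
  for compactness it is a spectral gap, as the slopes at infinity avoid the integers. The number
  \<open>4R\<close> is the area of the rectangle with sides \<open>2R\<close> and 2. It is mapped to
  a disc because the extension at infinity is quadratic: a slope beyond the first resonance fits
  under an oscillation that exceeds the area of the disc. For the lower bound, the sublevel sets
  fill the product of the balls as \<open>k\<close> grows, and the power \<open>1/k\<close> makes
  the function homogeneous of degree 2, so that one bound on the slope bounds all frequencies.
  Motion on a line then nearly follows a square; half a turn covers four times its half side, which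
  is the 4 in \<open>4r\<close>.\<close>

lemma finite_coord_subseq:
  fixes x :: "nat \<Rightarrow> 'i \<Rightarrow> 'b::heine_borel"
  assumes "finite I" "\<And>i. i \<in> I \<Longrightarrow> bounded (range (\<lambda>p. x p i))"
  shows "\<exists>l r. strict_mono (r::nat\<Rightarrow>nat) \<and> (\<forall>i\<in>I. (\<lambda>p. x (r p) i) \<longlonglongrightarrow> l i)"
  using assms
proof (induction I rule: finite_induct)
  case empty
  then show ?case by (auto intro!: exI[of _ id] simp: strict_mono_id)
next
  case (insert j I)
  then obtain l r where r: "strict_mono (r::nat\<Rightarrow>nat)" "\<forall>i\<in>I. (\<lambda>p. x (r p) i) \<longlonglongrightarrow> l i"
    by auto
  have "bounded (range (\<lambda>p. x (r p) j))"
    by (rule bounded_subset[OF insert.prems[of j]]) auto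
  then obtain m s where s: "strict_mono (s::nat\<Rightarrow>nat)" "((\<lambda>p. x (r p) j) \<circ> s) \<longlonglongrightarrow> m"
    using bounded_imp_convergent_subsequence by blast
  have "(\<lambda>p. x (r (s p)) i) \<longlonglongrightarrow> l i" if "i \<in> I" for i
    using LIMSEQ_subseq_LIMSEQ[OF r(2)[rule_format, OF that] s(1)] by (simp add: o_def)
  then have "\<forall>i\<in>insert j I. (\<lambda>p. x ((r \<circ> s) p) i) \<longlonglongrightarrow> (l(j := m)) i"
    using s(2) insert.hyps by (auto simp: o_def)
  moreover have "strict_mono (r \<circ> s)" using r(1) s(1) by (rule strict_mono_o)
  ultimately show ?case by blast
qed

text \<open>Kuhn's combinatorial lemma is applied to the grid of mesh \<open>1 / Suc p\<close>,
  labelled by the signs of \<open>\<Phi>\<close>. It yields a cell in which every component takes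
  both signs at vertices; as the mesh tends to 0, all these vertices converge to a common
  zero.\<close>

lemma poincare_miranda_unit:
  fixes \<Phi> :: "(nat \<Rightarrow> real) \<Rightarrow> nat \<Rightarrow> real" and n :: nat
  defines "B \<equiv> {x. (\<forall>i<n. 0 \<le> x i \<and> x i \<le> 1)}"
  assumes cont: "\<And>i X x. i < n \<Longrightarrow> (\<And>p. X p \<in> B) \<Longrightarrow> x \<in> B \<Longrightarrow> (\<And>i. i < n \<Longrightarrow> (\<lambda>p. X p i) \<longlonglongrightarrow> x i)
     \<Longrightarrow> (\<lambda>p. \<Phi> (X p) i) \<longlonglongrightarrow> \<Phi> x i"
    and low: "\<And>x i. x \<in> B \<Longrightarrow> i < n \<Longrightarrow> x i = 0 \<Longrightarrow> \<Phi> x i \<le> 0"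
    and high: "\<And>x i. x \<in> B \<Longrightarrow> i < n \<Longrightarrow> x i = 1 \<Longrightarrow> \<Phi> x i \<ge> 0"
  shows "\<exists>x\<in>B. \<forall>i<n. \<Phi> x i = 0"
proof -
  define P where "P p q i r s \<longleftrightarrow> (\<forall>j<n. q j \<le> r j \<and> r j \<le> q j + 1) \<and> (\<forall>j<n. q j \<le> s j \<and> s j \<le> q j + 1) \<and>
        \<Phi> (\<lambda>j. real (r j) / real (Suc p)) i \<le> 0 \<and> \<Phi> (\<lambda>j. real (s j) / real (Suc p)) i \<ge> 0" for p q i r s
  have "\<exists>q. (\<forall>i<n. q i < Suc p) \<and> (\<forall>i<n. \<exists>r s. P p q i r s)" for p :: nat
  proof -
    \<comment> \<open>On the two faces the label is prescribed, as Kuhn's lemma demands;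
      \<open>low\<close> and \<open>high\<close> make it agree with the weak sign of
      \<open>\<Phi>\<close> there.\<close>
    define lab where "lab x i = (if x i = 0 then 0 else if x i = Suc p then 1
        else if \<Phi> (\<lambda>j. real (x j) / real (Suc p)) i \<ge> 0 then 1 else (0::nat))" for x i
    have L0: "\<Phi> (\<lambda>j. real (x j) / real (Suc p)) i \<le> 0" if "\<And>j. j < n \<Longrightarrow> x j \<le> Suc p" "i < n" "lab x i = 0" for x i
    proof (cases "x i = 0")
      case True
      have "real (x j) \<le> real (Suc p)" if "j < n" for j
        using \<open>\<And>j. j < n \<Longrightarrow> x j \<le> Suc p\<close>[OF that] by (simp only: of_nat_le_iff)
      then have "\<forall>j<n. 0 \<le> real (x j) / real (Suc p) \<and> real (x j) / real (Suc p) \<le> 1"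
        by (metis divide_le_eq_1_pos of_nat_0_less_iff of_nat_0_le_iff zero_less_Suc divide_nonneg_nonneg)
      then have "(\<lambda>j. real (x j) / real (Suc p)) \<in> B" unfolding B_def by blast
      then show ?thesis using \<open>i < n\<close> True by (intro low) auto
    qed (use that in \<open>auto simp: lab_def split: if_splits\<close>)
    have L1: "\<Phi> (\<lambda>j. real (x j) / real (Suc p)) i \<ge> 0" if "\<And>j. j < n \<Longrightarrow> x j \<le> Suc p" "i < n" "lab x i \<noteq> 0" for x i
    proof (cases "x i = Suc p")
      case True
      have "real (x j) \<le> real (Suc p)" if "j < n" for j
        using \<open>\<And>j. j < n \<Longrightarrow> x j \<le> Suc p\<close>[OF that] by (simp only: of_nat_le_iff)
      then have "\<forall>j<n. 0 \<le> real (x j) / real (Suc p) \<and> real (x j) / real (Suc p) \<le> 1"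
        by (metis divide_le_eq_1_pos of_nat_0_less_iff of_nat_0_le_iff zero_less_Suc divide_nonneg_nonneg)
      then have "(\<lambda>j. real (x j) / real (Suc p)) \<in> B" unfolding B_def by blast
      then show ?thesis using \<open>i < n\<close> True by (intro high) auto
    qed (use that in \<open>auto simp: lab_def split: if_splits\<close>)
    obtain q where q: "\<forall>i<n. q i < Suc p"
      "\<forall>i<n. \<exists>r s. (\<forall>j<n. q j \<le> r j \<and> r j \<le> q j + 1) \<and> (\<forall>j<n. q j \<le> s j \<and> s j \<le> q j + 1) \<and> lab r i \<noteq> lab s i"
      by (rule kuhn_lemma[of "Suc p" n lab]) (auto simp: lab_def)
    have "\<exists>r s. P p q i r s" if "i < n" for i
    proof -
      obtain r s where rs: "\<forall>j<n. q j \<le> r j \<and> r j \<le> q j + 1" "\<forall>j<n. q j \<le> s j \<and> s j \<le> q j + 1" "lab r i \<noteq> lab s i"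
        using q(2) \<open>i < n\<close> by blast
      have le: "r j \<le> Suc p" "s j \<le> Suc p" if "j < n" for j
        using rs(1)[rule_format, OF that] rs(2)[rule_format, OF that] q(1)[rule_format, OF that] by linarith+
      show ?thesis
      proof (cases "lab r i = 0")
        case True
        then have "lab s i \<noteq> 0" using rs(3) by simp
        then have "P p q i r s"
          using rs(1,2) L0[OF le(1) \<open>i < n\<close> True] L1[OF le(2) \<open>i < n\<close>] unfolding P_def by auto
        then show ?thesis by blast
      next
        case False
        moreover from this have "lab s i = 0" using rs(3) by (auto simp: lab_def split: if_splits)
        ultimately have "P p q i s r"
          using rs(1,2) L0[OF le(2) \<open>i < n\<close>] L1[OF le(1) \<open>i < n\<close>] False unfolding P_def by auto
        then show ?thesis by blast
      qed
    qed
    then show ?thesis using q(1) by blast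
  qed
  then obtain q where q: "\<And>p i. i < n \<Longrightarrow> q p i < Suc p" and "\<And>p i. i < n \<Longrightarrow> \<exists>r s. P p (q p) i r s"
    by metis
  then have "\<forall>p i. \<exists>r s. i < n \<longrightarrow> P p (q p) i r s" by blast
  then obtain R S where P: "\<And>p i. i < n \<Longrightarrow> P p (q p) i (R p i) (S p i)"
    by metis
  then have RS: "\<And>p i j. i < n \<Longrightarrow> j < n \<Longrightarrow> q p j \<le> R p i j \<and> R p i j \<le> q p j + 1 \<and> q p j \<le> S p i j \<and> S p i j \<le> q p j + 1"
    and sgn: "\<And>p i. i < n \<Longrightarrow> \<Phi> (\<lambda>j. real (R p i j) / real (Suc p)) i \<le> 0 \<and> \<Phi> (\<lambda>j. real (S p i j) / real (Suc p)) i \<ge> 0"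
    unfolding P_def by blast+
  define X where "X p j = real (q p j) / real (Suc p)" for p j
  have X01: "0 \<le> X p j \<and> X p j \<le> 1" if "j < n" for p j
    using q[OF that, of p] by (auto simp: X_def divide_simps)
  have "\<exists>l r. strict_mono (r::nat\<Rightarrow>nat) \<and> (\<forall>i\<in>{..<n}. (\<lambda>p. X (r p) i) \<longlonglongrightarrow> l i)"
  proof (rule finite_coord_subseq)
    show "bounded (range (\<lambda>p. X p i))" if "i \<in> {..<n}" for i
      using X01 that by (intro boundedI[of _ 1]) auto
  qed auto
  then obtain l r where r: "strict_mono (r::nat\<Rightarrow>nat)" "\<And>i. i < n \<Longrightarrow> (\<lambda>p. X (r p) i) \<longlonglongrightarrow> l i"
    by auto
  have inv0: "(\<lambda>p. 1 / real (Suc (r p))) \<longlonglongrightarrow> 0"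
    using LIMSEQ_subseq_LIMSEQ[OF LIMSEQ_inverse_real_of_nat r(1)] by (simp add: o_def inverse_eq_divide)
  have lB: "l \<in> B"
    unfolding B_def using X01 by (auto intro: LIMSEQ_le_const[OF r(2)] LIMSEQ_le_const2[OF r(2)])
  \<comment> \<open>Vertices of a cell differ from its corner \<open>q\<close> by at most one mesh
    width, so they share the limit \<open>l\<close>.\<close>
  have squeeze: "(\<lambda>p. real (Y (r p)) / real (Suc (r p))) \<longlonglongrightarrow> l j"
    if "j < n" "\<And>p. q p j \<le> Y p \<and> Y p \<le> q p j + 1" for Y j
  proof (rule tendsto_sandwich[OF _ _ r(2)[OF \<open>j < n\<close>]])
    show "(\<lambda>p. X (r p) j + 1 / real (Suc (r p))) \<longlonglongrightarrow> l j"
      using tendsto_add[OF r(2)[OF \<open>j < n\<close>] inv0] by simp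
    have "real (q p j) \<le> real (Y p) \<and> real (Y p) \<le> real (q p j) + 1" for p
      using that(2)[of p] by linarith
    then show "\<forall>\<^sub>F p in sequentially. X (r p) j \<le> real (Y (r p)) / real (Suc (r p))"
      "\<forall>\<^sub>F p in sequentially. real (Y (r p)) / real (Suc (r p)) \<le> X (r p) j + 1 / real (Suc (r p))"
      by (auto simp: X_def divide_simps intro!: always_eventually)
  qed
  have inB: "(\<lambda>j. real (Y j) / real (Suc p)) \<in> B" if Y: "\<And>j. j < n \<Longrightarrow> q p j \<le> Y j \<and> Y j \<le> q p j + 1" for Y p
  proof -
    have "Y j \<le> Suc p" if "j < n" for j
      using q[OF that, of p] Y[OF that] by linarith
    then have "real (Y j) \<le> real (Suc p)" if "j < n" for j
      using that of_nat_le_iff by blast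
    then show ?thesis by (simp add: B_def del: of_nat_Suc)
  qed
  have "\<Phi> l i = 0" if "i < n" for i
  proof (rule antisym)
    have "(\<lambda>p. \<Phi> (\<lambda>j. real (R (r p) i j) / real (Suc (r p))) i) \<longlonglongrightarrow> \<Phi> l i"
    proof (rule cont[where X = "\<lambda>p j. real (R (r p) i j) / real (Suc (r p))"])
      show "(\<lambda>p. real (R (r p) i j) / real (Suc (r p))) \<longlonglongrightarrow> l j" if "j < n" for j
        using squeeze[of j "\<lambda>p. R p i j"] RS that \<open>i < n\<close> by blast
    qed (use RS \<open>i < n\<close> lB in \<open>auto intro!: inB simp del: of_nat_Suc\<close>)
    then show "\<Phi> l i \<le> 0" using sgn[OF \<open>i < n\<close>] by (auto intro: LIMSEQ_le_const2)
    have "(\<lambda>p. \<Phi> (\<lambda>j. real (S (r p) i j) / real (Suc (r p))) i) \<longlonglongrightarrow> \<Phi> l i"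
    proof (rule cont[where X = "\<lambda>p j. real (S (r p) i j) / real (Suc (r p))"])
      show "(\<lambda>p. real (S (r p) i j) / real (Suc (r p))) \<longlonglongrightarrow> l j" if "j < n" for j
        using squeeze[of j "\<lambda>p. S p i j"] RS that \<open>i < n\<close> by blast
    qed (use RS \<open>i < n\<close> lB in \<open>auto intro!: inB simp del: of_nat_Suc\<close>)
    then show "\<Phi> l i \<ge> 0" using sgn[OF \<open>i < n\<close>] by (auto intro: LIMSEQ_le_const)
  qed
  then show ?thesis using lB by blast
qed

text \<open>Continuity is only required sequentially with respect to the coordinates in \<open>I\<close>.\<close>
lemma poincare_miranda:
  fixes \<Phi> :: "('i \<Rightarrow> real) \<Rightarrow> 'i \<Rightarrow> real" and I :: "'i set" and l u :: "'i \<Rightarrow> real"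
  defines "B \<equiv> {x. (\<forall>i\<in>I. l i \<le> x i \<and> x i \<le> u i)}"
  assumes fin: "finite I" and lu: "\<And>i. i \<in> I \<Longrightarrow> l i < u i"
    and cont: "\<And>i X x. i \<in> I \<Longrightarrow> (\<And>p. X p \<in> B) \<Longrightarrow> x \<in> B \<Longrightarrow> (\<And>i. i \<in> I \<Longrightarrow> (\<lambda>p. X p i) \<longlonglongrightarrow> x i)
     \<Longrightarrow> (\<lambda>p. \<Phi> (X p) i) \<longlonglongrightarrow> \<Phi> x i"
    and low: "\<And>x i. x \<in> B \<Longrightarrow> i \<in> I \<Longrightarrow> x i = l i \<Longrightarrow> \<Phi> x i \<le> 0"
    and high: "\<And>x i. x \<in> B \<Longrightarrow> i \<in> I \<Longrightarrow> x i = u i \<Longrightarrow> \<Phi> x i \<ge> 0"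
  shows "\<exists>x\<in>B. \<forall>i\<in>I. \<Phi> x i = 0"
proof -
  obtain e where e: "bij_betw e {..<card I} I"
    using fin ex_bij_betw_nat_finite[of I] by (auto simp: lessThan_atLeast0)
  define ei where "ei = inv_into {..<card I} e"
  have ei: "ei i < card I" "e (ei i) = i" if "i \<in> I" for i
    using e that bij_betw_inv_into_right[OF e] bij_betw_apply[OF bij_betw_inv_into[OF e]]
    unfolding ei_def by auto
  have eI: "e j \<in> I" "ei (e j) = j" if "j < card I" for j
    using e that by (auto simp: bij_betw_def ei_def)
  define P where "P y i = l i + y (ei i) * (u i - l i)" for y i
  have PB: "P y \<in> B" if y: "\<forall>j<card I. 0 \<le> y j \<and> y j \<le> 1" for y
  proof -
    have "l i \<le> P y i \<and> P y i \<le> u i" if "i \<in> I" for i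
    proof -
      have "0 \<le> y (ei i)" "y (ei i) \<le> 1" using ei(1)[OF that] y by auto
      then have "0 \<le> y (ei i) * (u i - l i)" "y (ei i) * (u i - l i) \<le> 1 * (u i - l i)"
        using lu[OF that] by (intro mult_nonneg_nonneg mult_right_mono; simp)+
      then show ?thesis unfolding P_def by auto
    qed
    then show ?thesis by (auto simp: B_def)
  qed
  have "\<exists>y\<in>{y. \<forall>j<card I. 0 \<le> y j \<and> y j \<le> 1}. \<forall>j<card I. \<Phi> (P y) (e j) = 0"
  proof (rule poincare_miranda_unit[of "card I" "\<lambda>y j. \<Phi> (P y) (e j)"], goal_cases)
    case (1 j X x)
    show ?case
    proof (rule cont)
      show "(\<lambda>p. P (X p) i) \<longlonglongrightarrow> P x i" if "i \<in> I" for i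
        unfolding P_def using 1(4) ei[OF that] by (auto intro!: tendsto_intros)
    qed (use 1 eI PB in auto)
  next
    case (2 x i)
    then show ?case using eI PB by (intro low) (auto simp: P_def)
  next
    case (3 x i)
    then show ?case using eI PB by (intro high) (auto simp: P_def)
  qed
  then obtain y where y: "\<forall>j<card I. 0 \<le> y j \<and> y j \<le> 1" "\<forall>j<card I. \<Phi> (P y) (e j) = 0" by auto
  have "\<Phi> (P y) i = 0" if "i \<in> I" for i using y(2) ei[OF that] by metis
  then show ?thesis using PB[OF y(1)] by blast
qed

section \<open>Trigonometric polynomials and discrete averages\<close>

text \<open>The mean over the \<open>M\<close>-th roots of unity: it is exact on trigonometric polynomials of degree less than
  \<open>M\<close>, and replaces the integral over a period.\<close>
definition gavg :: "nat \<Rightarrow> (real \<Rightarrow> 'a::real_vector) \<Rightarrow> 'a" where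
  "gavg M \<phi> = (1 / real M) *\<^sub>R (\<Sum>j<M. \<phi> (2 * pi * real j / real M))"

lemma gavg_add: "gavg M (\<lambda>t. f t + g t) = gavg M f + gavg M g"
  by (simp add: gavg_def sum.distrib scaleR_add_right)

lemma gavg_diff: "gavg M (\<lambda>t. f t - g t) = gavg M f - gavg M g"
  by (simp add: gavg_def sum_subtractf scaleR_diff_right)

lemma gavg_scaleR: "gavg M (\<lambda>t. c *\<^sub>R f t) = c *\<^sub>R gavg M f"
  by (simp add: gavg_def scaleR_sum_right mult.commute)

lemma gavg_cmult: "gavg M (\<lambda>t. c * f t) = c * gavg M f" for c :: real
  using gavg_scaleR[of M c f] by simp

lemma gavg_sum: "gavg M (\<lambda>t. \<Sum>i\<in>I. f i t) = (\<Sum>i\<in>I. gavg M (f i))"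
  unfolding gavg_def by (subst sum.swap) (simp add: scaleR_sum_right)

lemma gavg_const [simp]: "M > 0 \<Longrightarrow> gavg M (\<lambda>t. c) = c"
  by (simp add: gavg_def scaleR_sum_left[symmetric] sum_constant_scaleR)

lemma gavg_mono: "(\<And>t. f t \<le> g t) \<Longrightarrow> gavg M f \<le> gavg M (g :: real \<Rightarrow> real)"
  by (simp add: gavg_def sum_mono mult_left_mono divide_right_mono)

lemma gavg_nonneg: "(\<And>t. 0 \<le> g t) \<Longrightarrow> 0 \<le> gavg M (g :: real \<Rightarrow> real)"
  by (simp add: gavg_def sum_nonneg)

lemma gavg_linear: "bounded_linear L \<Longrightarrow> L (gavg M f) = gavg M (\<lambda>t. L (f t))"
  by (simp add: gavg_def bounded_linear.linear linear_scale linear_sum)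

lemma gavg_tendsto:
  fixes f :: "nat \<Rightarrow> real \<Rightarrow> 'a::real_normed_vector"
  shows "(\<And>t. (\<lambda>p. f p t) \<longlonglongrightarrow> g t) \<Longrightarrow> (\<lambda>p. gavg M (f p)) \<longlonglongrightarrow> gavg M g"
  unfolding gavg_def by (intro tendsto_intros)

text \<open>A geometric sum whose ratio \<open>w\<close> is an \<open>M\<close>-th root of unity: it
  vanishes unless \<open>w = 1\<close>, that is, unless \<open>M\<close> divides
  \<open>k\<close>.\<close>

lemma gavg_cis:
  assumes "M > 0"
  shows "gavg M (\<lambda>t. cis (of_int k * t)) = (if int M dvd k then 1 else 0)"
proof -
  define w where "w = cis (2 * pi * of_int k / real M)"
  have wj: "cis (of_int k * (2 * pi * real j / real M)) = w ^ j" for j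
    unfolding w_def Complex.DeMoivre by (rule arg_cong[of _ _ cis]) simp
  have wM: "w ^ M = 1"
    using assms by (simp add: w_def Complex.DeMoivre)
  show ?thesis
  proof (cases "int M dvd k")
    case True
    then obtain m where "k = int M * m" by blast
    then have "w = 1" using assms by (simp add: w_def) (metis cis_multiple_2pi Ints_of_int mult.assoc mult.commute)
    then show ?thesis unfolding gavg_def wj using True assms by (simp add: scaleR_conv_of_real)
  next
    case False
    have "w \<noteq> 1"
    proof
      assume "w = 1"
      then have "cos (2 * pi * of_int k / real M) = 1"
        by (simp add: w_def complex_eq_iff)
      then obtain x :: int where "2 * pi * of_int k / real M = real_of_int x * 2 * pi"
        using cos_one_2pi_int by blast
      then have "real_of_int k = real_of_int (x * int M)" using assms by (simp add: field_simps)
      then have "k = x * int M" by (simp only: of_int_eq_iff)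
      then show False using False by simp
    qed
    then have "(\<Sum>j<M. w ^ j) = 0" using wM by (simp add: geometric_sum)
    then show ?thesis unfolding gavg_def wj using False by simp
  qed
qed

lemma gavg_cos:
  assumes "M > 0"
  shows "gavg M (\<lambda>t. cos (of_int k * t)) = (if int M dvd k then 1 else 0)"
  using gavg_cis[OF assms, of k] gavg_linear[OF bounded_linear_Re, of M "\<lambda>t. cis (of_int k * t)"] by auto

section \<open>Reversible trigonometric polynomials and their discrete Fourier coefficients\<close>

definition mode :: "int \<Rightarrow> real \<Rightarrow> real^'n \<Rightarrow> (real^'n) \<times> (real^'n)" where
  "mode k t v = (cos (of_int k * t) *\<^sub>R v, sin (of_int k * t) *\<^sub>R v)"

definition trig :: "nat \<Rightarrow> (int \<Rightarrow> real^'n) \<Rightarrow> real \<Rightarrow> (real^'n) \<times> (real^'n)" where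
  "trig N a t = (\<Sum>k\<in>{- int N..int N}. mode k t (a k))"

text \<open>In the notation \<open>q + i p\<close> a mode is \<open>exp (i k t) v\<close> with real
  \<open>v\<close>, and this is the real part of the discrete Fourier coefficient of
  \<open>y\<close>. It is the adjoint of \<open>trig\<close> with respect to the discrete
  mean.\<close>

definition coef :: "nat \<Rightarrow> (real \<Rightarrow> (real^'n) \<times> (real^'n)) \<Rightarrow> int \<Rightarrow> real^'n" where
  "coef M y k = gavg M (\<lambda>t. cos (of_int k * t) *\<^sub>R fst (y t) + sin (of_int k * t) *\<^sub>R snd (y t))"

lemma mode_inner_mode: "mode k t v \<bullet> mode l t w = cos (of_int (k - l) * t) * (v \<bullet> w)"
  by (simp add: mode_def inner_prod_def cos_diff algebra_simps)

lemma norm_mode [simp]: "norm (mode k t v) = norm v"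
proof -
  have "(norm (mode k t v))\<^sup>2 = (norm v)\<^sup>2"
    by (simp add: power2_norm_eq_inner mode_inner_mode)
  then show ?thesis by simp
qed

lemma trig_add: "trig N (\<lambda>k. a k + b k) t = trig N a t + trig N b t"
  by (simp add: trig_def mode_def sum.distrib[symmetric] scaleR_add_right)

lemma fst_trig: "fst (trig N a t) = (\<Sum>k\<in>{- int N..int N}. cos (of_int k * t) *\<^sub>R a k)"
  by (simp add: trig_def mode_def fst_sum)

lemma snd_trig: "snd (trig N a t) = (\<Sum>k\<in>{- int N..int N}. sin (of_int k * t) *\<^sub>R a k)"
  by (simp add: trig_def mode_def snd_sum)

lemma norm_trig_le: "norm (trig N a t) \<le> (\<Sum>k\<in>{- int N..int N}. norm (a k))"
  unfolding trig_def by (rule order_trans[OF norm_sum]) simp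

lemma trig_tendsto:
  assumes "\<And>k. k \<in> {- int N..int N} \<Longrightarrow> (\<lambda>p. a p k) \<longlonglongrightarrow> b k"
  shows "(\<lambda>p. trig N (a p) t) \<longlonglongrightarrow> trig N b t"
  unfolding trig_def mode_def using assms by (intro tendsto_intros)

text \<open>Differences of frequencies are at most \<open>2 * N\<close> in absolute value, so
  \<open>2 * N + 1\<close> nodes cause no aliasing and only \<open>k = l\<close> survives.\<close>

lemma gavg_trig_inner:
  "gavg (2 * N + 1) (\<lambda>t. trig N a t \<bullet> trig N b t) = (\<Sum>k\<in>{- int N..int N}. a k \<bullet> b k)"
proof -
  have d: "int (2 * N + 1) dvd (k - l) \<longleftrightarrow> k = l" if "k \<in> {- int N..int N}" "l \<in> {- int N..int N}" for k l
    using that zdvd_imp_le[of "int (2*N+1)" "\<bar>k - l\<bar>"] by (cases "k = l") (force dest: zdvd_imp_le)+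
  have "gavg (2 * N + 1) (\<lambda>t. trig N a t \<bullet> trig N b t)
      = (\<Sum>k\<in>{- int N..int N}. \<Sum>l\<in>{- int N..int N}. gavg (2 * N + 1) (\<lambda>t. cos (of_int (k - l) * t)) * (a k \<bullet> b l))"
    by (simp add: trig_def inner_sum_left inner_sum_right mode_inner_mode gavg_sum mult.commute[of "cos _"] gavg_cmult
        del: of_int_diff) (subst sum.swap, simp add: mult.commute)
  also have "\<dots> = (\<Sum>k\<in>{- int N..int N}. \<Sum>l\<in>{- int N..int N}. if k = l then a k \<bullet> b l else 0)"
    by (intro sum.cong refl) (simp only: gavg_cos d, simp)
  finally show ?thesis by simp
qed

lemma gavg_trig_norm:
  "gavg (2 * N + 1) (\<lambda>t. (norm (trig N a t))\<^sup>2) = (\<Sum>k\<in>{- int N..int N}. (norm (a k))\<^sup>2)"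
  using gavg_trig_inner[of N a a] by (simp add: power2_norm_eq_inner)

lemma gavg_trig_coef:
  "gavg M (\<lambda>t. trig N a t \<bullet> y t) = (\<Sum>k\<in>{- int N..int N}. a k \<bullet> coef M y k)"
proof -
  have "a k \<bullet> coef M y k = gavg M (\<lambda>t. mode k t (a k) \<bullet> y t)" for k
    unfolding coef_def by (subst gavg_linear[OF bounded_linear_inner_right])
      (simp add: mode_def inner_prod_def inner_add_right)
  then show ?thesis by (simp add: trig_def inner_sum_left gavg_sum)
qed

text \<open>The mean square of \<open>y\<close> minus its projection \<open>trig N ?c\<close> is
  nonnegative. As \<open>y\<close> is arbitrary, pointwise bounds on a gradient become bounds on its
  coefficients that do not depend on \<open>N\<close>.\<close>

lemma bessel:
  "(\<Sum>k\<in>{- int N..int N}. (norm (coef (2 * N + 1) y k))\<^sup>2) \<le> gavg (2 * N + 1) (\<lambda>t. (norm (y t))\<^sup>2)"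
proof -
  let ?c = "coef (2 * N + 1) y"
  have "0 \<le> gavg (2 * N + 1) (\<lambda>t. (norm (y t - trig N ?c t))\<^sup>2)"
    by (rule gavg_nonneg) simp
  also have "(\<lambda>t. (norm (y t - trig N ?c t))\<^sup>2)
      = (\<lambda>t. (norm (y t))\<^sup>2 - 2 * (trig N ?c t \<bullet> y t) + (norm (trig N ?c t))\<^sup>2)"
    by (simp add: power2_norm_eq_inner algebra_simps inner_commute)
  also have "gavg (2 * N + 1) \<dots> = gavg (2 * N + 1) (\<lambda>t. (norm (y t))\<^sup>2) - (\<Sum>k\<in>{- int N..int N}. (norm (?c k))\<^sup>2)"
    by (simp only: gavg_add gavg_diff gavg_cmult gavg_trig_norm gavg_trig_coef) (simp add: power2_norm_eq_inner)
  finally show ?thesis by simp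
qed

lemma sum_sq_le_card: "(\<Sum>i\<in>I. x i)\<^sup>2 \<le> real (card I) * (\<Sum>i\<in>I. (x i)\<^sup>2)" for x :: "'i \<Rightarrow> real"
  using Cauchy_Schwarz_ineq_sum[of "\<lambda>_. 1" x I] by simp

text \<open>On the positive modes the \<open>L\<^sup>4\<close> norm is controlled by the \<open>H\<^bsup>1/2\<^esup>\<close> norm: the square of
  a polynomial in \<open>cis t\<close> is again one, and \<open>k (m - k) \<ge> m - 1\<close> for \<open>0 < k < m\<close>.\<close>
lemma gavg_cis_power4:
  fixes b :: "nat \<Rightarrow> real"
  assumes b0: "b 0 = 0" and bN: "\<And>k. k > N \<Longrightarrow> b k = 0"
  shows "gavg (2 * N + 1) (\<lambda>t. (cmod (\<Sum>k\<le>N. b k * cis (real k * t))) ^ 4) \<le> (\<Sum>k\<le>N. real k * (b k)\<^sup>2)\<^sup>2"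
proof -
  \<comment> \<open>The Cauchy product: coefficients of the squared polynomial. Since
    \<open>b 0 = 0\<close>, the first two of them vanish.\<close>
  define c where "c m = (\<Sum>k\<le>m. b k * b (m - k))" for m
  have X2: "(\<Sum>k\<le>N. b k * cis (real k * t))\<^sup>2 = (\<Sum>m\<le>2*N. c m * cis (real m * t))" for t
    using polynomial_product[of N "\<lambda>k. complex_of_real (b k)" N "\<lambda>k. complex_of_real (b k)" "cis t"] bN
    by (simp flip: Complex.DeMoivre add: power2_eq_square c_def mult_2)
  have cm0: "c 0 = 0" "c 1 = 0" by (simp_all add: c_def b0)
  have norm2: "(cmod (\<Sum>m\<le>2*N. c m * cis (real m * t)))\<^sup>2
       = (\<Sum>m\<in>{1..2*N}. \<Sum>l\<in>{1..2*N}. c m * c l * cos (of_int (int m - int l) * t))" for t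
  proof -
    have "(\<Sum>m\<le>2*N. c m * cis (real m * t)) = (\<Sum>m\<in>{1..2*N}. c m * cis (real m * t))"
      by (rule sum.mono_neutral_right) (auto simp: cm0 not_less_eq_eq)
    moreover have "(cmod (\<Sum>m\<in>{1..2*N}. c m * cis (real m * t)))\<^sup>2
      = (\<Sum>m\<in>{1..2*N}. c m * cos (real m * t))\<^sup>2 + (\<Sum>m\<in>{1..2*N}. c m * sin (real m * t))\<^sup>2"
      by (simp add: cmod_power2)
    moreover have "\<dots> = (\<Sum>m\<in>{1..2*N}. \<Sum>l\<in>{1..2*N}. c m * c l * cos (of_int (int m - int l) * t))"
      by (simp add: power2_eq_square sum_product sum.distrib[symmetric] left_diff_distrib cos_diff algebra_simps)
    ultimately show ?thesis by simp
  qed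
  have d: "int (2 * N + 1) dvd (int k - int l) \<longleftrightarrow> k = l" if "k \<in> {1..2*N}" "l \<in> {1..2*N}" for k l
    using that zdvd_imp_le[of "int (2*N+1)" "\<bar>int k - int l\<bar>"] by (cases "k = l") (force dest: zdvd_imp_le)+
  have "(\<lambda>t. (cmod (\<Sum>k\<le>N. b k * cis (real k * t))) ^ 4) = (\<lambda>t. (cmod (\<Sum>m\<le>2*N. c m * cis (real m * t)))\<^sup>2)"
    by (simp flip: X2 add: norm_power power_mult[symmetric])
  then have "gavg (2 * N + 1) (\<lambda>t. (cmod (\<Sum>k\<le>N. b k * cis (real k * t))) ^ 4)
     = (\<Sum>m\<in>{1..2*N}. \<Sum>l\<in>{1..2*N}. c m * c l * gavg (2 * N + 1) (\<lambda>t. cos (of_int (int m - int l) * t)))"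
    by (simp only: norm2 gavg_sum gavg_cmult)
  also have "\<dots> = (\<Sum>m\<in>{1..2*N}. \<Sum>l\<in>{1..2*N}. if m = l then c m * c l else 0)"
    by (intro sum.cong refl) (simp only: gavg_cos d, simp)
  also have "\<dots> = (\<Sum>m\<in>{1..2*N}. (c m)\<^sup>2)"
    by (simp add: power2_eq_square)
  also have "\<dots> \<le> (\<Sum>m\<in>{1..2*N}. \<Sum>k\<le>m. (real k * (b k)\<^sup>2) * (real (m - k) * (b (m - k))\<^sup>2))"
  proof (rule sum_mono)
    fix m assume "m \<in> {1..2*N}"
    have "c m = (\<Sum>k\<in>{1..<m}. b k * b (m - k))"
      unfolding c_def by (rule sum.mono_neutral_right) (auto simp: b0 not_less Suc_le_eq)
    then have "(c m)\<^sup>2 \<le> real (m - 1) * (\<Sum>k\<in>{1..<m}. (b k * b (m - k))\<^sup>2)"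
      using sum_sq_le_card[of "\<lambda>k. b k * b (m - k)" "{1..<m}"] by simp
    also have "\<dots> = (\<Sum>k\<in>{1..<m}. real (m - 1) * (b k * b (m - k))\<^sup>2)"
      by (rule sum_distrib_left)
    also have "\<dots> \<le> (\<Sum>k\<in>{1..<m}. (real k * (b k)\<^sup>2) * (real (m - k) * (b (m - k))\<^sup>2))"
    proof (rule sum_mono)
      fix k assume k: "k \<in> {1..<m}"
      have "m - 1 \<le> k * (m - k)"
      proof -
        obtain i j where "k = Suc i" "m - k = Suc j"
          using k by (metis Suc_diff_Suc Suc_pred' atLeastLessThan_iff less_eq_Suc_le One_nat_def)
        moreover from this have "m - 1 = i + j + 1" using k by auto
        ultimately show ?thesis by simp
      qed
      then have "real (m - 1) \<le> real k * real (m - k)" by (metis of_nat_le_iff of_nat_mult)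
      then have "real (m - 1) * (b k * b (m - k))\<^sup>2 \<le> (real k * real (m - k)) * (b k * b (m - k))\<^sup>2"
        by (rule mult_right_mono) simp
      then show "real (m - 1) * (b k * b (m - k))\<^sup>2 \<le> (real k * (b k)\<^sup>2) * (real (m - k) * (b (m - k))\<^sup>2)"
        by (simp add: power_mult_distrib mult_ac)
    qed
    also have "\<dots> \<le> (\<Sum>k\<le>m. (real k * (b k)\<^sup>2) * (real (m - k) * (b (m - k))\<^sup>2))"
      by (rule sum_mono2) auto
    finally show "(c m)\<^sup>2 \<le> \<dots>" .
  qed
  also have "\<dots> \<le> (\<Sum>m\<le>2*N. \<Sum>k\<le>m. (real k * (b k)\<^sup>2) * (real (m - k) * (b (m - k))\<^sup>2))"
    by (rule sum_mono2) (auto intro!: sum_nonneg)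
  \<comment> \<open>Again a Cauchy product, now of the sequence
    \<open>real k * (b k)\<^sup>2\<close> with itself, evaluated at 1.\<close>
  also have "\<dots> = (\<Sum>k\<le>N. real k * (b k)\<^sup>2)\<^sup>2"
    using polynomial_product[of N "\<lambda>k. real k * (b k)\<^sup>2" N "\<lambda>k. real k * (b k)\<^sup>2" 1] bN
    by (simp add: power2_eq_square mult_2)
  finally show ?thesis .
qed

text \<open>Each pair of components \<open>q_i + i p_i\<close> is a scalar polynomial in
  \<open>cis t\<close>, to which the scalar estimate applies. One factor \<open>CARD('n)\<close>
  comes from Cauchy--Schwarz over the components, the other from summing the bound over
  them.\<close>

lemma gavg_trig_power4:
  fixes a :: "int \<Rightarrow> real^'n"
  assumes a0: "\<And>k. k \<le> 0 \<Longrightarrow> a k = 0"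
  shows "gavg (2 * N + 1) (\<lambda>t. (norm (trig N a t)) ^ 4)
    \<le> real CARD('n) * (real CARD('n) * (\<Sum>k\<in>{- int N..int N}. of_int k * (norm (a k))\<^sup>2)\<^sup>2)"
proof -
  define b where "b i k = (if k \<le> N then a (int k) $ i else 0)" for i and k :: nat
  define X where "X i t = (\<Sum>k\<le>N. b i k * cis (real k * t))" for i t
  define S where "S = (\<Sum>k\<in>{- int N..int N}. of_int k * (norm (a k))\<^sup>2)"
  have reidx: "(\<Sum>k\<in>{- int N..int N}. g k) = (\<Sum>k\<le>N. g (int k))" if "\<And>k. k < 0 \<Longrightarrow> g k = 0" for g :: "int \<Rightarrow> 'b::comm_monoid_add"
  proof -
    have "(\<Sum>k\<in>{- int N..int N}. g k) = (\<Sum>k\<in>int ` {..N}. g k)"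
      by (rule sum.mono_neutral_right) (auto intro!: that simp: image_iff, metis atMost_iff nat_eq_iff2 not_less of_nat_le_iff)
    also have "\<dots> = (\<Sum>k\<le>N. g (int k))" by (subst sum.reindex) auto
    finally show ?thesis .
  qed
  have ReX: "Re (X i t) = fst (trig N a t) $ i" for i t
    unfolding X_def fst_trig by (subst reidx) (auto simp: a0 b_def sum_component mult.commute intro!: sum.cong)
  have ImX: "Im (X i t) = snd (trig N a t) $ i" for i t
    unfolding X_def snd_trig by (subst reidx) (auto simp: a0 b_def sum_component mult.commute intro!: sum.cong)
  have "(norm z)\<^sup>2 = (\<Sum>i\<in>UNIV. (fst z $ i)\<^sup>2 + (snd z $ i)\<^sup>2)" for z :: "(real^'n) \<times> (real^'n)"
    by (simp add: power2_norm_eq_inner inner_prod_def inner_vec_def sum.distrib power2_eq_square[of "_ $ _"])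
  then have "(norm (trig N a t))\<^sup>2 = (\<Sum>i\<in>UNIV. (cmod (X i t))\<^sup>2)" for t
    unfolding cmod_power2 ReX ImX .
  moreover have "(norm (trig N a t)) ^ 4 = ((norm (trig N a t))\<^sup>2)\<^sup>2" for t
    by (simp flip: power_mult)
  ultimately have "(norm (trig N a t)) ^ 4 = (\<Sum>i\<in>UNIV. (cmod (X i t))\<^sup>2)\<^sup>2" for t
    by (simp only:)
  also have "(\<Sum>i\<in>UNIV. (cmod (X i t))\<^sup>2)\<^sup>2 \<le> real CARD('n) * (\<Sum>i\<in>UNIV. (cmod (X i t)) ^ 4)" for t
    using sum_sq_le_card[of "\<lambda>i. (cmod (X i t))\<^sup>2" "UNIV :: 'n set"] by (simp add: power_mult[symmetric])
  finally have "gavg (2 * N + 1) (\<lambda>t. (norm (trig N a t)) ^ 4)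
     \<le> real CARD('n) * (\<Sum>i\<in>UNIV. gavg (2 * N + 1) (\<lambda>t. (cmod (X i t)) ^ 4))"
    using gavg_mono[of "\<lambda>t. (norm (trig N a t)) ^ 4" "\<lambda>t. real CARD('n) * (\<Sum>i\<in>UNIV. (cmod (X i t)) ^ 4)" "2*N+1"]
    by (simp only: gavg_cmult gavg_sum)
  also have "\<dots> \<le> real CARD('n) * (\<Sum>i\<in>(UNIV::'n set). S\<^sup>2)"
  proof (intro mult_left_mono sum_mono)
    fix i :: 'n
    have "gavg (2 * N + 1) (\<lambda>t. (cmod (X i t)) ^ 4) \<le> (\<Sum>k\<le>N. real k * (b i k)\<^sup>2)\<^sup>2"
      unfolding X_def by (rule gavg_cis_power4) (auto simp: b_def a0)
    also have "\<dots> \<le> S\<^sup>2"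
    proof (rule power_mono)
      have "S = (\<Sum>k\<le>N. real k * (norm (a (int k)))\<^sup>2)"
        unfolding S_def by (subst reidx) (auto simp: a0)
      moreover have "(b i k)\<^sup>2 \<le> (norm (a (int k)))\<^sup>2" for k
        using component_le_norm_cart[of "a (int k)" i] by (auto simp: b_def abs_le_square_iff[symmetric])
      ultimately show "(\<Sum>k\<le>N. real k * (b i k)\<^sup>2) \<le> S"
        by (auto intro!: sum_mono mult_left_mono)
    qed (auto intro!: sum_nonneg)
    finally show "gavg (2 * N + 1) (\<lambda>t. (cmod (X i t)) ^ 4) \<le> S\<^sup>2" .
  qed simp
  finally show ?thesis by (simp add: S_def)
qed

section \<open>Linking for the discretised action\<close>

text \<open>At infinity \<open>h\<close> is a quadratic form whose slope \<open>A\<close> in the coordinate plane \<open>i0\<close> lies between the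
  first two resonances, all other slopes \<open>e\<close> being below the first.\<close>
locale hz_hamiltonian =
  fixes h :: "(real^'n) \<times> (real^'n) \<Rightarrow> real"
    and g :: "(real^'n) \<times> (real^'n) \<Rightarrow> (real^'n) \<times> (real^'n)"
    and A e :: real and i0 :: 'n and q0 :: "real^'n" and D :: "real^'n \<Rightarrow> real^'n"
  defines "D \<equiv> (\<lambda>v. \<chi> i. (if i = i0 then A else e) * v $ i)"
  assumes deriv: "\<And>z. (h has_derivative (\<lambda>w. g z \<bullet> w)) (at z)"
    and cont_g: "continuous_on UNIV g"
    and A: "1 < A" "A < 2" and e: "0 < e" "e < 1"
    and quad: "\<exists>R c. \<forall>z. R \<le> norm z \<longrightarrow> h z = (D (fst z), D (snd z)) \<bullet> z / 2 + c \<and> g z = (D (fst z), D (snd z))"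
    and h_nonneg: "\<And>z. 0 \<le> h z"
    and h_zero: "\<exists>d>0. \<forall>w. norm w < d \<longrightarrow> h ((q0, 0) + w) = 0"
begin

abbreviation B where "B z \<equiv> (D (fst z), D (snd z))"

lemma D_add: "D (v + w) = D v + D w"
  and D_scaleR: "D (c *\<^sub>R v) = c *\<^sub>R D v"
  and D_inner: "D v \<bullet> w = v \<bullet> D w"
  by (simp_all add: D_def vec_eq_iff algebra_simps inner_vec_def)

lemma linear_D: "linear D"
  by (intro linearI D_add D_scaleR)

lemma bounded_linear_B: "bounded_linear B"
  by (auto intro!: linear_conv_bounded_linear[THEN iffD1] linearI simp: D_add D_scaleR)

lemma cont_h: "continuous_on UNIV h"
  unfolding continuous_on_eq_continuous_at[OF open_UNIV] using has_derivative_continuous[OF deriv] by blast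

lemma bounded_diff_quad:
  obtains C where "\<And>z. norm (g z - B z) \<le> C" "\<And>z. \<bar>h z - B z \<bullet> z / 2\<bar> \<le> C"
proof -
  obtain R c where R: "\<And>z. R \<le> norm z \<Longrightarrow> h z = B z \<bullet> z / 2 + c \<and> g z = B z" using quad by blast
  have cB: "continuous_on UNIV B"
    using bounded_linear_B by (rule linear_continuous_on)
  have "continuous_on UNIV (\<lambda>z. g z - B z)" "continuous_on UNIV (\<lambda>z. h z - B z \<bullet> z / 2)"
    by (intro continuous_on_diff continuous_on_divide continuous_on_inner cont_g cont_h cB continuous_on_id continuous_on_const; simp)+
  then have "compact ((\<lambda>z. g z - B z) ` cball 0 R)" "compact ((\<lambda>z. h z - B z \<bullet> z / 2) ` cball 0 R)"
    by (meson compact_continuous_image continuous_on_subset compact_cball top_greatest)+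
  then have "\<exists>C1. \<forall>z\<in>cball 0 R. norm (g z - B z) \<le> C1" "\<exists>C2. \<forall>z\<in>cball 0 R. \<bar>h z - B z \<bullet> z / 2\<bar> \<le> C2"
    unfolding real_norm_def[symmetric] by (metis (mono_tags, lifting) bounded_iff compact_imp_bounded imageI)+
  then obtain C1 C2 where C: "\<And>z. norm z \<le> R \<Longrightarrow> norm (g z - B z) \<le> C1" "\<And>z. norm z \<le> R \<Longrightarrow> \<bar>h z - B z \<bullet> z / 2\<bar> \<le> C2"
    by (meson mem_cball_0)
  show ?thesis
  proof
    show "norm (g z - B z) \<le> max 0 C1 + max \<bar>c\<bar> C2" "\<bar>h z - B z \<bullet> z / 2\<bar> \<le> max 0 C1 + max \<bar>c\<bar> C2" for z
      using C[of z] R[of z] by (cases "norm z \<le> R"; force)+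
  qed
qed

text \<open>Subtracting the linear map \<open>B\<close> leaves a continuous map that vanishes far
  out.\<close>

lemma uniformly_continuous_g: "uniformly_continuous_on UNIV g"
proof -
  obtain R c where R: "\<And>z. R \<le> norm z \<Longrightarrow> h z = B z \<bullet> z / 2 + c \<and> g z = B z" using quad by blast
  define k where "k z = g z - B z" for z
  have ck: "continuous_on UNIV k"
    unfolding k_def by (intro continuous_intros cont_g linear_continuous_on bounded_linear_B)
  then have "uniformly_continuous_on (cball 0 (R + 1)) k"
    by (intro compact_uniformly_continuous continuous_on_subset[OF ck]) auto
  then have "uniformly_continuous_on UNIV k"
    unfolding uniformly_continuous_on_def
  proof (intro allI impI)
    fix \<epsilon> :: real assume u: "\<forall>e>0. \<exists>d>0. \<forall>x\<in>cball 0 (R + 1). \<forall>x'\<in>cball 0 (R + 1). dist x' x < d \<longrightarrow> dist (k x') (k x) < e" "\<epsilon> > 0"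
    then obtain d where d: "d > 0" "\<And>x x'. x\<in>cball 0 (R + 1) \<Longrightarrow> x'\<in>cball 0 (R + 1) \<Longrightarrow> dist x' x < d \<Longrightarrow> dist (k x') (k x) < \<epsilon>"
      by metis
    have "dist (k x') (k x) < \<epsilon>" if "dist x' x < min d 1" for x x'
    proof (cases "norm x \<le> R + 1 \<and> norm x' \<le> R + 1")
      case False
      moreover have "\<bar>norm x' - norm x\<bar> < 1"
        using that norm_triangle_ineq3[of x' x] by (simp add: dist_norm)
      ultimately have "R \<le> norm x" "R \<le> norm x'" by auto
      then show ?thesis using R \<open>\<epsilon> > 0\<close> by (simp add: k_def)
    qed (use d that in auto)
    then show "\<exists>d>0. \<forall>x\<in>UNIV. \<forall>x'\<in>UNIV. dist x' x < d \<longrightarrow> dist (k x') (k x) < \<epsilon>"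
      using d(1) by (intro exI[of _ "min d 1"]) auto
  qed
  moreover have "uniformly_continuous_on UNIV B"
    by (rule bounded_linear.uniformly_continuous_on[OF bounded_linear_B uniformly_continuous_on_id])
  ultimately have "uniformly_continuous_on UNIV (\<lambda>z. k z + B z)"
    by (rule uniformly_continuous_on_add)
  then show ?thesis by (simp add: k_def)
qed

text \<open>The mean value inequality for \<open>h\<close> minus its linear part at
  \<open>z\<close>; uniform continuity of \<open>g\<close> makes \<open>d\<close> independent of
  \<open>z\<close>.\<close>

lemma uniform_taylor:
  assumes "\<eta> > 0"
  obtains d where "d > 0" "\<And>z w. norm w \<le> d \<Longrightarrow> \<bar>h (z + w) - h z - g z \<bullet> w\<bar> \<le> \<eta> * norm w"
proof -
  obtain d where d: "d > 0" "\<And>x x'. dist x' x < d \<Longrightarrow> dist (g x') (g x) < \<eta>"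
    using uniformly_continuous_g assms unfolding uniformly_continuous_on_def by (metis UNIV_I)
  have "\<bar>h (z + w) - h z - g z \<bullet> w\<bar> \<le> \<eta> * norm w" if w: "norm w \<le> d / 2" for z w
  proof -
    have "norm ((h (z + w) - g z \<bullet> (z + w)) - (h z - g z \<bullet> z)) \<le> \<eta> * norm ((z + w) - z)"
    proof (rule differentiable_bound[where S = "cball z (d/2)" and f' = "\<lambda>x v. g x \<bullet> v - g z \<bullet> v"])
      fix x assume x: "x \<in> cball z (d/2)"
      show "((\<lambda>x. h x - g z \<bullet> x) has_derivative (\<lambda>v. g x \<bullet> v - g z \<bullet> v)) (at x within cball z (d/2))"
        by (rule has_derivative_at_withinI) (intro derivative_intros deriv)
      show "onorm (\<lambda>v. g x \<bullet> v - g z \<bullet> v) \<le> \<eta>"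
      proof (rule onorm_le)
        fix v :: "(real^'n) \<times> (real^'n)"
        have "norm (g x - g z) \<le> \<eta>" using d(2)[of x z] x d(1) by (simp add: dist_norm norm_minus_commute)
        then have "norm (g x - g z) * norm v \<le> \<eta> * norm v" by (rule mult_right_mono) simp
        then show "norm (g x \<bullet> v - g z \<bullet> v) \<le> \<eta> * norm v"
          using Cauchy_Schwarz_ineq2[of "g x - g z" v] by (simp add: inner_diff_left)
      qed
    qed (use w d(1) in \<open>auto simp: dist_norm\<close>)
    then show ?thesis by (simp add: inner_add_right algebra_simps)
  qed
  then show ?thesis using d(1) by (intro that[of "d/2"]) auto
qed

text \<open>\<open>f\<close> is the action of \<open>trig N a\<close> divided by \<open>2\<pi>\<close>, and \<open>F\<close> is its gradient.\<close>
definition f :: "nat \<Rightarrow> (int \<Rightarrow> real^'n) \<Rightarrow> real" where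
  "f N a = (\<Sum>k\<in>{- int N..int N}. of_int k * (norm (a k))\<^sup>2) / 2 - gavg (2 * N + 1) (\<lambda>t. h (trig N a t))"

definition F :: "nat \<Rightarrow> (int \<Rightarrow> real^'n) \<Rightarrow> int \<Rightarrow> real^'n" where
  "F N a k = (if k \<in> {- int N..int N} then of_int k *\<^sub>R a k - coef (2 * N + 1) (\<lambda>t. g (trig N a t)) k else 0)"

text \<open>By \<open>gavg_trig_norm\<close> this is the root mean square of the loop
  \<open>trig N a\<close> over the nodes.\<close>

definition nm :: "nat \<Rightarrow> (int \<Rightarrow> real^'n) \<Rightarrow> real" where
  "nm N a = L2_set (\<lambda>k. norm (a k)) {- int N..int N}"

lemma nm_nonneg: "0 \<le> nm N a" by (simp add: nm_def L2_set_nonneg)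

lemma nm_sq: "(nm N a)\<^sup>2 = (\<Sum>k\<in>{- int N..int N}. (norm (a k))\<^sup>2)"
  by (simp add: nm_def L2_set_def sum_nonneg)

lemma norm_le_nm: "k \<in> {- int N..int N} \<Longrightarrow> norm (a k) \<le> nm N a"
  unfolding nm_def by (rule member_le_L2_set) auto

lemma nm_triangle: "nm N (\<lambda>k. a k + b k) \<le> nm N a + nm N b"
  unfolding nm_def by (rule order_trans[OF L2_set_mono L2_set_triangle_ineq]) (auto simp: norm_triangle_ineq)

lemma nm_scaleR: "nm N (\<lambda>k. c *\<^sub>R a k) = \<bar>c\<bar> * nm N a"
  unfolding nm_def by (simp add: L2_set_right_distrib)

lemma norm_trig_nm: "norm (trig N a t) \<le> real (2 * N + 1) * nm N a"
proof -
  have "norm (trig N a t) \<le> (\<Sum>k\<in>{- int N..int N}. nm N a)"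
    by (rule order_trans[OF norm_trig_le sum_mono]) (rule norm_le_nm)
  then show ?thesis by (simp add: add.commute)
qed

text \<open>\<open>h\<close> is only \<open>C^1\<close>, so the remainder is a small multiple of
  \<open>nm N v\<close> rather than quadratic. A one-sided bound that is uniform in \<open>a\<close>
  is what a descent step uses.\<close>

lemma f_expand:
  assumes "\<eta> > 0"
  obtains d where "d > 0"
    "\<And>a v. nm N v \<le> d \<Longrightarrow> f N (\<lambda>k. a k + v k) \<le> f N a + (\<Sum>k\<in>{- int N..int N}. F N a k \<bullet> v k) + \<eta> * nm N v"
proof -
  define M where "M = 2 * N + 1"
  define c where "c = real M"
  have c: "c > 0" by (simp add: c_def M_def)
  obtain d where d: "d > 0" "\<And>z w. norm w \<le> d \<Longrightarrow> \<bar>h (z + w) - h z - g z \<bullet> w\<bar> \<le> (\<eta> / (2 * c)) * norm w"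
    using uniform_taylor[of "\<eta> / (2 * c)"] assms c by auto
  \<comment> \<open>The first bound keeps \<open>trig N v\<close> within the range of the Taylor
    estimate; the second makes the quadratic term of the action at most half of the allowed
    error.\<close>
  define d' where "d' = min (d / c) (\<eta> / (c + 1))"
  have "f N (\<lambda>k. a k + v k) \<le> f N a + (\<Sum>k\<in>{- int N..int N}. F N a k \<bullet> v k) + \<eta> * nm N v" if v: "nm N v \<le> d'" for a v
  proof -
    have tv: "norm (trig N v t) \<le> c * nm N v" for t
      using norm_trig_nm[of N v t] by (simp add: c_def M_def)
    have "c * nm N v \<le> d" using v c by (simp add: d'_def field_simps)
    then have "h (trig N a t) + g (trig N a t) \<bullet> trig N v t - h (trig N (\<lambda>k. a k + v k) t) \<le> \<eta> / 2 * nm N v" for t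
      using d(2)[of "trig N v t" "trig N a t"] tv[of t] mult_left_mono[OF tv[of t], of "\<eta> / (2 * c)"] assms c
      by (simp add: trig_add abs_le_iff)
    then have "gavg M (\<lambda>t. h (trig N a t) + g (trig N a t) \<bullet> trig N v t - h (trig N (\<lambda>k. a k + v k) t)) \<le> gavg M (\<lambda>t. \<eta> / 2 * nm N v)"
      by (rule gavg_mono)
    then have 1: "gavg M (\<lambda>t. h (trig N a t)) + (\<Sum>k\<in>{- int N..int N}. v k \<bullet> coef M (\<lambda>t. g (trig N a t)) k)
        - gavg M (\<lambda>t. h (trig N (\<lambda>k. a k + v k) t)) \<le> \<eta> / 2 * nm N v"
      by (simp add: gavg_add gavg_diff M_def inner_commute[of "g _"] gavg_trig_coef)
    have 2: "(\<Sum>k\<in>{- int N..int N}. of_int k * (norm (a k + v k))\<^sup>2) / 2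
       = (\<Sum>k\<in>{- int N..int N}. of_int k * (norm (a k))\<^sup>2) / 2 + (\<Sum>k\<in>{- int N..int N}. (of_int k *\<^sub>R a k) \<bullet> v k)
         + (\<Sum>k\<in>{- int N..int N}. of_int k * (norm (v k))\<^sup>2) / 2"
      unfolding sum_divide_distrib sum.distrib[symmetric]
      by (intro sum.cong refl) (simp add: power2_norm_eq_inner inner_add_left inner_add_right inner_commute field_simps)
    have "(\<Sum>k\<in>{- int N..int N}. of_int k * (norm (v k))\<^sup>2) \<le> (\<Sum>k\<in>{- int N..int N}. real N * (norm (v k))\<^sup>2)"
    proof (intro sum_mono mult_right_mono)
      fix k assume "k \<in> {- int N..int N}"
      then have "real_of_int k \<le> real_of_int (int N)" by (subst of_int_le_iff) simp
      then show "real_of_int k \<le> real N" by simp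
    qed simp
    also have "\<dots> = real N * (nm N v)\<^sup>2" by (simp add: nm_sq sum_distrib_left)
    also have "\<dots> \<le> \<eta> * nm N v"
    proof -
      have "real N * nm N v \<le> (c + 1) * nm N v" using nm_nonneg[of N v] by (intro mult_right_mono) (auto simp: c_def M_def)
      also have "\<dots> \<le> (c + 1) * (\<eta> / (c + 1))" using v c by (intro mult_left_mono) (auto simp: d'_def)
      finally have "real N * nm N v \<le> \<eta>" using c by simp
      then have "real N * nm N v * nm N v \<le> \<eta> * nm N v" using nm_nonneg by (rule mult_right_mono)
      then show ?thesis by (simp add: power2_eq_square mult.assoc)
    qed
    finally have 3: "(\<Sum>k\<in>{- int N..int N}. of_int k * (norm (v k))\<^sup>2) \<le> \<eta> * nm N v" .
    have 4: "(\<Sum>k\<in>{- int N..int N}. F N a k \<bullet> v k) = (\<Sum>k\<in>{- int N..int N}. (of_int k *\<^sub>R a k) \<bullet> v k)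
        - (\<Sum>k\<in>{- int N..int N}. v k \<bullet> coef M (\<lambda>t. g (trig N a t)) k)"
      unfolding sum_subtractf[symmetric] by (intro sum.cong) (auto simp: F_def M_def inner_diff_left inner_diff_right inner_commute)
    show ?thesis using 1 2 3 4 unfolding f_def M_def by linarith
  qed
  moreover have "d' > 0" using d(1) c assms by (simp add: d'_def)
  ultimately show ?thesis using that by blast
qed

text \<open>At infinity \<open>F\<close> is the diagonal operator \<open>k - D\<close>, whose
  eigenvalues \<open>k - A\<close> and \<open>k - e\<close> stay away from 0 because
  \<open>A\<close> and \<open>e\<close> lie strictly between integers. The rest consists of
  coefficients of the bounded map \<open>g - B\<close>, controlled by Bessel's inequality. Neither
  constant depends on \<open>N\<close>.\<close>

lemma F_coercive:
  obtains \<kappa> C where "\<kappa> > 0" "\<And>N a. \<kappa> * nm N a - C \<le> nm N (F N a)"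
proof -
  obtain C where C: "\<And>z. norm (g z - B z) \<le> C" by (rule bounded_diff_quad, rule that)
  define \<kappa> where "\<kappa> = min (min (A - 1) (2 - A)) (min e (1 - e))"
  have "0 < A - 1" using A(1) by simp
  moreover have "0 < 2 - A" using A(2) by simp
  moreover have "0 < 1 - e" using e(2) by simp
  ultimately have "\<kappa> > 0" unfolding \<kappa>_def using e(1) by (intro min_less_iff_conj[THEN iffD2] conjI)
  moreover have "\<kappa> \<le> A - 1" "\<kappa> \<le> 2 - A" "\<kappa> \<le> e" "\<kappa> \<le> 1 - e"
    unfolding \<kappa>_def by (meson min.cobounded1 min.cobounded2 order_trans)+
  ultimately have \<kappa>: "\<kappa> > 0" "\<kappa> \<le> A - 1" "\<kappa> \<le> 2 - A" "\<kappa> \<le> e" "\<kappa> \<le> 1 - e" by auto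
  have gap: "\<kappa> \<le> \<bar>of_int k - A\<bar>" "\<kappa> \<le> \<bar>of_int k - e\<bar>" for k :: int
  proof -
    have "k \<le> 1 \<or> 2 \<le> k" "k \<le> 0 \<or> 1 \<le> k" by auto
    then have "real_of_int k \<le> 1 \<or> 2 \<le> real_of_int k" "real_of_int k \<le> 0 \<or> 1 \<le> real_of_int k"
      by (metis of_int_le_iff of_int_1 of_int_numeral of_int_0)+
    then show "\<kappa> \<le> \<bar>of_int k - A\<bar>" "\<kappa> \<le> \<bar>of_int k - e\<bar>" using \<kappa>(2-5) A e by (linarith+)
  qed
  have "\<kappa> * nm N a - C \<le> nm N (F N a)" for N a
  proof -
    define M where "M = 2 * N + 1"
    define y where "y t = g (trig N a t) - B (trig N a t)" for t
    have C0: "0 \<le> C" using C norm_ge_zero order_trans by blast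
    have cB: "coef M (\<lambda>t. B (trig N a t)) k = D (a k)" if k: "k \<in> {- int N..int N}" for k
    proof (rule vector_eq_ldot[THEN iffD1], rule allI)
      fix v
      have "v \<bullet> coef M (\<lambda>t. B (trig N a t)) k = gavg M (\<lambda>t. trig N (\<lambda>l. if l = k then v else 0) t \<bullet> B (trig N a t))"
        unfolding gavg_trig_coef using k by (simp add: if_distrib[of "\<lambda>x. x \<bullet> _"] cong: if_cong)
      also have "(\<lambda>t. trig N (\<lambda>l. if l = k then v else 0) t \<bullet> B (trig N a t)) = (\<lambda>t. trig N (\<lambda>l. if l = k then v else 0) t \<bullet> trig N (\<lambda>l. D (a l)) t)"
        by (simp add: inner_prod_def fst_trig snd_trig linear_sum[OF linear_D] D_scaleR)
      also have "gavg M \<dots> = v \<bullet> D (a k)"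
        unfolding M_def gavg_trig_inner using k by (simp add: if_distrib[of "\<lambda>x. x \<bullet> _"] cong: if_cong)
      finally show "v \<bullet> coef M (\<lambda>t. B (trig N a t)) k = v \<bullet> D (a k)" .
    qed
    have coef_add: "coef M (\<lambda>t. g (trig N a t)) k = coef M y k + coef M (\<lambda>t. B (trig N a t)) k" for k
      unfolding coef_def gavg_add[symmetric] by (simp add: y_def scaleR_diff_right)
    have eq: "of_int k *\<^sub>R a k - D (a k) = F N a k + coef M y k" if "k \<in> {- int N..int N}" for k
      using that coef_add[of k] cB[OF that] by (simp add: F_def M_def)
    have "\<kappa> * norm v \<le> norm (of_int k *\<^sub>R v - D v)" for k :: int and v
    proof -
      have nsq: "(norm u)\<^sup>2 = (\<Sum>i\<in>UNIV. (u $ i)\<^sup>2)" for u :: "real^'n"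
        by (simp add: power2_norm_eq_inner inner_vec_def power2_eq_square[of "_ $ _"])
      have "(\<kappa> * norm v)\<^sup>2 = (\<Sum>i\<in>UNIV. (\<kappa> * \<bar>v $ i\<bar>)\<^sup>2)"
        by (simp add: power_mult_distrib nsq sum_distrib_left)
      also have "\<dots> \<le> (\<Sum>i\<in>UNIV. ((of_int k *\<^sub>R v - D v) $ i)\<^sup>2)"
      proof (rule sum_mono)
        fix i
        have "\<kappa> * \<bar>v $ i\<bar> \<le> \<bar>(of_int k *\<^sub>R v - D v) $ i\<bar>"
          using gap[of k] by (auto simp: D_def left_diff_distrib[symmetric] abs_mult intro!: mult_right_mono)
        then show "(\<kappa> * \<bar>v $ i\<bar>)\<^sup>2 \<le> ((of_int k *\<^sub>R v - D v) $ i)\<^sup>2"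
          using \<kappa>(1) by (metis abs_ge_zero less_imp_le mult_nonneg_nonneg power2_abs power_mono)
      qed
      also have "\<dots> = (norm (of_int k *\<^sub>R v - D v))\<^sup>2"
        by (rule nsq[symmetric])
      finally show ?thesis by (rule power2_le_imp_le) simp
    qed
    then have "nm N (\<lambda>k. \<kappa> *\<^sub>R a k) \<le> nm N (\<lambda>k. of_int k *\<^sub>R a k - D (a k))"
      unfolding nm_def using \<kappa>(1) by (intro L2_set_mono) auto
    also have "\<dots> = nm N (\<lambda>k. F N a k + coef M y k)"
      unfolding nm_def by (intro L2_set_cong) (auto simp: eq)
    also have "\<dots> \<le> nm N (F N a) + nm N (coef M y)" by (rule nm_triangle)
    also have "nm N (coef M y) \<le> C"
    proof (rule power2_le_imp_le[OF _ C0])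
      have "(nm N (coef M y))\<^sup>2 \<le> gavg M (\<lambda>t. (norm (y t))\<^sup>2)"
        unfolding nm_sq M_def by (rule bessel)
      also have "\<dots> \<le> gavg M (\<lambda>t. C\<^sup>2)"
        by (intro gavg_mono power_mono) (auto simp: y_def C)
      finally show "(nm N (coef M y))\<^sup>2 \<le> C\<^sup>2" by (simp add: M_def)
    qed
    finally show ?thesis using \<kappa>(1) by (simp add: nm_scaleR)
  qed
  then show ?thesis using \<kappa>(1) that by blast
qed

lemma h_tendsto: "(X \<longlonglongrightarrow> z) \<Longrightarrow> (\<lambda>p. h (X p)) \<longlonglongrightarrow> h z"
  using isCont_tendsto_compose[of z h X] cont_h unfolding continuous_on_eq_continuous_at[OF open_UNIV] by blast

lemma g_tendsto: "(X \<longlonglongrightarrow> z) \<Longrightarrow> (\<lambda>p. g (X p)) \<longlonglongrightarrow> g z"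
  using isCont_tendsto_compose[of z g X] cont_g unfolding continuous_on_eq_continuous_at[OF open_UNIV] by blast

lemma f_tendsto:
  assumes "\<And>k. k \<in> {- int N..int N} \<Longrightarrow> (\<lambda>p. a p k) \<longlonglongrightarrow> b k"
  shows "(\<lambda>p. f N (a p)) \<longlonglongrightarrow> f N b"
  unfolding f_def using assms by (intro tendsto_intros gavg_tendsto h_tendsto trig_tendsto) auto

lemma F_tendsto:
  assumes "\<And>k. k \<in> {- int N..int N} \<Longrightarrow> (\<lambda>p. a p k) \<longlonglongrightarrow> b k"
  shows "(\<lambda>p. F N (a p) k) \<longlonglongrightarrow> F N b k"
  unfolding F_def coef_def using assms
  by (cases "k \<in> {- int N..int N}") (auto intro!: tendsto_intros gavg_tendsto g_tendsto trig_tendsto)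

lemma nm_tendsto:
  assumes "\<And>k. k \<in> {- int N..int N} \<Longrightarrow> (\<lambda>p. a p k) \<longlonglongrightarrow> b k"
  shows "(\<lambda>p. nm N (a p)) \<longlonglongrightarrow> nm N b"
  unfolding nm_def L2_set_def using assms by (intro tendsto_intros)

text \<open>Otherwise the gradients tend to 0 along a sequence at levels at least \<open>b\<close>.
  Coercivity keeps it bounded, and the limit of a subsequence would be a critical point at such a
  level.\<close>

lemma palais_smale:
  assumes "\<And>a. f N a \<ge> b \<Longrightarrow> nm N (F N a) \<noteq> 0"
  obtains \<kappa> where "\<kappa> > 0" "\<And>a. f N a \<ge> b \<Longrightarrow> nm N (F N a) \<ge> \<kappa>"
proof (rule ccontr)
  assume "\<not> thesis"
  then have "\<forall>\<kappa>>0. \<exists>a. f N a \<ge> b \<and> nm N (F N a) < \<kappa>" using that by (meson not_le)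
  then have "\<forall>p. \<exists>a. f N a \<ge> b \<and> nm N (F N a) < 1 / real (Suc p)" by simp
  then obtain a where a: "\<And>p. f N (a p) \<ge> b" "\<And>p. nm N (F N (a p)) < 1 / real (Suc p)" by metis
  obtain \<kappa> C where \<kappa>: "\<kappa> > 0" "\<And>N a. \<kappa> * nm N a - C \<le> nm N (F N a)" using F_coercive by blast
  have bd: "nm N (a p) \<le> (C + 1) / \<kappa>" for p
  proof -
    have "nm N (F N (a p)) < 1" using a(2)[of p] by (rule less_le_trans) simp
    then have "\<kappa> * nm N (a p) \<le> C + 1" using \<kappa>(2)[of N "a p"] by linarith
    then show ?thesis using \<kappa>(1) by (simp add: field_simps)
  qed
  have "\<exists>l r. strict_mono (r::nat\<Rightarrow>nat) \<and> (\<forall>k\<in>{- int N..int N}. (\<lambda>p. a (r p) k) \<longlonglongrightarrow> l k)"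
    by (rule finite_coord_subseq) (use bd norm_le_nm order_trans in \<open>auto intro!: boundedI, blast\<close>)
  then obtain l r where r: "strict_mono (r::nat\<Rightarrow>nat)" "\<And>k. k\<in>{- int N..int N} \<Longrightarrow> (\<lambda>p. a (r p) k) \<longlonglongrightarrow> l k" by blast
  have "b \<le> f N l" by (rule LIMSEQ_le_const[OF f_tendsto[OF r(2)]]) (use a(1) in auto)
  moreover have "nm N (F N l) = 0"
  proof -
    have "(\<lambda>p. nm N (F N (a (r p)))) \<longlonglongrightarrow> nm N (F N l)"
      by (intro nm_tendsto F_tendsto r(2))
    moreover have "(\<lambda>p. nm N (F N (a (r p)))) \<longlonglongrightarrow> 0"
    proof (rule tendsto_sandwich[of "\<lambda>_. 0" _ _ "\<lambda>p. 1 / real (Suc (r p))"])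
      show "(\<lambda>p. 1 / real (Suc (r p))) \<longlonglongrightarrow> 0"
        using LIMSEQ_subseq_LIMSEQ[OF LIMSEQ_inverse_real_of_nat r(1)] by (simp add: o_def inverse_eq_divide)
      show "\<forall>\<^sub>F p in sequentially. nm N (F N (a (r p))) \<le> 1 / real (Suc (r p))"
        using a(2) less_imp_le by (intro always_eventually allI) blast
    qed (auto intro!: always_eventually simp: nm_nonneg)
    ultimately show ?thesis using LIMSEQ_unique by blast
  qed
  ultimately show False using assms by blast
qed

text \<open>If there is no critical point at levels \<open>\<ge> b\<close>, then finitely many truncated steps of
  steepest descent push everything below a prescribed level above \<open>b\<close>, fixing what lies below \<open>b\<close>.\<close>
lemma deformation:
  assumes "\<And>a. f N a \<ge> b \<Longrightarrow> nm N (F N a) \<noteq> 0" "b < c"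
  obtains T :: "(int \<Rightarrow> real^'n) \<Rightarrow> int \<Rightarrow> real^'n" where
    "\<And>a. f N a \<le> b \<Longrightarrow> T a = a" "\<And>a. f N a \<le> m \<Longrightarrow> f N (T a) < c"
    "\<And>a a'. (\<And>k. (\<lambda>p. a p k) \<longlonglongrightarrow> a' k) \<Longrightarrow> (\<And>k. (\<lambda>p::nat. T (a p) k) \<longlonglongrightarrow> T a' k)"
proof -
  obtain \<kappa> where \<kappa>: "\<kappa> > 0" "\<And>a. f N a \<ge> b \<Longrightarrow> nm N (F N a) \<ge> \<kappa>"
    using palais_smale[OF assms(1)] by blast
  obtain d where d: "d > 0"
    "\<And>a v. nm N v \<le> d \<Longrightarrow> f N (\<lambda>k. a k + v k) \<le> f N a + (\<Sum>k\<in>{- int N..int N}. F N a k \<bullet> v k) + \<kappa> / 2 * nm N v"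
    using f_expand[of "\<kappa> / 2"] \<kappa>(1) by auto
  \<comment> \<open>Zero up to level \<open>b\<close>, one from the midpoint of \<open>b\<close> and
    \<open>c\<close> on: steps above \<open>c\<close> have full strength.\<close>
  define cut where "cut s = min 1 (max 0 ((s - b) / ((c - b) / 2)))" for s
  have cut: "0 \<le> cut s" "cut s \<le> 1" for s by (auto simp: cut_def)
  \<comment> \<open>Dividing by the norm of the gradient bounds the step length by \<open>d\<close>;
    the maximum with \<open>\<kappa>\<close> keeps the quotient continuous where the gradient may
    vanish.\<close>
  define u where "u a = d * cut (f N a) / max \<kappa> (nm N (F N a))" for a
  define T where "T a k = a k + (- u a) *\<^sub>R F N a k" for a k
  have Tid: "T a = a" if "f N a \<le> b" for a
  proof -
    have "(f N a - b) / ((c - b) / 2) \<le> 0"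
      using that assms(2) by (intro divide_nonpos_pos) auto
    then have "cut (f N a) = 0" by (simp add: cut_def)
    then show ?thesis by (simp add: T_def u_def fun_eq_iff)
  qed
  have step: "f N (T a) \<le> f N a - \<kappa> / 2 * (d * cut (f N a))" for a
  proof (cases "f N a \<ge> b")
    case True
    have n: "nm N (F N a) \<ge> \<kappa>" using \<kappa>(2)[OF True] .
    have u: "u a * nm N (F N a) = d * cut (f N a)" "0 \<le> u a"
      using n \<kappa>(1) d(1) cut by (auto simp: u_def max_def)
    then have nv: "nm N (\<lambda>k. (- u a) *\<^sub>R F N a k) = d * cut (f N a)" by (simp only: nm_scaleR) simp
    have "f N (T a) \<le> f N a + (\<Sum>k\<in>{- int N..int N}. F N a k \<bullet> ((- u a) *\<^sub>R F N a k)) + \<kappa> / 2 * nm N (\<lambda>k. (- u a) *\<^sub>R F N a k)"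
      unfolding T_def by (rule d(2)) (use nv cut[of "f N a"] d(1) in \<open>simp add: mult_left_le\<close>)
    also have "(\<Sum>k\<in>{- int N..int N}. F N a k \<bullet> ((- u a) *\<^sub>R F N a k)) = - (u a * nm N (F N a)) * nm N (F N a)"
      using nm_sq[of N "F N a"] by (simp add: sum_negf sum_distrib_left[symmetric] dot_square_norm power2_eq_square mult.assoc)
    also have "\<dots> \<le> - (u a * nm N (F N a)) * \<kappa>"
      using n u cut[of "f N a"] d(1) by (simp add: mult_left_mono)
    finally show ?thesis unfolding nv u(1) by (simp add: field_simps)
  next
    case False
    then have "(f N a - b) / ((c - b) / 2) \<le> 0" using assms(2) by (intro divide_nonpos_pos) auto
    then show ?thesis using Tid[of a] False by (simp add: cut_def)
  qed
  have Tcont: "(\<lambda>p::nat. T (a p) k) \<longlonglongrightarrow> T a' k" if "\<And>k. (\<lambda>p. a p k) \<longlonglongrightarrow> a' k" for a a' k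
    unfolding T_def u_def cut_def using that \<kappa>(1) assms(2)
    by (intro tendsto_intros F_tendsto f_tendsto nm_tendsto) auto
  \<comment> \<open>The guaranteed gain of a full step: descent \<open>d * \<kappa>\<close> minus
    the expansion error \<open>d * \<kappa> / 2\<close>.\<close>
  define w where "w = \<kappa> / 2 * d"
  have w: "w > 0" using \<kappa> d by (simp add: w_def)
  have pow: "f N ((T ^^ n) a) < c \<or> f N ((T ^^ n) a) \<le> m - real n * w" if "f N a \<le> m" for a n
  proof (induction n)
    case 0
    then show ?case using that by simp
  next
    case (Suc n)
    let ?a = "(T ^^ n) a"
    have le: "f N (T ?a) \<le> f N ?a" using step[of ?a] \<kappa>(1) d(1) cut[of "f N ?a"] by (smt (verit) mult_nonneg_nonneg divide_nonneg_nonneg)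
    show ?case
    proof (cases "f N ?a < c")
      case True
      then show ?thesis using le by simp
    next
      case False
      then have "(c - b) / 2 \<le> f N ?a - b" using assms(2) by simp
      then have "1 \<le> (f N ?a - b) / ((c - b) / 2)" using assms(2) by simp
      then have "cut (f N ?a) = 1" by (simp add: cut_def)
      then have "f N (T ?a) \<le> f N ?a - w" using step[of ?a] by (simp add: w_def)
      then show ?thesis using Suc False by (auto simp: algebra_simps)
    qed
  qed
  obtain n where "m - c < real n * w" using w reals_Archimedean3 by blast
  then have B: "f N ((T ^^ n) a) < c" if "f N a \<le> m" for a using pow[OF that, of n] by auto
  have A: "(T ^^ n) a = a" if "f N a \<le> b" for a
    by (induction n) (auto simp: Tid that)
  have C: "(\<lambda>p::nat. (T ^^ n) (a p) k) \<longlonglongrightarrow> (T ^^ n) a' k" if "\<And>k. (\<lambda>p. a p k) \<longlonglongrightarrow> a' k" for a a' k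
  proof (induction n arbitrary: k)
    case (Suc n)
    then show ?case using Tcont[of "\<lambda>p. (T ^^ n) (a p)" "(T ^^ n) a'"] by simp
  qed (use that in simp)
  show ?thesis by (rule that[of "T ^^ n"]) (use A B C in blast)+
qed

end

section \<open>Linking geometry and existence of critical points\<close>

context hz_hamiltonian begin

lemma B_trig: "B (trig N a t) = trig N (\<lambda>l. D (a l)) t"
  by (simp add: prod_eq_iff fst_trig snd_trig linear_sum[OF linear_D] D_scaleR)

lemma D_inner_ge: "e * (norm v)\<^sup>2 \<le> D v \<bullet> v"
proof -
  have "e * (norm v)\<^sup>2 = (\<Sum>i\<in>UNIV. e * (v $ i * v $ i))"
    by (simp add: power2_norm_eq_inner inner_vec_def sum_distrib_left)
  also have "\<dots> \<le> (\<Sum>i\<in>UNIV. (if i = i0 then A else e) * (v $ i * v $ i))"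
    using A e by (intro sum_mono mult_right_mono) auto
  also have "\<dots> = D v \<bullet> v" by (simp add: D_def inner_vec_def mult.assoc)
  finally show ?thesis .
qed

text \<open>\<open>h\<close> vanishes near \<open>(q0, 0)\<close>, and at distance at least
  \<open>d\<close> quadratic growth is dominated by the fourth power after division by powers of
  \<open>d\<close>. The exponent matches the \<open>L^4\<close> estimate for the positive
  modes.\<close>

lemma h_le_power4:
  obtains C where "C > 0" "\<And>w. h ((q0, 0) + w) \<le> C * norm w ^ 4"
proof -
  obtain d where d: "d > 0" "\<And>w. norm w < d \<Longrightarrow> h ((q0, 0) + w) = 0" using h_zero by blast
  obtain C0 where C0: "\<And>z. \<bar>h z - B z \<bullet> z / 2\<bar> \<le> C0" by (rule bounded_diff_quad, rule that)
  obtain K where K: "K > 0" "\<And>z. norm (B z) \<le> norm z * K"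
    using bounded_linear.pos_bounded[OF bounded_linear_B] by blast
  have C00: "0 \<le> C0" using C0[of 0] by linarith
  define C where "C = (C0 + K * (norm q0)\<^sup>2) / d ^ 4 + K / d\<^sup>2"
  have "h ((q0, 0) + w) \<le> C * norm w ^ 4" for w
  proof (cases "norm w < d")
    case True
    then show ?thesis using d K C00 by (simp add: C_def)
  next
    case False
    let ?z = "(q0, 0) + w" and ?n = "norm w"
    have "B ?z \<bullet> ?z \<le> norm (B ?z) * norm ?z" by (rule norm_cauchy_schwarz)
    also have "\<dots> \<le> (norm ?z * K) * norm ?z" by (intro mult_right_mono K) simp
    also have "\<dots> = K * (norm ?z)\<^sup>2" by (simp add: power2_eq_square)
    also have "\<dots> \<le> K * (2 * ((norm q0)\<^sup>2 + ?n\<^sup>2))"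
    proof (rule mult_left_mono)
      have "norm ?z \<le> norm q0 + ?n" using norm_triangle_ineq[of "(q0, 0)" w] by simp
      then have "(norm ?z)\<^sup>2 \<le> (norm q0 + ?n)\<^sup>2" by (rule power_mono) simp
      also have "\<dots> \<le> 2 * ((norm q0)\<^sup>2 + ?n\<^sup>2)" by (smt (verit) sum_squares_bound power2_sum)
      finally show "(norm ?z)\<^sup>2 \<le> 2 * ((norm q0)\<^sup>2 + ?n\<^sup>2)" .
    qed (use K in simp)
    also have "\<dots> = 2 * (K * (norm q0)\<^sup>2) + 2 * (K * ?n\<^sup>2)" by (simp add: algebra_simps)
    finally have s: "B ?z \<bullet> ?z \<le> 2 * (K * (norm q0)\<^sup>2) + 2 * (K * ?n\<^sup>2)" .
    have "h ?z - B ?z \<bullet> ?z / 2 \<le> C0" using C0 by (rule abs_le_D1)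
    with s have 1: "h ?z \<le> (C0 + K * (norm q0)\<^sup>2) + K * ?n\<^sup>2" by linarith
    have r: "1 \<le> ?n / d" using False d(1) by simp
    have 2: "1 \<le> (?n / d) ^ 4" using r by (rule one_le_power)
    have "?n\<^sup>2 * 1 \<le> ?n\<^sup>2 * (?n / d)\<^sup>2" using one_le_power[OF r] by (intro mult_left_mono) auto
    then have 3: "?n\<^sup>2 \<le> ?n ^ 4 / d\<^sup>2" by (simp add: power_divide power_add[symmetric])
    have "h ?z \<le> (C0 + K * (norm q0)\<^sup>2) * (?n / d) ^ 4 + K * (?n ^ 4 / d\<^sup>2)"
      using mult_left_mono[OF 2, of "C0 + K * (norm q0)\<^sup>2"] mult_left_mono[OF 3, of K] K(1) C00 1 by simp
    also have "\<dots> = C * ?n ^ 4" by (simp add: C_def field_simps)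
    finally show ?thesis .
  qed
  moreover have "C > 0" using K d C00 by (auto simp: C_def intro!: add_nonneg_pos divide_nonneg_pos)
  ultimately show ?thesis using that by blast
qed

text \<open>On the positive modes, shifted by the constant loop \<open>(q0, 0)\<close>, the
  quadratic part of the action is \<open>\<rho>\<^sup>2 / 2\<close>, while the mean of
  \<open>h\<close> is of order \<open>\<rho>^4\<close> with a constant that does not depend on
  \<open>N\<close>.\<close>

lemma f_on_sphere:
  shows "\<exists>\<beta> \<rho>. 0 < \<beta> \<and> 0 < \<rho> \<and>
    (\<forall>N a. a 0 = q0 \<longrightarrow> (\<forall>k\<in>{- int N..-1}. a k = 0) \<longrightarrow>
       (\<Sum>k\<in>{1..int N}. of_int k * (norm (a k))\<^sup>2) = \<rho>\<^sup>2 \<longrightarrow> \<beta> \<le> f N a)"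
proof -
  obtain C where C: "C > 0" "\<And>w. h ((q0, 0) + w) \<le> C * norm w ^ 4" by (rule h_le_power4, rule that)
  define n where "n = real CARD('n)"
  have n: "n > 0" by (simp add: n_def)
  \<comment> \<open>With this radius the quartic bound equals \<open>\<rho>\<^sup>2 / 4\<close>,
    half of the quadratic part.\<close>
  define \<rho> where "\<rho> = 1 / (2 * n * sqrt C)"
  have \<rho>: "\<rho> > 0" using n C by (simp add: \<rho>_def)
  have \<rho>2: "C * (n * (n * (\<rho>\<^sup>2)\<^sup>2)) = \<rho>\<^sup>2 / 4"
    using n C by (simp add: \<rho>_def power_divide power_mult_distrib field_simps power2_eq_square)
  have "\<rho>\<^sup>2 / 4 \<le> f N a"
    if a0: "a 0 = q0" and an: "\<And>k. k \<in> {- int N..-1} \<Longrightarrow> a k = 0"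
      and S: "(\<Sum>k\<in>{1..int N}. of_int k * (norm (a k))\<^sup>2) = \<rho>\<^sup>2" for N a
  proof -
    define x where "x k = (if k \<ge> 1 then a k else 0)" for k
    define y where "y k = (if k = 0 then q0 else 0)" for k :: int
    have "trig N a t = trig N (\<lambda>k. x k + y k) t" for t
      unfolding trig_def by (intro sum.cong refl arg_cong[of _ _ "mode _ t"])
        (auto simp: x_def y_def a0 an)
    moreover have "trig N y t = (q0, 0)" for t
    proof -
      have "trig N y t = (\<Sum>k\<in>{- int N..int N}. if k = 0 then (q0, 0) else 0)"
        unfolding trig_def by (intro sum.cong refl) (auto simp: y_def mode_def zero_prod_def)
      then show ?thesis by simp
    qed
    ultimately have tr: "trig N a t = (q0, 0) + trig N x t" for t
      by (simp add: trig_add add.commute)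
    have S1: "(\<Sum>k\<in>{- int N..int N}. of_int k * (norm (u k))\<^sup>2) = \<rho>\<^sup>2"
      if "\<And>k. k \<in> {1..int N} \<Longrightarrow> u k = a k" "\<And>k. k \<in> {- int N..-1} \<Longrightarrow> u k = 0" for u
    proof -
      have "(\<Sum>k\<in>{- int N..int N}. of_int k * (norm (u k))\<^sup>2) = (\<Sum>k\<in>{1..int N}. of_int k * (norm (u k))\<^sup>2)"
        by (rule sum.mono_neutral_right) (auto, smt (verit) that(2) atLeastAtMost_iff norm_zero)
      then show ?thesis using S that(1) by simp
    qed
    have "gavg (2 * N + 1) (\<lambda>t. h (trig N a t)) \<le> gavg (2 * N + 1) (\<lambda>t. C * norm (trig N x t) ^ 4)"
      by (rule gavg_mono) (simp add: tr C)
    also have "\<dots> \<le> C * (n * (n * (\<rho>\<^sup>2)\<^sup>2))"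
      unfolding gavg_cmult n_def using gavg_trig_power4[of x N] S1[of x] C(1)
      by (intro mult_left_mono) (auto simp: x_def)
    finally show ?thesis using S1[of a] an unfolding f_def \<rho>2 by simp
  qed
  then show ?thesis using \<rho> by (intro exI[of _ "\<rho>\<^sup>2 / 4"] exI[of _ \<rho>]) auto
qed

lemma f_nonpos: "(\<And>k. k \<in> {1..int N} \<Longrightarrow> a k = 0) \<Longrightarrow> f N a \<le> 0"
proof -
  assume a: "\<And>k. k \<in> {1..int N} \<Longrightarrow> a k = 0"
  have "(\<Sum>k\<in>{- int N..int N}. of_int k * (norm (a k))\<^sup>2) \<le> 0"
  proof (rule sum_nonpos)
    fix k assume "k \<in> {- int N..int N}"
    then show "of_int k * (norm (a k))\<^sup>2 \<le> 0"
      using a[of k] by (cases "k \<ge> 1") (auto intro: mult_nonpos_nonneg)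
  qed
  moreover have "0 \<le> gavg (2 * N + 1) (\<lambda>t. h (trig N a t))" by (rule gavg_nonneg) (rule h_nonneg)
  ultimately show ?thesis by (simp add: f_def)
qed

lemma f_le_term:
  shows "\<exists>C\<ge>0. (\<forall>N a. \<forall>k\<in>{- int N..int N}. (\<forall>l\<in>{- int N..int N}. of_int l * (norm (a l))\<^sup>2 \<le> D (a l) \<bullet> a l)
       \<longrightarrow> f N a \<le> C + (of_int k * (norm (a k))\<^sup>2 - D (a k) \<bullet> a k) / 2)"
proof -
  obtain C where C: "\<And>z. \<bar>h z - B z \<bullet> z / 2\<bar> \<le> C" by (rule bounded_diff_quad, rule that)
  have "f N a \<le> C + (of_int k * (norm (a k))\<^sup>2 - D (a k) \<bullet> a k) / 2"
    if k: "k \<in> {- int N..int N}" and le: "\<And>l. l \<in> {- int N..int N} \<Longrightarrow> of_int l * (norm (a l))\<^sup>2 \<le> D (a l) \<bullet> a l" for N a k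
  proof -
    have "1 / 2 * (B z \<bullet> z) - C \<le> h z" for z using C[of z] by (simp add: abs_le_iff)
    then have "gavg (2 * N + 1) (\<lambda>t. 1 / 2 * (B (trig N a t) \<bullet> trig N a t) - C) \<le> gavg (2 * N + 1) (\<lambda>t. h (trig N a t))"
      by (rule gavg_mono)
    then have 1: "(\<Sum>k\<in>{- int N..int N}. D (a k) \<bullet> a k) / 2 - C \<le> gavg (2 * N + 1) (\<lambda>t. h (trig N a t))"
      unfolding gavg_diff gavg_cmult B_trig gavg_trig_inner by simp
    have "(\<Sum>l\<in>{- int N..int N}. of_int l * (norm (a l))\<^sup>2 - D (a l) \<bullet> a l)
       = (of_int k * (norm (a k))\<^sup>2 - D (a k) \<bullet> a k) + (\<Sum>l\<in>{- int N..int N} - {k}. of_int l * (norm (a l))\<^sup>2 - D (a l) \<bullet> a l)"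
      using k by (rule sum.remove[rotated]) simp
    moreover have "(\<Sum>l\<in>{- int N..int N} - {k}. of_int l * (norm (a l))\<^sup>2 - D (a l) \<bullet> a l) \<le> 0"
      using le by (intro sum_nonpos) auto
    ultimately show ?thesis using 1 unfolding f_def sum_subtractf diff_divide_distrib by linarith
  qed
  moreover have "C \<ge> 0" using C[of 0] by linarith
  ultimately show ?thesis by blast
qed

text \<open>Without critical points, the deformation \<open>T\<close> would push a box below level
  \<open>\<beta>\<close> while fixing its boundary, where \<open>f\<close> is at most 0. The box is
  spanned by the nonpositive modes and a half-line in mode 1 along \<open>i0\<close>. By
  Poincare--Miranda its image still meets the sphere of \<open>f_on_sphere\<close>, where
  \<open>f\<close> is at least \<open>\<beta>\<close>.\<close>

theorem critical_points:
  obtains \<beta> where "\<beta> > 0" "\<And>N. N \<ge> 1 \<Longrightarrow> \<exists>a. nm N (F N a) = 0 \<and> f N a \<ge> \<beta>"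
proof -
  obtain \<beta> \<rho> where \<beta>: "\<beta> > 0" "\<rho> > 0" and sph: "(\<forall>N a. a 0 = q0 \<longrightarrow> (\<forall>k\<in>{- int N..-1}. a k = 0) \<longrightarrow>
       (\<Sum>k\<in>{1..int N}. of_int k * (norm (a k))\<^sup>2) = \<rho>\<^sup>2 \<longrightarrow> \<beta> \<le> f N a)"
    using f_on_sphere by blast
  obtain C where C: "C \<ge> 0"
    and fle: "(\<forall>N a. \<forall>k\<in>{- int N..int N}. (\<forall>l\<in>{- int N..int N}. of_int l * (norm (a l))\<^sup>2 \<le> D (a l) \<bullet> a l)
       \<longrightarrow> f N a \<le> C + (of_int k * (norm (a k))\<^sup>2 - D (a k) \<bullet> a k) / 2)"
    using f_le_term by blast
  \<comment> \<open>On the box the quadratic part at infinity is negative definite with this margin: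
    nonpositive modes give at most \<open>- e\<close>, mode 1 in the plane \<open>i0\<close> gives
    \<open>1 - A\<close>.\<close>
  define \<mu> where "\<mu> = min e (A - 1)"
  have \<mu>: "\<mu> > 0" "\<mu> \<le> e" "\<mu> \<le> A - 1" using A e by (auto simp: \<mu>_def)
  \<comment> \<open>Half side of the box: \<open>q0\<close> and \<open>\<rho>\<close> fit into it,
    and on the faces the negative quadratic part absorbs the constant \<open>C\<close>.\<close>
  define m where "m = 1 + \<rho> + norm q0 + sqrt (2 * C / \<mu>)"
  have m: "m > 0" "\<rho> \<le> m" "norm q0 \<le> m" using \<beta> \<mu> C by (auto simp: m_def add_pos_nonneg)
  have mC: "C \<le> \<mu> * m\<^sup>2 / 2"
  proof -
    have "2 * C / \<mu> = (sqrt (2 * C / \<mu>))\<^sup>2" using C \<mu> by simp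
    also have "\<dots> \<le> m\<^sup>2" using C \<mu> \<beta> by (intro power_mono) (auto simp: m_def)
    finally show ?thesis using \<mu> by (simp add: field_simps)
  qed
  have "\<exists>a. nm N (F N a) = 0 \<and> f N a \<ge> \<beta> / 2" if N: "N \<ge> 1" for N
  proof (rule ccontr)
    assume "\<not> ?thesis"
    then have "\<And>a. f N a \<ge> \<beta> / 2 \<Longrightarrow> nm N (F N a) \<noteq> 0" by blast
    then obtain T :: "(int \<Rightarrow> real^'n) \<Rightarrow> int \<Rightarrow> real^'n" where
      Tid: "\<And>a. f N a \<le> \<beta> / 2 \<Longrightarrow> T a = a" and Tlow: "\<And>a. f N a \<le> C \<Longrightarrow> f N (T a) < \<beta>"
      and Tcont: "\<And>a a' k. (\<And>k. (\<lambda>p. a p k) \<longlonglongrightarrow> a' k) \<Longrightarrow> (\<lambda>p::nat. T (a p) k) \<longlonglongrightarrow> T a' k"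
      using deformation[where N=N and b="\<beta> / 2" and c=\<beta> and m=C] \<beta>(1) by auto
    define I where "I = {- int N..0} \<times> (UNIV :: 'n set) \<union> {(1, i0)}"
    define c where "c x k = (if k = 1 then x (1, i0) *\<^sub>R axis i0 1 else if k \<in> {- int N..0} then (\<chi> i. x (k, i)) else 0)"
      for x :: "int \<times> 'n \<Rightarrow> real" and k
    \<comment> \<open>A common zero says that the deformed loop has constant part \<open>q0\<close>,
      no negative modes and positive-mode energy \<open>\<rho>\<^sup>2\<close>, so it lies on the
      sphere. The half-line coordinate is paired with the energy.\<close>
    define \<Phi> where "\<Phi> x = (\<lambda>(k, i). if k = 1 then (\<Sum>k\<in>{1..int N}. of_int k * (norm (T (c x) k))\<^sup>2) - \<rho>\<^sup>2
       else T (c x) k $ i - (if k = 0 then q0 $ i else 0))" for x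
    have Dc: "of_int l * (norm (c x l))\<^sup>2 - D (c x l) \<bullet> c x l \<le> - \<mu> * (norm (c x l))\<^sup>2" for x l
    proof (cases "l = 1")
      case True
      have "D (c x l) = A *\<^sub>R c x l" using True by (simp add: c_def D_def vec_eq_iff axis_def)
      then have "of_int l * (norm (c x l))\<^sup>2 - D (c x l) \<bullet> c x l = - (A - 1) * (norm (c x l))\<^sup>2"
        using True by (simp add: power2_norm_eq_inner algebra_simps)
      moreover have "(1 - A) * (norm (c x l))\<^sup>2 \<le> - \<mu> * (norm (c x l))\<^sup>2"
        using \<mu> by (intro mult_right_mono) auto
      ultimately show ?thesis by simp
    next
      case False
      have "of_int l * (norm (c x l))\<^sup>2 \<le> 0"
        using False by (auto simp: c_def intro: mult_nonpos_nonneg)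
      moreover have "\<mu> * (norm (c x l))\<^sup>2 \<le> e * (norm (c x l))\<^sup>2" using \<mu> by (intro mult_right_mono) auto
      ultimately show ?thesis using D_inner_ge[of "c x l"] by linarith
    qed
    have fc: "f N (c x) \<le> C - \<mu> * (norm (c x k))\<^sup>2 / 2" if "k \<in> {- int N..int N}" for x k
    proof -
      have "of_int l * (norm (c x l))\<^sup>2 \<le> D (c x l) \<bullet> c x l" for l
        using Dc[of l x] \<mu>(1) by (smt (verit) mult_minus_left mult_nonneg_nonneg zero_le_power2)
      then have "f N (c x) \<le> C + (of_int k * (norm (c x k))\<^sup>2 - D (c x k) \<bullet> c x k) / 2"
        using fle that by blast
      then show ?thesis using Dc[of k x] by (simp add: field_simps)
    qed
    have fcC: "f N (c x) \<le> C" for x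
      using fc[of 0 x] \<mu>(1) by (smt (verit) atLeastAtMost_iff divide_nonneg_nonneg mult_nonneg_nonneg of_nat_0_le_iff zero_le_power2)
    have face: "T (c x) = c x" if "\<bar>x i\<bar> = m" "i \<in> I" for x i
    proof (rule Tid)
      obtain k j where i: "i = (k, j)" by force
      have "m \<le> norm (c x k)"
        using that component_le_norm_cart[of "c x k" j] by (auto simp: c_def i I_def)
      then have "m\<^sup>2 \<le> (norm (c x k))\<^sup>2" using m by (intro power_mono) auto
      then have "\<mu> * m\<^sup>2 \<le> \<mu> * (norm (c x k))\<^sup>2" using \<mu> by (intro mult_left_mono) auto
      moreover have "k \<in> {- int N..int N}" using that(2) N by (auto simp: i I_def)
      ultimately have "f N (c x) \<le> 0" using fc[of k x] mC by linarith
      then show "f N (c x) \<le> \<beta> / 2" using \<beta>(1) by simp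
    qed
    \<comment> \<open>On the face where mode 1 is absent only nonpositive modes remain, and the
      action is at most 0 whatever their size.\<close>
    have bottom: "T (c x) = c x" if "x (1, i0) = 0" for x
    proof (rule Tid)
      have "f N (c x) \<le> 0" by (rule f_nonpos) (use that in \<open>auto simp: c_def\<close>)
      then show "f N (c x) \<le> \<beta> / 2" using \<beta>(1) by simp
    qed
    have q0m: "\<bar>q0 $ j\<bar> \<le> m" for j using component_le_norm_cart[of q0 j] m(3) by simp
    have "\<exists>x\<in>{x. \<forall>i\<in>I. (if i = (1, i0) then 0 else - m) \<le> x i \<and> x i \<le> m}. \<forall>i\<in>I. \<Phi> x i = 0"
    proof (rule poincare_miranda)
      show "finite I" by (simp add: I_def)
      show "(if i = (1, i0) then 0 else - m) < m" for i using m by simp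
    next
      fix i and X :: "nat \<Rightarrow> int \<times> 'n \<Rightarrow> real" and x assume "i \<in> I" and X: "\<And>i. i \<in> I \<Longrightarrow> (\<lambda>p. X p i) \<longlonglongrightarrow> x i"
      have "(\<lambda>p. c (X p) k) \<longlonglongrightarrow> c x k" for k
      proof (cases "k \<in> {- int N..0}")
        case True
        then have "(\<lambda>p. X p (k, j)) \<longlonglongrightarrow> x (k, j)" for j by (intro X) (auto simp: I_def)
        then show ?thesis using True by (auto simp: c_def intro!: vec_tendstoI)
      next
        case False
        then show ?thesis using X[of "(1, i0)"] by (auto simp: c_def I_def intro!: tendsto_intros)
      qed
      note T = Tcont[OF this]
      show "(\<lambda>p. \<Phi> (X p) i) \<longlonglongrightarrow> \<Phi> x i"
        unfolding \<Phi>_def by (cases i) (auto intro!: tendsto_intros T)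
    next
      fix x i assume x: "x \<in> {x. \<forall>i\<in>I. (if i = (1, i0) then 0 else - m) \<le> x i \<and> x i \<le> m}" "i \<in> I"
        and xi: "x i = (if i = (1, i0) then 0 else - m)"
      show "\<Phi> x i \<le> 0"
      proof (cases "i = (1, i0)")
        case True
        then have "x (1, i0) = 0" using xi by simp
        moreover from this have "c x k = 0" if "k \<in> {1..int N}" for k using that by (auto simp: c_def)
        then have "(\<Sum>k\<in>{1..int N}. of_int k * (norm (c x k))\<^sup>2) = 0" by (intro sum.neutral) auto
        ultimately show ?thesis using True bottom[of x] by (simp add: \<Phi>_def)
      next
        case False
        then have T: "T (c x) = c x" using face[of x i] x xi m by simp
        obtain k j where i: "i = (k, j)" "k \<in> {- int N..0}" using False x(2) by (auto simp: I_def)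
        then have "\<Phi> x i = - m - (if k = 0 then q0 $ j else 0)" using T xi False by (simp add: \<Phi>_def c_def)
        then show ?thesis using q0m[of j] m by (auto simp: abs_le_iff)
      qed
    next
      fix x i assume x: "x \<in> {x. \<forall>i\<in>I. (if i = (1, i0) then 0 else - m) \<le> x i \<and> x i \<le> m}" "i \<in> I" and xi: "x i = m"
      then have T: "T (c x) = c x" using face[of x i] m by simp
      show "0 \<le> \<Phi> x i"
      proof (cases "i = (1, i0)")
        case True
        have "\<rho>\<^sup>2 \<le> m\<^sup>2" using m \<beta> by (intro power_mono) auto
        also have "m\<^sup>2 = of_int 1 * (norm (c x 1))\<^sup>2" using xi True by (simp add: c_def)
        also have "\<dots> \<le> (\<Sum>k\<in>{1..int N}. of_int k * (norm (c x k))\<^sup>2)"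
          by (rule member_le_sum) (use N in auto)
        finally show ?thesis using True T by (simp add: \<Phi>_def)
      next
        case False
        then obtain k j where i: "i = (k, j)" "k \<in> {- int N..0}" using x(2) by (auto simp: I_def)
        then have "\<Phi> x i = m - (if k = 0 then q0 $ j else 0)" using T xi by (simp add: \<Phi>_def c_def)
        then show ?thesis using q0m[of j] m by (simp add: abs_le_iff)
      qed
    qed
    then obtain x where x: "\<And>i. i \<in> I \<Longrightarrow> \<Phi> x i = 0" by blast
    have "T (c x) k = (if k = 0 then q0 else 0)" if "k \<in> {- int N..0}" for k
    proof -
      have "T (c x) k $ j = (if k = 0 then q0 else 0) $ j" for j
        using x[of "(k, j)"] that by (auto simp: \<Phi>_def I_def split: if_splits)
      then show ?thesis unfolding vec_eq_iff by blast
    qed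
    then have "T (c x) 0 = q0" "\<And>k. k \<in> {- int N..-1} \<Longrightarrow> T (c x) k = 0" by auto
    moreover have "(\<Sum>k\<in>{1..int N}. of_int k * (norm (T (c x) k))\<^sup>2) = \<rho>\<^sup>2"
      using x[of "(1, i0)"] by (simp add: \<Phi>_def I_def)
    ultimately have "\<beta> \<le> f N (T (c x))" using sph by blast
    then show False using Tlow[OF fcC[of x]] by simp
  qed
  then show ?thesis using \<beta>(1) by (intro that[of "\<beta> / 2"]) auto
qed

end

section \<open>Passage to the limit\<close>

text \<open>The addition formula turns the moments into moments against powers of
  \<open>cos t\<close>. Polynomials in \<open>cos t\<close> are uniformly dense by
  Stone--Weierstrass in the variable \<open>x = cos t\<close>, so the integral of the square of
  \<open>u\<close> vanishes.\<close>

lemma cos_moments_zero: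
  fixes u :: "real \<Rightarrow> real"
  assumes u: "continuous_on {0..pi} u" and mom: "\<And>k::nat. integral {0..pi} (\<lambda>t. u t * cos (real k * t)) = 0"
    and t: "t \<in> {0..pi}"
  shows "u t = 0"
proof -
  have pows: "integral {0..pi} (\<lambda>t. u t * (cos t ^ m * cos (real k * t))) = 0" for m k :: nat
  proof (induction m arbitrary: k)
    case 0
    then show ?case using mom by simp
  next
    case (Suc m)
    show ?case
    proof (cases k)
      case 0
      then show ?thesis using Suc[of 1] by (simp add: mult_ac)
    next
      case (Suc j)
      have "(\<lambda>t. u t * (cos t ^ Suc m * cos (real k * t)))
         = (\<lambda>t. 1/2 * (u t * (cos t ^ m * cos (real (Suc k) * t))) + 1/2 * (u t * (cos t ^ m * cos (real j * t))))"
      proof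
        fix t
        have "cos (real (Suc k) * t) + cos (real j * t) = 2 * (cos t * cos (real k * t))"
          using cos_times_cos[of "real k * t" t] Suc by (simp add: algebra_simps)
        then have "cos t * cos (real k * t) = 1/2 * cos (real (Suc k) * t) + 1/2 * cos (real j * t)" by simp
        then show "u t * (cos t ^ Suc m * cos (real k * t))
          = 1/2 * (u t * (cos t ^ m * cos (real (Suc k) * t))) + 1/2 * (u t * (cos t ^ m * cos (real j * t)))"
          by (simp only: power_Suc2 mult.assoc) (simp add: algebra_simps)
      qed
      moreover have "(\<lambda>t. 1/2 * (u t * (cos t ^ m * cos (real l * t)))) integrable_on {0..pi}" for l
        by (intro integrable_continuous_real continuous_intros u)
      ultimately show ?thesis
        using Suc.IH[of "Suc k"] Suc.IH[of j] by (simp only: Henstock_Kurzweil_Integration.integral_add integral_mult_right)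
    qed
  qed
  obtain K where K: "\<And>t. t \<in> {0..pi} \<Longrightarrow> \<bar>u t\<bar> \<le> K" and K0: "K > 0"
  proof -
    have "bounded (u ` {0..pi})" using u by (intro compact_imp_bounded compact_continuous_image) auto
    then have "\<exists>b>0. \<forall>x\<in>{0..pi}. \<bar>u x\<bar> \<le> b" by (auto simp: bounded_pos)
    then show thesis using that by blast
  qed
  have int0: "integral {0..pi} (\<lambda>t. (u t)\<^sup>2) = 0"
  proof (rule ccontr)
    assume "integral {0..pi} (\<lambda>t. (u t)\<^sup>2) \<noteq> 0"
    moreover have "integral {0..pi} (\<lambda>t. (u t)\<^sup>2) \<ge> 0" by (rule integral_nonneg) (auto intro!: integrable_continuous_real continuous_intros u)
    ultimately have pos: "integral {0..pi} (\<lambda>t. (u t)\<^sup>2) > 0" by simp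
    \<comment> \<open>Chosen so that \<open>K * \<epsilon>\<close> integrates over
      \<open>{0..pi}\<close> to half of the integral assumed positive.\<close>
    define \<epsilon> where "\<epsilon> = integral {0..pi} (\<lambda>t. (u t)\<^sup>2) / (2 * K * pi)"
    have "continuous_on {-1..1} (\<lambda>x. u (arccos x))"
      by (rule continuous_on_compose2[OF u continuous_on_arccos']) (auto simp: arccos_lbound arccos_ubound)
    then obtain P where P: "real_polynomial_function P" "\<And>x. x \<in> {-1..1} \<Longrightarrow> \<bar>u (arccos x) - P x\<bar> < \<epsilon>"
      using Stone_Weierstrass_real_polynomial_function[of "{-1..1}" "\<lambda>x. u (arccos x)" \<epsilon>] pos K0
      by (auto simp: \<epsilon>_def)
    then obtain a n where an: "P = (\<lambda>x. \<Sum>i\<le>n. a i * x ^ i)" by (auto simp: real_polynomial_function_iff_sum)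
    have "integral {0..pi} (\<lambda>t. u t * P (cos t)) = (\<Sum>i\<le>n. a i * integral {0..pi} (\<lambda>t. u t * (cos t ^ i * cos (real 0 * t))))"
      unfolding an sum_distrib_left
      by (subst integral_sum) (auto intro!: integrable_continuous_real continuous_intros u simp: mult.left_commute)
    then have P0: "integral {0..pi} (\<lambda>t. u t * P (cos t)) = 0" by (simp only: pows) simp
    have cP: "continuous_on {0..pi} (\<lambda>t. P (cos t))" unfolding an by (intro continuous_intros)
    have "integral {0..pi} (\<lambda>t. (u t)\<^sup>2) = integral {0..pi} (\<lambda>t. u t * (u t - P (cos t)))"
      using P0 by (simp add: right_diff_distrib power2_eq_square)
        (subst Henstock_Kurzweil_Integration.integral_diff, auto intro!: integrable_continuous_real continuous_intros u cP)
    also have "\<dots> \<le> integral {0..pi} (\<lambda>t. K * \<epsilon>)"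
    proof (rule integral_le)
      fix t assume t: "t \<in> {0..pi}"
      have "u t * (u t - P (cos t)) \<le> \<bar>u t\<bar> * \<bar>u t - P (cos t)\<bar>" by (simp flip: abs_mult)
      also have "\<dots> \<le> K * \<epsilon>" using K[OF t] P(2)[of "cos t"] t by (intro mult_mono) (auto simp: arccos_cos intro: less_imp_le)
      finally show "u t * (u t - P (cos t)) \<le> K * \<epsilon>" .
    qed (auto intro!: integrable_continuous_real continuous_intros u cP)
    also have "\<dots> = integral {0..pi} (\<lambda>t. (u t)\<^sup>2) / 2" using K0 by (simp add: \<epsilon>_def)
    finally show False using pos by simp
  qed
  have "\<forall>t\<in>{0..pi}. (u t)\<^sup>2 = 0"
    using integral_eq_0_iff[of 0 pi "\<lambda>t. (u t)\<^sup>2"] int0 by (auto intro!: continuous_intros u)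
  then show ?thesis using t by simp
qed

lemma integral_reverse: "integral {0..c} (\<lambda>t. w (c - t)) = integral {0..c::real} w" for w :: "real \<Rightarrow> real"
proof -
  have "integral {0..c} (\<lambda>t. w (c - t)) = integral {-c..-0} (\<lambda>x. w (c + x))"
    using Henstock_Kurzweil_Integration.integral_reflect_real[of c 0 "\<lambda>t. w (c - t)"] by simp
  also have "\<dots> = integral {0..c} w"
    using integral_shift_Icc_real[of "-c" "-0" w c] by (simp add: add.commute comp_def)
  finally show ?thesis .
qed


text \<open>The reflection of \<open>t\<close> to \<open>2*pi - t\<close> splits \<open>u\<close>
  into an even and an odd part. The even part is determined by cosine moments; so is the odd part
  after multiplication by \<open>sin t\<close>, which vanishes only at the ends of
  \<open>{0..pi}\<close>, where continuity takes over.\<close>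

lemma fourier_unique:
  fixes u :: "real \<Rightarrow> real"
  assumes u: "continuous_on {0..2*pi} u"
    and C: "\<And>k::nat. integral {0..2*pi} (\<lambda>t. u t * cos (real k * t)) = 0"
    and S: "\<And>k::nat. integral {0..2*pi} (\<lambda>t. u t * sin (real k * t)) = 0"
    and t: "t \<in> {0..2*pi}"
  shows "u t = 0"
proof -
  define v where "v s t = u t + s * u (2*pi - t)" for s t
  have cr: "continuous_on {0..pi} (\<lambda>t. u (2*pi - t))" and cu: "continuous_on {0..pi} u"
    by (rule continuous_on_compose2[OF u] continuous_on_subset[OF u]; auto intro!: continuous_intros)+
  have fold: "integral {0..pi} (\<lambda>t. w t + w (2*pi - t)) = integral {0..2*pi} w" if w: "continuous_on {0..2*pi} w" for w :: "real \<Rightarrow> real"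
  proof -
    have 1: "integral {0..pi} (\<lambda>t. w (2*pi - t)) = integral {pi..2*pi} w"
      using integral_reverse[of pi "\<lambda>t. w (pi + t)"] integral_shift_Icc_real[of 0 pi w pi]
      by (simp add: comp_def add.commute algebra_simps)
    have "w integrable_on {0..2*pi}" using w by (rule integrable_continuous_real)
    then have "integral {0..pi} w + integral {pi..2*pi} w = integral {0..2*pi} w"
      by (intro Henstock_Kurzweil_Integration.integral_combine) auto
    moreover have "integral {0..pi} (\<lambda>t. w t + w (2*pi - t)) = integral {0..pi} w + integral {0..pi} (\<lambda>t. w (2*pi - t))"
      by (intro Henstock_Kurzweil_Integration.integral_add integrable_continuous_real continuous_on_subset[OF w]
         continuous_on_compose2[OF w]) (auto intro!: continuous_intros)
    ultimately show ?thesis using 1 by simp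
  qed
  have per: "cos (real k * (2*pi - t)) = cos (real k * t)" "sin (real k * (2*pi - t)) = - sin (real k * t)" for k :: nat and t
  proof -
    have "real k * (2*pi - t) = - (real k * t) + real k * (2 * pi)" by (simp add: algebra_simps)
    moreover have "sin (real k * (2 * pi)) = 0" "cos (real k * (2 * pi)) = 1"
      using sin_2npi[of k] cos_2npi[of k] by (simp_all add: mult.commute mult.left_commute)
    ultimately show "cos (real k * (2*pi - t)) = cos (real k * t)" "sin (real k * (2*pi - t)) = - sin (real k * t)"
      by (simp_all only: cos_add sin_add) simp_all
  qed
  have even: "v 1 t = 0" if "t \<in> {0..pi}" for t
  proof (rule cos_moments_zero[OF _ _ that])
    show "continuous_on {0..pi} (v 1)" unfolding v_def by (intro continuous_intros cr cu)
    show "integral {0..pi} (\<lambda>t. v 1 t * cos (real k * t)) = 0" for k :: nat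
      using fold[of "\<lambda>t. u t * cos (real k * t)"] C[of k]
      by (simp add: per v_def distrib_right continuous_intros u)
  qed
  have odd_mom: "integral {0..pi} (\<lambda>t. v (-1) t * sin (real k * t)) = 0" for k :: nat
    using fold[of "\<lambda>t. u t * sin (real k * t)"] S[of k]
    by (simp add: per v_def left_diff_distrib continuous_intros u)
  have cv: "continuous_on {0..pi} (v (-1))" unfolding v_def by (intro continuous_intros cr cu)
  have odd: "v (-1) t * sin t = 0" if "t \<in> {0..pi}" for t
  proof (rule cos_moments_zero[OF _ _ that])
    show "continuous_on {0..pi} (\<lambda>t. v (-1) t * sin t)" by (intro continuous_intros cv)
    fix k :: nat
    show "integral {0..pi} (\<lambda>t. v (-1) t * sin t * cos (real k * t)) = 0"
    proof (cases k)
      case 0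
      then show ?thesis using odd_mom[of 1] by simp
    next
      case (Suc j)
      have "(\<lambda>t. v (-1) t * sin t * cos (real k * t))
        = (\<lambda>t. 1/2 * (v (-1) t * sin (real (Suc k) * t)) - 1/2 * (v (-1) t * sin (real j * t)))"
      proof
        fix t
        have "sin (real (Suc k) * t) - sin (real j * t) = 2 * (sin t * cos (real k * t))"
          using sin_times_cos[of t "real k * t"] Suc sin_minus[of "real j * t"] by (simp add: algebra_simps)
        then have "sin t * cos (real k * t) = 1/2 * sin (real (Suc k) * t) - 1/2 * sin (real j * t)" by simp
        then show "v (-1) t * sin t * cos (real k * t) = 1/2 * (v (-1) t * sin (real (Suc k) * t)) - 1/2 * (v (-1) t * sin (real j * t))"
          by (simp only: mult.assoc) (simp add: algebra_simps)
      qed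
      moreover have "(\<lambda>t. 1/2 * (v (-1) t * sin (real l * t))) integrable_on {0..pi}" for l
        by (intro integrable_continuous_real continuous_intros cv)
      ultimately show ?thesis
        using odd_mom[of "Suc k"] odd_mom[of j] by (simp only: Henstock_Kurzweil_Integration.integral_diff integral_mult_right)
    qed
  qed
  have odd': "v (-1) t = 0" if "t \<in> {0<..<pi}" for t
    using odd[of t] sin_gt_zero[of t] that by auto
  have odd'': "v (-1) t = 0" if "t \<in> {0..pi}" for t
  proof (rule continuous_constant_on_closure[of "{0<..<pi}" "v (-1)" 0])
    show "continuous_on (closure {0<..<pi}) (v (-1))" using cv by simp
  qed (use odd' that in auto)
  have half: "u t = 0 \<and> u (2*pi - t) = 0" if "t \<in> {0..pi}" for t
    using even[OF that] odd''[OF that] by (simp add: v_def)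
  show ?thesis
    using half[of t] half[of "2*pi - t"] t by (cases "t \<le> pi") auto
qed

text \<open>The primitive \<open>P\<close> of \<open>v\<close> takes equal values at both ends since
  \<open>v\<close> has mean 0. Integration by parts shows that it has the same Fourier coefficients
  as \<open>u\<close> apart from the mean, so \<open>u\<close> and \<open>P\<close> differ by a
  constant.\<close>

lemma weak_derivative:
  fixes u v :: "real \<Rightarrow> real"
  assumes u: "continuous_on {0..2*pi} u" and v: "continuous_on {0..2*pi} v" and v0: "integral {0..2*pi} v = 0"
    and vS: "\<And>k::nat. integral {0..2*pi} (\<lambda>t. v t * sin (real k * t)) = - real k * integral {0..2*pi} (\<lambda>t. u t * cos (real k * t))"
    and vC: "\<And>k::nat. integral {0..2*pi} (\<lambda>t. v t * cos (real k * t)) = real k * integral {0..2*pi} (\<lambda>t. u t * sin (real k * t))"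
    and t: "t \<in> {0..2*pi}"
  shows "(u has_real_derivative v t) (at t within {0..2*pi})"
proof -
  define P where "P t = integral {0..t} v" for t
  have dP: "(P has_real_derivative v t) (at t within {0..2*pi})" if "t \<in> {0..2*pi}" for t
    unfolding P_def using integral_has_real_derivative[OF v that] .
  have cP: "continuous_on {0..2*pi} P"
    unfolding continuous_on_eq_continuous_within using dP DERIV_continuous by blast
  have P0: "P 0 = 0" "P (2*pi) = 0" using v0 by (auto simp: P_def)
  note ci = integrable_continuous_real continuous_intros u v cP
  have per: "sin (real k * (2 * pi)) = 0" "cos (real k * (2 * pi)) = 1" for k :: nat
    using sin_2npi[of k] cos_2npi[of k] by (simp_all add: mult.commute mult.left_commute)
  have A: "integral {0..2*pi} (\<lambda>t. v t * sin (real k * t)) + real k * integral {0..2*pi} (\<lambda>t. P t * cos (real k * t)) = 0" for k :: nat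
  proof -
    have "((\<lambda>t. v t * sin (real k * t) + real k * (P t * cos (real k * t))) has_integral
        (P (2*pi) * sin (real k * (2*pi)) - P 0 * sin (real k * 0))) {0..2*pi}"
      by (rule fundamental_theorem_of_calculus)
        (auto simp flip: has_real_derivative_iff_has_vector_derivative intro!: derivative_eq_intros dP)
    then have "integral {0..2*pi} (\<lambda>t. v t * sin (real k * t) + real k * (P t * cos (real k * t))) = 0"
      using P0 by (simp add: integral_unique)
    then show ?thesis
      by (subst (asm) Henstock_Kurzweil_Integration.integral_add) (auto intro!: ci)
  qed
  have B: "integral {0..2*pi} (\<lambda>t. v t * cos (real k * t)) - real k * integral {0..2*pi} (\<lambda>t. P t * sin (real k * t)) = 0" for k :: nat
  proof -
    have "((\<lambda>t. v t * cos (real k * t) - real k * (P t * sin (real k * t))) has_integral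
        (P (2*pi) * cos (real k * (2*pi)) - P 0 * cos (real k * 0))) {0..2*pi}"
      by (rule fundamental_theorem_of_calculus)
        (auto simp flip: has_real_derivative_iff_has_vector_derivative intro!: derivative_eq_intros dP)
    then have "integral {0..2*pi} (\<lambda>t. v t * cos (real k * t) - real k * (P t * sin (real k * t))) = 0"
      using P0 by (simp add: integral_unique)
    then show ?thesis
      by (subst (asm) Henstock_Kurzweil_Integration.integral_diff) (auto intro!: ci)
  qed
  have triv: "integral {0..2*pi} (\<lambda>t. cos (real k * t)) = 0" "integral {0..2*pi} (\<lambda>t. sin (real k * t)) = 0" if "k > 0" for k :: nat
  proof -
    have "((\<lambda>t. cos (real k * t)) has_integral (sin (real k * (2*pi)) / real k - sin (real k * 0) / real k)) {0..2*pi}"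
      by (rule fundamental_theorem_of_calculus)
        (use that in \<open>auto simp flip: has_real_derivative_iff_has_vector_derivative intro!: derivative_eq_intros\<close>)
    then show "integral {0..2*pi} (\<lambda>t. cos (real k * t)) = 0" using per by (simp add: integral_unique)
    have "((\<lambda>t. sin (real k * t)) has_integral (- cos (real k * (2*pi)) / real k - - cos (real k * 0) / real k)) {0..2*pi}"
      by (rule fundamental_theorem_of_calculus)
        (use that in \<open>auto simp flip: has_real_derivative_iff_has_vector_derivative intro!: derivative_eq_intros\<close>)
    then show "integral {0..2*pi} (\<lambda>t. sin (real k * t)) = 0" using per by (simp add: integral_unique)
  qed
  define c where "c = (integral {0..2*pi} u - integral {0..2*pi} P) / (2*pi)"
  have "u s - P s - c = 0" if "s \<in> {0..2*pi}" for s
  proof (rule fourier_unique[OF _ _ _ that])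
    show "continuous_on {0..2*pi} (\<lambda>s. u s - P s - c)" by (intro ci)
    fix k :: nat
    have 1: "integral {0..2*pi} (\<lambda>s. (u s - P s - c) * w s) = integral {0..2*pi} (\<lambda>s. u s * w s)
       - integral {0..2*pi} (\<lambda>s. P s * w s) - c * integral {0..2*pi} w" if w: "continuous_on {0..2*pi} w" for w
      by (simp only: left_diff_distrib) (subst Henstock_Kurzweil_Integration.integral_diff
         Henstock_Kurzweil_Integration.integral_diff, auto intro!: ci w)+
    show "integral {0..2*pi} (\<lambda>s. (u s - P s - c) * cos (real k * s)) = 0"
    proof (cases "k = 0")
      case True
      then show ?thesis using 1[of "\<lambda>_. 1"] by (simp add: c_def)
    next
      case False
      then have "integral {0..2*pi} (\<lambda>t. P t * cos (real k * t)) = integral {0..2*pi} (\<lambda>t. u t * cos (real k * t))"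
        using A[of k] vS[of k] by simp
      then show ?thesis using triv(1)[of k] False by (subst 1) (auto intro!: continuous_intros)
    qed
    show "integral {0..2*pi} (\<lambda>s. (u s - P s - c) * sin (real k * s)) = 0"
    proof (cases "k = 0")
      case False
      then have "integral {0..2*pi} (\<lambda>t. P t * sin (real k * t)) = integral {0..2*pi} (\<lambda>t. u t * sin (real k * t))"
        using B[of k] vC[of k] by simp
      then show ?thesis using triv(2)[of k] False by (subst 1) (auto intro!: continuous_intros)
    qed simp
  qed
  then have eq: "u s = P s + c" if "s \<in> {0..2*pi}" for s using that by fastforce
  have "((\<lambda>s. P s + c) has_real_derivative v t) (at t within {0..2*pi})"
    using dP[OF t] by (auto intro!: derivative_eq_intros)
  then show ?thesis
    by (rule has_field_derivative_transform_within[where d=1]) (use eq t in auto)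
qed

text \<open>The means are Riemann sums: on each cell the mean value theorem compares the integral
  with the value at the left node. Uniform convergence allows the integrand to vary with
  \<open>p\<close> as well.\<close>

lemma gavg_tendsto_integral:
  fixes \<phi> :: "real \<Rightarrow> real"
  assumes \<phi>: "continuous_on {0..2*pi} \<phi>" and M: "filterlim M at_top sequentially"
    and unif: "\<And>\<epsilon>. \<epsilon> > 0 \<Longrightarrow> \<forall>\<^sub>F p in sequentially. \<forall>t\<in>{0..2*pi}. \<bar>f p t - \<phi> t\<bar> \<le> \<epsilon>"
  shows "(\<lambda>p. gavg (M p) (f p)) \<longlonglongrightarrow> integral {0..2*pi} \<phi> / (2*pi)"
proof (rule LIMSEQ_I)
  fix r :: real assume r: "r > 0"
  define \<epsilon> where "\<epsilon> = r / 3"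
  have "uniformly_continuous_on {0..2*pi} \<phi>" by (intro compact_uniformly_continuous \<phi>) simp
  then obtain d where d: "d > 0" "\<And>s t. s \<in> {0..2*pi} \<Longrightarrow> t \<in> {0..2*pi} \<Longrightarrow> \<bar>s - t\<bar> < d \<Longrightarrow> \<bar>\<phi> s - \<phi> t\<bar> < \<epsilon>"
    using r unfolding uniformly_continuous_on_def \<epsilon>_def dist_real_def by (metis zero_less_divide_iff zero_less_numeral)
  obtain m0 :: nat where m0: "2 * pi / d < real m0" using reals_Archimedean2 by blast
  have m0': "real m0 > 0" using m0 d(1) by (smt (verit) divide_pos_pos pi_gt_zero)
  define P where "P t = integral {0..t} \<phi>" for t
  have dP: "(P has_real_derivative \<phi> t) (at t within {0..2*pi})" if "t \<in> {0..2*pi}" for t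
    unfolding P_def using integral_has_real_derivative[OF \<phi> that] .
  have riem: "\<bar>gavg m \<phi> - integral {0..2*pi} \<phi> / (2*pi)\<bar> \<le> \<epsilon>" if m: "m \<ge> m0" for m
  proof -
    have m': "real m > 0" using m m0' by simp
    define h where "h = 2 * pi / real m"
    have h: "h > 0" "h < d" "real m * h = 2 * pi"
    proof -
      have "2 * pi / d < real m" using m m0 by linarith
      then show "h < d" using m' d(1) by (simp add: h_def field_simps)
    qed (use m' in \<open>auto simp: h_def\<close>)
    have grid: "2 * pi * real j / real m = real j * h" for j by (simp add: h_def)
    have step: "\<bar>(P (real (Suc j) * h) - P (real j * h)) - h * \<phi> (real j * h)\<bar> \<le> h * \<epsilon>" if j: "j < m" for j
    proof -
      have "real (Suc j) * h \<le> real m * h" using j h by (intro mult_right_mono) auto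
      then have sub: "{real j * h..real (Suc j) * h} \<subseteq> {0..2*pi}" using h by auto
      have "\<exists>x\<in>{real j * h<..<real (Suc j) * h}. P (real (Suc j) * h) - P (real j * h) = (real (Suc j) * h - real j * h) * \<phi> x"
      proof (rule mvt_simple)
        fix x assume "real j * h \<le> x" "x \<le> real (Suc j) * h"
        then have "x \<in> {0..2*pi}" using sub by auto
        then have "(P has_derivative times (\<phi> x)) (at x within {real j * h..real (Suc j) * h})"
          using has_derivative_subset[OF dP[unfolded has_field_derivative_def] sub] by blast
        moreover have "times (\<phi> x) = (\<lambda>y. y * \<phi> x)" by (simp add: fun_eq_iff mult.commute)
        ultimately show "(P has_derivative (\<lambda>y. y * \<phi> x)) (at x within {real j * h..real (Suc j) * h})"
          by (simp only:)
      qed (use h in \<open>auto simp: algebra_simps\<close>)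
      then obtain x where x: "x \<in> {real j * h<..<real (Suc j) * h}" "P (real (Suc j) * h) - P (real j * h) = h * \<phi> x"
        by (auto simp: algebra_simps)
      have "\<bar>\<phi> x - \<phi> (real j * h)\<bar> < \<epsilon>"
        using x(1) h sub by (intro d(2)) (auto simp: algebra_simps subset_iff)
      then show ?thesis using x(2) h by (simp add: right_diff_distrib[symmetric] abs_mult)
    qed
    have "(\<Sum>j<m. P (real (Suc j) * h) - P (real j * h)) = integral {0..2*pi} \<phi>"
      using sum_lessThan_telescope[of "\<lambda>j. P (real j * h)" m] h by (simp add: P_def)
    then have "\<bar>integral {0..2*pi} \<phi> - (\<Sum>j<m. h * \<phi> (real j * h))\<bar>
        = \<bar>\<Sum>j<m. (P (real (Suc j) * h) - P (real j * h)) - h * \<phi> (real j * h)\<bar>"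
      by (simp add: sum_subtractf)
    also have "\<dots> \<le> (\<Sum>j<m. h * \<epsilon>)" by (rule order_trans[OF sum_abs sum_mono]) (use step in auto)
    also have "\<dots> = 2 * pi * \<epsilon>" using h by simp
    finally have 1: "\<bar>integral {0..2*pi} \<phi> - (\<Sum>j<m. h * \<phi> (real j * h))\<bar> \<le> 2 * pi * \<epsilon>" .
    have "gavg m \<phi> = (\<Sum>j<m. h * \<phi> (real j * h)) / (2 * pi)"
      unfolding gavg_def grid sum_distrib_left[symmetric] by (simp add: h_def)
    then have "gavg m \<phi> - integral {0..2*pi} \<phi> / (2*pi) = - (integral {0..2*pi} \<phi> - (\<Sum>j<m. h * \<phi> (real j * h))) / (2*pi)"
      by (simp add: diff_divide_distrib)
    also have "\<bar>\<dots>\<bar> \<le> (2 * pi * \<epsilon>) / (2 * pi)"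
      using divide_right_mono[OF 1, of "2*pi"] by (simp add: abs_minus_commute)
    finally show ?thesis by simp
  qed
  have "\<forall>\<^sub>F p in sequentially. M p \<ge> max 1 m0"
    using filterlim_at_top[THEN iffD1, OF M] by (rule allE)
  moreover have "\<forall>\<^sub>F p in sequentially. \<forall>t\<in>{0..2*pi}. \<bar>f p t - \<phi> t\<bar> \<le> \<epsilon>"
    using unif[of \<epsilon>] r by (simp add: \<epsilon>_def)
  ultimately have "\<forall>\<^sub>F p in sequentially. M p \<ge> max 1 m0 \<and> (\<forall>t\<in>{0..2*pi}. \<bar>f p t - \<phi> t\<bar> \<le> \<epsilon>)"
    by (rule eventually_conj)
  then obtain p0 where p0: "\<And>p. p \<ge> p0 \<Longrightarrow> M p \<ge> max 1 m0 \<and> (\<forall>t\<in>{0..2*pi}. \<bar>f p t - \<phi> t\<bar> \<le> \<epsilon>)"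
    by (auto simp: eventually_sequentially)
  have "norm (gavg (M p) (f p) - integral {0..2*pi} \<phi> / (2*pi)) < r" if "p \<ge> p0" for p
  proof -
    have Mp: "M p \<ge> m0" "M p > 0" using p0[OF that] by auto
    have "\<bar>f p (2 * pi * real j / real (M p)) - \<phi> (2 * pi * real j / real (M p))\<bar> \<le> \<epsilon>" if "j < M p" for j
    proof -
      have "2 * pi * real j / real (M p) \<in> {0..2*pi}" using that by (auto simp: field_simps)
      then show ?thesis using p0[OF \<open>p \<ge> p0\<close>] by blast
    qed
    then have "\<bar>\<Sum>j<M p. f p (2 * pi * real j / real (M p)) - \<phi> (2 * pi * real j / real (M p))\<bar> \<le> (\<Sum>j<M p. \<epsilon>)"
      by (intro order_trans[OF sum_abs sum_mono]) auto
    then have "\<bar>gavg (M p) (f p) - gavg (M p) \<phi>\<bar> \<le> \<epsilon>"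
      using Mp by (simp add: gavg_def sum_subtractf diff_divide_distrib[symmetric] abs_divide divide_le_eq mult.commute)
    then show ?thesis using riem[OF Mp(1)] r unfolding real_norm_def \<epsilon>_def by linarith
  qed
  then show "\<exists>no. \<forall>n\<ge>no. norm (gavg (M n) (f n) - integral {0..2*pi} \<phi> / (2*pi)) < r" by blast
qed


text \<open>The field is autonomous, so translated copies of \<open>z\<close> solve the same
  equation. At a multiple of \<open>P\<close> the derivatives from both sides agree, each being
  \<open>V\<close> of the common value.\<close>

lemma periodic_extension:
  fixes z :: "real \<Rightarrow> 'a::real_normed_vector"
  assumes P: "P > 0" and per: "z P = z 0"
    and d: "\<And>t. t \<in> {0..P} \<Longrightarrow> (z has_vector_derivative V (z t)) (at t within {0..P})"
  obtains Z where "\<And>t. t \<in> {0..P} \<Longrightarrow> Z t = z t" "\<And>t m. Z (t + of_int m * P) = Z t"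
    "\<And>t. (Z has_vector_derivative V (Z t)) (at t)"
proof -
  define Z where "Z t = z (t - of_int \<lfloor>t / P\<rfloor> * P)" for t
  have Zm: "Z t = z (t - of_int m * P)" if t: "t \<in> {of_int m * P..of_int (m + 1) * P}" for t m
  proof (cases "t = of_int (m + 1) * P")
    case True
    then have "\<lfloor>t / P\<rfloor> = m + 1" using P by simp
    then show ?thesis using True per by (simp add: Z_def algebra_simps)
  next
    case False
    then have "of_int m \<le> t / P" "t / P < of_int m + 1" using t P by (auto simp: field_simps)
    then have "\<lfloor>t / P\<rfloor> = m" by (simp add: floor_eq_iff)
    then show ?thesis by (simp add: Z_def)
  qed
  have Zper: "Z (t + of_int m * P) = Z t" for t m
  proof -
    have "(t + of_int m * P) / P = t / P + of_int m" using P by (simp add: field_simps)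
    then show ?thesis by (simp add: Z_def algebra_simps)
  qed
  have dm: "(Z has_vector_derivative V (Z t)) (at t within {of_int m * P..of_int (m + 1) * P})"
    if t: "t \<in> {of_int m * P..of_int (m + 1) * P}" for t m
  proof -
    let ?I = "{of_int m * P..of_int (m + 1) * P}" and ?s = "\<lambda>x. x - of_int m * P"
    have "((z \<circ> ?s) has_vector_derivative 1 *\<^sub>R V (z (?s t))) (at t within ?I)"
    proof (rule vector_diff_chain_within)
      show "(?s has_vector_derivative 1) (at t within ?I)"
        by (auto intro!: derivative_eq_intros)
      have "?s ` ?I \<subseteq> {0..P}" by (auto simp: algebra_simps)
      moreover have "?s t \<in> {0..P}" using t by (auto simp: algebra_simps)
      ultimately show "(z has_vector_derivative V (z (?s t))) (at (?s t) within ?s ` ?I)"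
        using d has_vector_derivative_within_subset by blast
    qed
    then have "((z \<circ> ?s) has_vector_derivative V (Z t)) (at t within ?I)" using Zm[OF t] by simp
    then show ?thesis
      by (rule has_vector_derivative_transform[rotated 2]) (use t Zm in auto)
  qed
  have "(Z has_vector_derivative V (Z t)) (at t)" for t
  proof -
    define m where "m = \<lfloor>t / P\<rfloor>"
    have "of_int m \<le> t / P" "t / P < of_int m + 1" unfolding m_def by linarith+
    then have tm: "of_int m * P \<le> t" "t < of_int (m + 1) * P" using P by (auto simp: field_simps)
    define J where "J = {of_int (m - 1) * P..of_int m * P}"
    define I where "I = {of_int m * P..of_int (m + 1) * P}"
    have UI: "J \<union> I = {of_int (m - 1) * P..of_int (m + 1) * P}"
      using P by (auto simp: J_def I_def algebra_simps intro: mult_right_mono)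
    have "(Z has_vector_derivative V (Z t)) (at t within I)" using dm[of t m] tm by (simp add: I_def)
    moreover have "(Z has_vector_derivative V (Z t)) (at t within J)"
    proof (cases "t = of_int m * P")
      case True
      then show ?thesis using dm[of t "m - 1"] P by (simp add: J_def algebra_simps)
    next
      \<comment> \<open>Then \<open>t\<close> lies outside the closed interval \<open>J\<close>, and
        differentiability within \<open>J\<close> is vacuous.\<close>
      case False
      then have "t \<notin> J" using tm by (auto simp: J_def)
      moreover have "closed J" by (simp add: J_def)
      ultimately have "at t within J = bot" by (simp add: at_within_eq_bot_iff)
      then show ?thesis
        by (simp add: has_vector_derivative_def has_derivative_def bounded_linear_scaleR_left)
    qed
    ultimately have "(Z has_vector_derivative V (Z t)) (at t within J \<union> I)"
      unfolding has_vector_derivative_def has_derivative_within by (auto intro: Lim_Un)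
    moreover have "t \<in> interior (J \<union> I)"
      unfolding UI interior_atLeastAtMost_real using tm P by (auto simp: algebra_simps)
    then have "at t within J \<union> I = at t" by (rule at_within_interior)
    ultimately show ?thesis by (simp only:)
  qed
  then have dZ: "\<And>t. (Z has_vector_derivative V (Z t)) (at t)" .
  have eqZ: "Z t = z t" if "t \<in> {0..P}" for t using Zm[of t 0] that by simp
  show ?thesis by (rule that[OF eqZ Zper dZ])
qed

section \<open>Equicontinuity of trigonometric polynomials with bounded derivative\<close>

lemma inverse_square_tail:
  assumes "K \<ge> 1"
  shows "(\<Sum>k\<in>{K<..N}. 1 / (real k)\<^sup>2) \<le> 1 / real K"
proof (cases "K \<le> N")
  case True
  then have "(\<Sum>k\<in>{K<..N}. 1 / (real k)\<^sup>2) \<le> 1 / real K - 1 / real N"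
  proof (induction N rule: dec_induct)
    case (step n)
    have n: "real n > 0" using step assms by simp
    have "1 / (real (Suc n))\<^sup>2 \<le> 1 / (real n * real (Suc n))"
      unfolding power2_eq_square using n by (intro divide_left_mono mult_right_mono) auto
    also have "\<dots> = 1 / real n - 1 / real (Suc n)" using n by (simp add: field_simps)
    finally have "1 / (real (Suc n))\<^sup>2 \<le> 1 / real n - 1 / real (Suc n)" .
    moreover have "{K<..Suc n} = insert (Suc n) {K<..n}" using step by auto
    ultimately show ?case using step.IH by simp
  qed simp
  also have "\<dots> \<le> 1 / real K" by simp
  finally show ?thesis .
next
  case False
  then show ?thesis by simp
qed

text \<open>The sum is split at \<open>K\<close>: beyond it the tail of \<open>4 / k^2\<close> is at
  most \<open>\<epsilon> / 2\<close>, up to it there are \<open>K\<close> terms of size at most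
  \<open>\<delta>^2\<close>. The bound is uniform in \<open>N\<close>.\<close>

lemma small_weights:
  assumes "\<epsilon> > 0"
  obtains \<delta> where "\<delta> > 0" "\<And>N. (\<Sum>k\<in>{1..N}. (min (2 / real k) \<delta>)\<^sup>2) \<le> \<epsilon>"
proof -
  obtain K :: nat where K: "8 / \<epsilon> < real K" using reals_Archimedean2 by blast
  have K0: "real K > 0" using K assms by (smt (verit) divide_pos_pos)
  define \<delta> where "\<delta> = sqrt (\<epsilon> / (2 * real K))"
  have \<delta>: "\<delta> > 0" using assms K0 by (simp add: \<delta>_def)
  have "(\<Sum>k\<in>{1..N}. (min (2 / real k) \<delta>)\<^sup>2) \<le> \<epsilon>" for N
  proof -
    have "(\<Sum>k\<in>{1..N}. (min (2 / real k) \<delta>)\<^sup>2) \<le> (\<Sum>k\<in>{1..K} \<union> {K<..N}. (min (2 / real k) \<delta>)\<^sup>2)"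
      by (intro sum_mono2) auto
    also have "\<dots> = (\<Sum>k\<in>{1..K}. (min (2 / real k) \<delta>)\<^sup>2) + (\<Sum>k\<in>{K<..N}. (min (2 / real k) \<delta>)\<^sup>2)"
      by (intro sum.union_disjoint) auto
    also have "\<dots> \<le> (\<Sum>k\<in>{1..K}. \<delta>\<^sup>2) + (\<Sum>k\<in>{K<..N}. 4 * (1 / (real k)\<^sup>2))"
    proof (intro add_mono sum_mono)
      show "(min (2 / real k) \<delta>)\<^sup>2 \<le> \<delta>\<^sup>2" for k using \<delta> by (intro power_mono) auto
      have "(min (2 / real k) \<delta>)\<^sup>2 \<le> (2 / real k)\<^sup>2" for k using \<delta> by (intro power_mono) auto
      then show "(min (2 / real k) \<delta>)\<^sup>2 \<le> 4 * (1 / (real k)\<^sup>2)" for k by (simp add: power_divide)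
    qed
    also have "\<dots> \<le> real K * \<delta>\<^sup>2 + 4 * (1 / real K)"
      unfolding sum_distrib_left[symmetric] using inverse_square_tail[of K N] K0 by simp
    also have "\<dots> \<le> \<epsilon> / 2 + \<epsilon> / 2"
    proof (rule add_mono)
      show "real K * \<delta>\<^sup>2 \<le> \<epsilon> / 2" using assms K0 by (simp add: \<delta>_def)
      show "4 * (1 / real K) \<le> \<epsilon> / 2" using K K0 assms by (simp add: field_simps)
    qed
    finally show ?thesis by simp
  qed
  then show ?thesis using \<delta> that by blast
qed

lemma norm_mode_diff: "norm (mode k t v - mode k s v) \<le> min 2 (\<bar>of_int k\<bar> * \<bar>t - s\<bar>) * norm v"
proof -
  let ?x = "of_int k * (t - s) / 2"
  have "(norm (mode k t v - mode k s v))\<^sup>2 = (norm v)\<^sup>2 * (2 - 2 * cos (of_int k * t - of_int k * s))"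
    by (simp add: power2_norm_eq_inner inner_diff_left inner_diff_right mode_def inner_prod_def cos_diff algebra_simps)
      (simp add: sin_squared_eq power2_eq_square[symmetric] algebra_simps flip: power2_eq_square)
  also have "2 - 2 * cos (of_int k * t - of_int k * s) = (2 * sin ?x)\<^sup>2"
  proof -
    have "cos (of_int k * t - of_int k * s) = 1 - 2 * (sin ?x)\<^sup>2"
    proof -
      have "of_int k * t - of_int k * s = 2 * ?x" by (simp add: algebra_simps)
      then show ?thesis by (simp only: cos_double_sin)
    qed
    then show ?thesis by (simp add: power_mult_distrib)
  qed
  finally have "(norm (mode k t v - mode k s v))\<^sup>2 = (2 * \<bar>sin ?x\<bar> * norm v)\<^sup>2" by (simp add: power_mult_distrib)
  then have "norm (mode k t v - mode k s v) = 2 * \<bar>sin ?x\<bar> * norm v"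
    by (rule power2_eq_imp_eq) auto
  also have "\<dots> \<le> min 2 (\<bar>of_int k\<bar> * \<bar>t - s\<bar>) * norm v"
    using abs_sin_x_le_abs_x[of ?x] by (intro mult_right_mono) (auto simp: abs_mult)
  finally show ?thesis .
qed

text \<open>Cauchy--Schwarz, with the mean square of the derivative as one factor; the 2 counts the
  frequencies \<open>k\<close> and \<open>- k\<close>. One choice of weights gives a modulus of
  continuity, another a sup bound.\<close>

lemma weighted_coeff_sum:
  fixes a :: "int \<Rightarrow> real^'n"
  assumes C: "(\<Sum>k\<in>{- int N..int N}. (norm (of_int k *\<^sub>R a k))\<^sup>2) \<le> C"
    and W: "(\<Sum>k\<in>{1..N}. (w k)\<^sup>2) \<le> W" and w: "\<And>k. k \<in> {1..N} \<Longrightarrow> 0 \<le> w k"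
    and b: "b 0 \<le> 0" "\<And>k. k \<in> {- int N..int N} \<Longrightarrow> k \<noteq> 0 \<Longrightarrow> b k \<le> norm (of_int k *\<^sub>R a k) * w (nat \<bar>k\<bar>)"
  shows "(\<Sum>k\<in>{- int N..int N}. b k) \<le> sqrt C * sqrt (2 * W)"
proof -
  let ?R = "{- int N..int N}"
  have "(\<Sum>k\<in>?R. b k) \<le> (\<Sum>k\<in>?R - {0}. b k)"
    using b(1) by (subst sum.remove[of ?R 0]) auto
  also have "\<dots> \<le> (\<Sum>k\<in>?R - {0}. \<bar>norm (of_int k *\<^sub>R a k)\<bar> * \<bar>w (nat \<bar>k\<bar>)\<bar>)"
    by (rule sum_mono) (use b(2) w in \<open>auto simp: nat_le_iff\<close>, smt (verit, best) abs_ge_self mult_left_mono norm_ge_zero mult_nonneg_nonneg abs_ge_zero)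
  also have "\<dots> \<le> L2_set (\<lambda>k. norm (of_int k *\<^sub>R a k)) (?R - {0}) * L2_set (\<lambda>k. w (nat \<bar>k\<bar>)) (?R - {0})"
    by (rule L2_set_mult_ineq)
  also have "\<dots> \<le> sqrt C * sqrt (2 * W)"
  proof (rule mult_mono)
    have "(\<Sum>k\<in>?R - {0}. (norm (of_int k *\<^sub>R a k))\<^sup>2) \<le> (\<Sum>k\<in>?R. (norm (of_int k *\<^sub>R a k))\<^sup>2)"
      by (rule sum_mono2) auto
    then show "L2_set (\<lambda>k. norm (of_int k *\<^sub>R a k)) (?R - {0}) \<le> sqrt C"
      unfolding L2_set_def using C by (intro real_sqrt_le_mono) linarith
    have "?R - {0} = int ` {1..N} \<union> (\<lambda>k. - int k) ` {1..N}"
    proof (intro equalityI subsetI)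
      fix k assume "k \<in> ?R - {0}"
      then have "k = int (nat k) \<and> nat k \<in> {1..N} \<or> k = - int (nat (- k)) \<and> nat (- k) \<in> {1..N}" by auto
      then show "k \<in> int ` {1..N} \<union> (\<lambda>k. - int k) ` {1..N}" by blast
    qed auto
    then have "(\<Sum>k\<in>?R - {0}. (w (nat \<bar>k\<bar>))\<^sup>2)
      = (\<Sum>k\<in>int ` {1..N}. (w (nat \<bar>k\<bar>))\<^sup>2) + (\<Sum>k\<in>(\<lambda>k. - int k) ` {1..N}. (w (nat \<bar>k\<bar>))\<^sup>2)"
      by (simp only:) (rule sum.union_disjoint, auto)
    also have "\<dots> = 2 * (\<Sum>k\<in>{1..N}. (w k)\<^sup>2)"
      by (simp add: sum.reindex inj_on_def)
    finally show "L2_set (\<lambda>k. w (nat \<bar>k\<bar>)) (?R - {0}) \<le> sqrt (2 * W)"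
      unfolding L2_set_def using W by (intro real_sqrt_le_mono) linarith
    have "0 \<le> C" using C by (rule order_trans[rotated]) (simp add: sum_nonneg)
    then show "0 \<le> sqrt C" by simp
  qed (simp add: L2_set_nonneg)
  finally show ?thesis .
qed

text \<open>The embedding of \<open>H^1\<close> into the continuous functions, with constants free
  of \<open>N\<close>: the increment of a mode is at most \<open>|k| |a_k|\<close> times the weight
  of \<open>small_weights\<close>.\<close>

lemma trig_equicontinuous:
  assumes C: "(\<Sum>k\<in>{- int N..int N}. (norm (of_int k *\<^sub>R a k))\<^sup>2) \<le> C"
    and W: "(\<Sum>k\<in>{1..N}. (min (2 / real k) \<delta>)\<^sup>2) \<le> W" and \<delta>: "\<bar>t - s\<bar> \<le> \<delta>"
  shows "norm (trig N a t - trig N a s) \<le> sqrt C * sqrt (2 * W)"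
proof -
  have "norm (trig N a t - trig N a s) \<le> (\<Sum>k\<in>{- int N..int N}. norm (mode k t (a k) - mode k s (a k)))"
    unfolding trig_def sum_subtractf[symmetric] by (rule norm_sum)
  also have "\<dots> \<le> sqrt C * sqrt (2 * W)"
  proof (rule weighted_coeff_sum[OF C W])
    fix k :: int assume k: "k \<noteq> 0"
    have "norm (mode k t (a k) - mode k s (a k)) \<le> min 2 (\<bar>of_int k\<bar> * \<bar>t - s\<bar>) * norm (a k)" by (rule norm_mode_diff)
    also have "\<dots> \<le> (\<bar>of_int k\<bar> * min (2 / \<bar>of_int k\<bar>) \<delta>) * norm (a k)"
    proof (rule mult_right_mono)
      have "min 2 (\<bar>of_int k\<bar> * \<bar>t - s\<bar>) \<le> min (\<bar>of_int k\<bar> * (2 / \<bar>of_int k\<bar>)) (\<bar>of_int k\<bar> * \<delta> :: real)"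
        using \<delta> k by (intro min.mono mult_left_mono) auto
      then show "min 2 (\<bar>of_int k\<bar> * \<bar>t - s\<bar>) \<le> \<bar>of_int k\<bar> * min (2 / \<bar>of_int k\<bar>) (\<delta> :: real)"
        by (simp add: min_mult_distrib_left)
    qed simp
    also have "\<dots> = norm (of_int k *\<^sub>R a k) * min (2 / real (nat \<bar>k\<bar>)) \<delta>" by (simp add: mult_ac)
    finally show "norm (mode k t (a k) - mode k s (a k)) \<le> norm (of_int k *\<^sub>R a k) * min (2 / real (nat \<bar>k\<bar>)) \<delta>" .
  qed (use \<delta> in \<open>auto simp: mode_def\<close>)
  finally show ?thesis .
qed

text \<open>The same with weights \<open>1 / k\<close>, whose squares sum to at most 2; the constant
  mode is split off.\<close>

lemma trig_bound:
  assumes C: "(\<Sum>k\<in>{- int N..int N}. (norm (of_int k *\<^sub>R a k))\<^sup>2) \<le> C"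
  shows "norm (trig N a t) \<le> norm (a 0) + sqrt C * sqrt (2 * 2)"
proof -
  have "norm (trig N a t) \<le> (\<Sum>k\<in>{- int N..int N}. norm (a k))" by (rule norm_trig_le)
  also have "\<dots> = norm (a 0) + (\<Sum>k\<in>{- int N..int N}. if k = 0 then 0 else norm (a k))"
    by (subst (1 2) sum.remove[of _ 0]) (auto intro!: sum.cong)
  also have "(\<Sum>k\<in>{- int N..int N}. if k = 0 then 0 else norm (a k)) \<le> sqrt C * sqrt (2 * 2)"
  proof (rule weighted_coeff_sum[OF C])
    have "(\<Sum>k\<in>{1..N}. (1 / real k)\<^sup>2) \<le> (\<Sum>k\<in>insert 1 {1<..N}. (1 / real k)\<^sup>2)" by (intro sum_mono2) auto
    also have "\<dots> \<le> 2" using inverse_square_tail[of 1 N] by (simp add: power_divide)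
    finally show "(\<Sum>k\<in>{1..N}. (1 / real k)\<^sup>2) \<le> 2" .
  qed auto
  finally show ?thesis by simp
qed

lemma coef_trig:
  assumes k: "k \<in> {- int N..int N}"
  shows "coef (2 * N + 1) (trig N a) k = a k"
proof (rule vector_eq_ldot[THEN iffD1], rule allI)
  fix v
  have "v \<bullet> coef (2 * N + 1) (trig N a) k = gavg (2 * N + 1) (\<lambda>t. trig N (\<lambda>l. if l = k then v else 0) t \<bullet> trig N a t)"
    unfolding gavg_trig_coef using k by (simp add: if_distrib[of "\<lambda>x. x \<bullet> _"] cong: if_cong)
  also have "\<dots> = v \<bullet> a k"
    unfolding gavg_trig_inner using k by (simp add: if_distrib[of "\<lambda>x. x \<bullet> _"] cong: if_cong)
  finally show "v \<bullet> coef (2 * N + 1) (trig N a) k = v \<bullet> a k" .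
qed

lemma coef_component:
  "coef M y k $ i = gavg M (\<lambda>t. cos (of_int k * t) * (fst (y t) $ i)) + gavg M (\<lambda>t. sin (of_int k * t) * (snd (y t) $ i))"
  unfolding coef_def gavg_add[symmetric]
  by (subst gavg_linear[OF bounded_linear_vec_nth]) simp

lemma trig_reflect:
  "trig N a (2 * pi - t) = (fst (trig N a t), - snd (trig N a t))"
proof -
  have "cos (of_int k * (2 * pi - t)) = cos (of_int k * t)" "sin (of_int k * (2 * pi - t)) = - sin (of_int k * t)" for k :: int
  proof -
    have "of_int k * (2 * pi - t) = - (of_int k * t) + 2 * pi * of_int k" by (simp add: algebra_simps)
    then show "cos (of_int k * (2 * pi - t)) = cos (of_int k * t)" "sin (of_int k * (2 * pi - t)) = - sin (of_int k * t)"
      by (simp_all only: cos_add sin_add cos_int_2pin sin_int_2pin) simp_all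
  qed
  then show ?thesis by (simp add: prod_eq_iff fst_trig snd_trig sum_negf)
qed

lemma integral_odd:
  fixes w :: "real \<Rightarrow> real"
  assumes "\<And>t. t \<in> {0..c} \<Longrightarrow> w (c - t) = - w t"
  shows "integral {0..c} w = 0"
proof -
  have "integral {0..c} w = integral {0..c} (\<lambda>t. w (c - t))" by (rule integral_reverse[symmetric])
  also have "\<dots> = integral {0..c} (\<lambda>t. - w t)" by (rule integral_cong) (rule assms)
  finally show ?thesis by simp
qed


lemma compose_uniform_limit:
  fixes \<Psi> :: "'a::euclidean_space \<Rightarrow> real"
  assumes \<Psi>: "continuous_on UNIV \<Psi>" and K: "\<And>p t. norm (y p t) \<le> K" "\<And>t. t \<in> S \<Longrightarrow> norm (z t) \<le> K"
    and unif: "\<And>e. 0 < e \<Longrightarrow> \<exists>N::nat. \<forall>p t. p \<ge> N \<and> t \<in> S \<longrightarrow> norm (y p t - z t) < e" and \<epsilon>: "\<epsilon> > 0"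
  shows "\<forall>\<^sub>F p in sequentially. \<forall>t\<in>S. \<bar>\<Psi> (y p t) - \<Psi> (z t)\<bar> \<le> \<epsilon>"
proof -
  have "uniformly_continuous_on (cball 0 K) \<Psi>"
    by (intro compact_uniformly_continuous continuous_on_subset[OF \<Psi>]) auto
  then obtain d where d: "d > 0" "\<And>x x'. x \<in> cball 0 K \<Longrightarrow> x' \<in> cball 0 K \<Longrightarrow> dist x' x < d \<Longrightarrow> dist (\<Psi> x') (\<Psi> x) < \<epsilon>"
    using \<epsilon> unfolding uniformly_continuous_on_def by metis
  obtain N where N: "\<forall>p t. p \<ge> N \<and> t \<in> S \<longrightarrow> norm (y p t - z t) < d" using unif[OF d(1)] by blast
  have "\<bar>\<Psi> (y p t) - \<Psi> (z t)\<bar> \<le> \<epsilon>" if "p \<ge> N" "t \<in> S" for p t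
    using d(2)[of "z t" "y p t"] N that K by (simp add: dist_norm less_imp_le)
  then show ?thesis by (auto simp: eventually_sequentially)
qed

section \<open>The limit of the critical points is a periodic orbit\<close>

context hz_hamiltonian begin

lemma g_reflect:
  assumes sym: "\<And>z. h (fst z, - snd z) = h z"
  shows "g (fst z, - snd z) = (fst (g z), - snd (g z))"
proof -
  let ?R = "\<lambda>z :: (real^'n) \<times> (real^'n). (fst z, - snd z)"
  have "bounded_linear ?R"
    by (intro bounded_linear_Pair bounded_linear_fst bounded_linear_minus bounded_linear_snd)
  then have "(?R has_derivative ?R) (at z)" by (rule bounded_linear_imp_has_derivative)
  from has_derivative_compose[OF this deriv]
  have "(h has_derivative (\<lambda>w. g (?R z) \<bullet> ?R w)) (at z)" by (simp add: sym)
  from has_derivative_unique[OF this deriv]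
  have "g (?R z) \<bullet> ?R w = g z \<bullet> w" for w by metis
  then have "?R (g (?R z)) \<bullet> w = g z \<bullet> w" for w by (simp add: inner_prod_def)
  then have "?R (g (?R z)) = g z" using vector_eq_rdot by blast
  then show ?thesis by (metis fst_conv minus_minus prod.collapse snd_conv)
qed

text \<open>The critical equation expresses the coefficients of the derivative through
  \<open>g\<close>, which bounds the approximations in \<open>H^1\<close>. Arzela--Ascoli gives a
  uniform limit, whose Fourier moments satisfy Hamilton's equation. Uniform convergence also
  preserves the action level \<open>\<beta>\<close>, so the action density is positive
  somewhere.\<close>

theorem periodic_solution:
  assumes sym: "\<And>z. h (fst z, - snd z) = h z"
  obtains Z where "\<And>t. (Z has_vector_derivative (- snd (g (Z t)), fst (g (Z t)))) (at t)"
    "\<And>t. Z (t + 2 * pi) = Z t" "\<And>t. Z (- t) = (fst (Z t), - snd (Z t))"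
    "\<exists>t. h (Z t) < g (Z t) \<bullet> Z t / 2"
proof -
  obtain \<beta> where \<beta>: "\<beta> > 0" "\<And>N. N \<ge> 1 \<Longrightarrow> \<exists>a. nm N (F N a) = 0 \<and> f N a \<ge> \<beta>"
    by (rule critical_points, rule that)
  then have "\<forall>p. \<exists>a. nm (Suc p) (F (Suc p) a) = 0 \<and> f (Suc p) a \<ge> \<beta>" by simp
  then obtain a where a: "\<And>p. nm (Suc p) (F (Suc p) (a p)) = 0" "\<And>p. f (Suc p) (a p) \<ge> \<beta>" by metis
  obtain \<kappa> C where \<kappa>: "\<kappa> > 0" "\<And>N a. \<kappa> * nm N a - C \<le> nm N (F N a)" using F_coercive by blast
  define C1 where "C1 = C / \<kappa>"
  \<comment> \<open>At a critical point coercivity bounds the norm by its constant term.\<close>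
  have b1: "nm (Suc p) (a p) \<le> C1" for p
    using \<kappa>(2)[of "Suc p" "a p"] a(1)[of p] \<kappa>(1) by (simp add: C1_def field_simps)
  have C10: "0 \<le> C1" using b1[of 0] nm_nonneg order_trans by blast
  have crit: "of_int k *\<^sub>R a p k = coef (2 * Suc p + 1) (\<lambda>t. g (trig (Suc p) (a p) t)) k" if "k \<in> {- int (Suc p)..int (Suc p)}" for k p
  proof -
    have "norm (F (Suc p) (a p) k) \<le> 0" using norm_le_nm[OF that, of "F (Suc p) (a p)"] a(1)[of p] by simp
    then show ?thesis using that by (simp add: F_def)
  qed
  obtain Cg where Cg: "\<And>z. norm (g z - B z) \<le> Cg" by (rule bounded_diff_quad, rule that)
  obtain K where K: "K > 0" "\<And>z. norm (B z) \<le> norm z * K"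
    using bounded_linear.pos_bounded[OF bounded_linear_B] by blast
  have gK: "(norm (g z))\<^sup>2 \<le> 2 * K\<^sup>2 * (norm z)\<^sup>2 + 2 * Cg\<^sup>2" for z
  proof -
    have "norm (g z) \<le> norm (B z) + norm (g z - B z)" using norm_triangle_ineq[of "B z" "g z - B z"] by simp
    also have "\<dots> \<le> norm z * K + Cg" using K(2)[of z] Cg[of z] by linarith
    finally have "(norm (g z))\<^sup>2 \<le> (norm z * K + Cg)\<^sup>2" by (rule power_mono) simp
    also have "\<dots> \<le> 2 * (norm z * K)\<^sup>2 + 2 * Cg\<^sup>2" by (smt (verit) sum_squares_bound power2_sum)
    finally show ?thesis by (simp add: power_mult_distrib mult_ac)
  qed
  define C2 where "C2 = 2 * K\<^sup>2 * C1\<^sup>2 + 2 * Cg\<^sup>2"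
  \<comment> \<open>Bessel's inequality for the critical equation: the mean square of the derivative
    is bounded uniformly in \<open>p\<close>.\<close>
  have b2: "(\<Sum>k\<in>{- int (Suc p)..int (Suc p)}. (norm (of_int k *\<^sub>R a p k))\<^sup>2) \<le> C2" for p
  proof -
    have "(\<Sum>k\<in>{- int (Suc p)..int (Suc p)}. (norm (of_int k *\<^sub>R a p k))\<^sup>2)
      = (\<Sum>k\<in>{- int (Suc p)..int (Suc p)}. (norm (coef (2 * Suc p + 1) (\<lambda>t. g (trig (Suc p) (a p) t)) k))\<^sup>2)"
      by (rule sum.cong[OF refl]) (simp only: crit)
    also have "\<dots> \<le> gavg (2 * Suc p + 1) (\<lambda>t. (norm (g (trig (Suc p) (a p) t)))\<^sup>2)" by (rule bessel)
    also have "\<dots> \<le> gavg (2 * Suc p + 1) (\<lambda>t. 2 * K\<^sup>2 * (norm (trig (Suc p) (a p) t))\<^sup>2 + 2 * Cg\<^sup>2)"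
      by (rule gavg_mono) (rule gK)
    also have "\<dots> = 2 * K\<^sup>2 * (nm (Suc p) (a p))\<^sup>2 + 2 * Cg\<^sup>2"
      unfolding gavg_add gavg_cmult gavg_trig_norm nm_sq by simp
    also have "\<dots> \<le> C2" unfolding C2_def using b1[of p] nm_nonneg by (intro add_right_mono mult_left_mono power_mono) auto
    finally show ?thesis .
  qed
  have C20: "0 \<le> C2" using C10 by (simp add: C2_def)
  define R where "R = C1 + sqrt C2 * sqrt (2 * 2)"
  have b3: "norm (trig (Suc p) (a p) t) \<le> R" for p t
    using trig_bound[OF b2, of p t] norm_le_nm[of 0 "Suc p" "a p"] b1[of p] by (simp add: R_def)
  have b4: "\<exists>d. 0 < d \<and> (\<forall>n y. y \<in> {0..2*pi} \<and> norm (x - y) < d \<longrightarrow> norm (trig (Suc n) (a n) x - trig (Suc n) (a n) y) < e)"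
    if e: "e > 0" for x e
  proof -
    \<comment> \<open>Makes the equicontinuity constant \<open>sqrt C2 * sqrt (2 * w)\<close>
      smaller than \<open>e\<close>; the added 1 avoids a division by zero.\<close>
    define w where "w = (e / (2 * (sqrt C2 + 1)))\<^sup>2 / 2"
    have s0: "sqrt C2 \<ge> 0" using C20 by simp
    then have pos: "2 * (sqrt C2 + 1) > 0" by (intro mult_pos_pos add_nonneg_pos) auto
    have w: "w > 0" unfolding w_def using e pos by simp
    have "sqrt (2 * w) = e / (2 * (sqrt C2 + 1))"
      by (rule real_sqrt_unique) (use e pos in \<open>auto simp: w_def\<close>)
    then have "sqrt C2 * sqrt (2 * w) = sqrt C2 * e / (2 * (sqrt C2 + 1))" by simp
    moreover have "sqrt C2 * e < e * (2 * (sqrt C2 + 1))"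
      using mult_nonneg_nonneg[OF s0 less_imp_le[OF e]] e by (simp add: algebra_simps)
    ultimately have "sqrt C2 * sqrt (2 * w) < e" by (simp only: pos_divide_less_eq[OF pos])
    then have lt: "sqrt C2 * sqrt (2 * w) < e" .
    obtain \<delta> where \<delta>: "\<delta> > 0" "\<And>N. (\<Sum>k\<in>{1..N}. (min (2 / real k) \<delta>)\<^sup>2) \<le> w"
      using small_weights[OF w] by blast
    show ?thesis
    proof (intro exI[of _ \<delta>] conjI allI impI)
      fix n s assume "s \<in> {0..2*pi} \<and> norm (x - s) < \<delta>"
      then have "\<bar>x - s\<bar> \<le> \<delta>" by simp
      from trig_equicontinuous[OF b2 \<delta>(2) this] lt
      show "norm (trig (Suc n) (a n) x - trig (Suc n) (a n) s) < e" by (rule le_less_trans)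
    qed (rule \<delta>(1))
  qed
  obtain z r where z: "continuous_on {0..2*pi} z" and r: "strict_mono (r :: nat \<Rightarrow> nat)"
    and unif: "\<And>e. 0 < e \<Longrightarrow> \<exists>N. \<forall>n x. n \<ge> N \<and> x \<in> {0..2*pi} \<longrightarrow> norm (trig (Suc (r n)) (a (r n)) x - z x) < e"
    using Arzela_Ascoli[of "{0..2*pi}" "\<lambda>p. trig (Suc p) (a p)" R] b3 b4 by (metis compact_Icc)
  define M where "M p = 2 * Suc (r p) + 1" for p
  define y where "y p = trig (Suc (r p)) (a (r p))" for p
  have yz: "(\<lambda>p. y p t) \<longlonglongrightarrow> z t" if "t \<in> {0..2*pi}" for t
    using unif that unfolding LIMSEQ_iff y_def by blast
  have zR: "norm (z t) \<le> R" if "t \<in> {0..2*pi}" for t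
    by (rule LIMSEQ_le_const2[OF tendsto_norm[OF yz[OF that]]]) (simp add: y_def b3)
  have M: "filterlim M at_top sequentially"
  proof (rule filterlim_at_top_mono)
    show "filterlim r at_top sequentially" using r by (rule filterlim_subseq)
  qed (simp add: M_def)
  have lim: "(\<lambda>p. gavg (M p) (\<lambda>t. w t * \<Psi> (y p t))) \<longlonglongrightarrow> integral {0..2*pi} (\<lambda>t. w t * \<Psi> (z t)) / (2*pi)"
    if \<Psi>: "continuous_on UNIV \<Psi>" and w: "continuous_on {0..2*pi} w" "\<And>t. \<bar>w t\<bar> \<le> 1" for w :: "real \<Rightarrow> real" and \<Psi>
  proof (rule gavg_tendsto_integral[OF _ M])
    show "continuous_on {0..2*pi} (\<lambda>t. w t * \<Psi> (z t))"
      by (intro continuous_intros w continuous_on_compose2[OF \<Psi> z]) auto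
    fix \<epsilon> :: real assume "\<epsilon> > 0"
    then have "\<forall>\<^sub>F p in sequentially. \<forall>t\<in>{0..2*pi}. \<bar>\<Psi> (y p t) - \<Psi> (z t)\<bar> \<le> \<epsilon>"
      by (intro compose_uniform_limit[OF \<Psi>, of y R "{0..2*pi}" z]) (use b3 zR unif in \<open>auto simp only: y_def\<close>)
    then show "\<forall>\<^sub>F p in sequentially. \<forall>t\<in>{0..2*pi}. \<bar>w t * \<Psi> (y p t) - w t * \<Psi> (z t)\<bar> \<le> \<epsilon>"
    proof (rule eventually_mono, intro ballI)
      fix p t assume *: "\<forall>t\<in>{0..2*pi}. \<bar>\<Psi> (y p t) - \<Psi> (z t)\<bar> \<le> \<epsilon>" "t \<in> {0..2*pi}"
      have "\<bar>w t * \<Psi> (y p t) - w t * \<Psi> (z t)\<bar> = \<bar>w t\<bar> * \<bar>\<Psi> (y p t) - \<Psi> (z t)\<bar>"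
        by (simp add: right_diff_distrib[symmetric] abs_mult)
      also have "\<dots> \<le> 1 * \<epsilon>" using * w by (intro mult_mono) auto
      finally show "\<bar>w t * \<Psi> (y p t) - w t * \<Psi> (z t)\<bar> \<le> \<epsilon>" by simp
    qed
  qed
  have zsym: "z (2 * pi - t) = (fst (z t), - snd (z t))" if t: "t \<in> {0..2*pi}" for t
  proof (rule LIMSEQ_unique)
    show "(\<lambda>p. y p (2 * pi - t)) \<longlonglongrightarrow> z (2 * pi - t)" by (rule yz) (use t in auto)
    show "(\<lambda>p. y p (2 * pi - t)) \<longlonglongrightarrow> (fst (z t), - snd (z t))"
      unfolding y_def trig_reflect by (intro tendsto_intros yz[OF t, unfolded y_def])
  qed
  have zper: "z (2 * pi) = z 0"
  proof (rule LIMSEQ_unique)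
    show "(\<lambda>p. y p (2 * pi)) \<longlonglongrightarrow> z (2 * pi)" by (rule yz) auto
    have "y p (2 * pi) = y p 0" for p
      using trig_reflect[of "Suc (r p)" "a (r p)" 0] by (simp add: y_def prod_eq_iff snd_trig)
    then show "(\<lambda>p. y p (2 * pi)) \<longlonglongrightarrow> z 0" using yz[of 0] by simp
  qed
  have sc: "continuous_on S (\<lambda>t. cos (c * t))" "continuous_on S (\<lambda>t. sin (c * t))" for c :: real and S
    by (intro continuous_intros)+
  define I where "I w = integral {0..2*pi} w" for w :: "real \<Rightarrow> real"
  have eq: "of_int k * (I (\<lambda>t. cos (of_int k * t) * fst (z t) $ i) + I (\<lambda>t. sin (of_int k * t) * snd (z t) $ i))
     = I (\<lambda>t. cos (of_int k * t) * fst (g (z t)) $ i) + I (\<lambda>t. sin (of_int k * t) * snd (g (z t)) $ i)" for k :: int and i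
  proof -
    have lim2: "(\<lambda>p. coef (M p) (\<lambda>t. G (y p t)) k $ i) \<longlonglongrightarrow>
       (I (\<lambda>t. cos (of_int k * t) * fst (G (z t)) $ i) + I (\<lambda>t. sin (of_int k * t) * snd (G (z t)) $ i)) / (2*pi)"
      if G: "continuous_on UNIV G" for G
      unfolding coef_component I_def add_divide_distrib
      by (intro tendsto_add lim sc continuous_intros G) auto
    \<comment> \<open>A fixed frequency \<open>k\<close> is eventually within the degree
      \<open>Suc (r p)\<close>, and from then on the critical equation applies to it.\<close>
    have "\<forall>\<^sub>F p in sequentially. coef (M p) (\<lambda>t. g (y p t)) k $ i = of_int k * coef (M p) (\<lambda>t. y p t) k $ i"
    proof (rule eventually_sequentiallyI[of "nat \<bar>k\<bar>"])
      fix p assume "nat \<bar>k\<bar> \<le> p"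
      moreover have "p \<le> r p" using r by (rule strict_mono_imp_increasing)
      ultimately have k: "k \<in> {- int (Suc (r p))..int (Suc (r p))}" by auto
      have "coef (M p) (\<lambda>t. y p t) k = a (r p) k" unfolding y_def M_def by (rule coef_trig[OF k])
      then show "coef (M p) (\<lambda>t. g (y p t)) k $ i = of_int k * coef (M p) (\<lambda>t. y p t) k $ i"
        using crit[OF k] unfolding y_def M_def by (metis vector_scaleR_component real_scaleR_def)
    qed
    then have "(\<lambda>p. of_int k * coef (M p) (\<lambda>t. y p t) k $ i) \<longlonglongrightarrow>
      (I (\<lambda>t. cos (of_int k * t) * fst (g (z t)) $ i) + I (\<lambda>t. sin (of_int k * t) * snd (g (z t)) $ i)) / (2*pi)"
      by (intro Lim_transform_eventually[OF lim2[OF cont_g]])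
    moreover have "(\<lambda>p. of_int k * coef (M p) (\<lambda>t. y p t) k $ i) \<longlonglongrightarrow>
      of_int k * ((I (\<lambda>t. cos (of_int k * t) * fst (z t) $ i) + I (\<lambda>t. sin (of_int k * t) * snd (z t) $ i)) / (2*pi))"
      by (intro tendsto_mult tendsto_const lim2 continuous_on_id)
    ultimately have "of_int k * ((I (\<lambda>t. cos (of_int k * t) * fst (z t) $ i) + I (\<lambda>t. sin (of_int k * t) * snd (z t) $ i)) / (2*pi))
       = (I (\<lambda>t. cos (of_int k * t) * fst (g (z t)) $ i) + I (\<lambda>t. sin (of_int k * t) * snd (g (z t)) $ i)) / (2*pi)"
      using LIMSEQ_unique by blast
    then show ?thesis by (simp add: field_simps)
  qed
  have per: "cos (real k * (2 * pi - t)) = cos (real k * t)" "sin (real k * (2 * pi - t)) = - sin (real k * t)" for k t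
  proof -
    have "real k * (2 * pi - t) = - (real k * t) + 2 * pi * of_int (int k)" by (simp add: algebra_simps)
    then show "cos (real k * (2 * pi - t)) = cos (real k * t)" "sin (real k * (2 * pi - t)) = - sin (real k * t)"
      by (simp_all only: cos_add sin_add cos_int_2pin sin_int_2pin) simp_all
  qed
  \<comment> \<open>These integrands are odd under \<open>t\<close> to \<open>2*pi - t\<close>:
    \<open>q\<close> and the \<open>q\<close>-part of the gradient are even, \<open>p\<close> and
    the \<open>p\<close>-part are odd.\<close>
  have zero: "I (\<lambda>t. sin (real k * t) * fst (z t) $ i) = 0" "I (\<lambda>t. cos (real k * t) * snd (z t) $ i) = 0"
    "I (\<lambda>t. sin (real k * t) * fst (g (z t)) $ i) = 0" "I (\<lambda>t. cos (real k * t) * snd (g (z t)) $ i) = 0" for k i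
    unfolding I_def by (rule integral_odd; simp add: zsym g_reflect[OF sym] per)+
  \<comment> \<open>Sum and difference of the identities at \<open>k\<close> and \<open>- k\<close>
    separate the cosine moments from the sine moments.\<close>
  have rel: "real k * I (\<lambda>t. cos (real k * t) * fst (z t) $ i) = I (\<lambda>t. sin (real k * t) * snd (g (z t)) $ i)"
    "real k * I (\<lambda>t. sin (real k * t) * snd (z t) $ i) = I (\<lambda>t. cos (real k * t) * fst (g (z t)) $ i)" for k i
    using eq[of "int k" i] eq[of "- int k" i] by (simp_all add: I_def algebra_simps)
  have zc: "continuous_on {0..2*pi} (\<lambda>t. fst (z t) $ i)" "continuous_on {0..2*pi} (\<lambda>t. snd (z t) $ i)"
    "continuous_on {0..2*pi} (\<lambda>t. fst (g (z t)) $ i)" "continuous_on {0..2*pi} (\<lambda>t. - snd (g (z t)) $ i)" for i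
    by (intro continuous_intros z continuous_on_compose2[OF cont_g z]; simp)+
  have dq: "((\<lambda>t. fst (z t) $ i) has_real_derivative - snd (g (z t)) $ i) (at t within {0..2*pi})" if "t \<in> {0..2*pi}" for t i
  proof (rule weak_derivative[OF zc(1,4) _ _ _ that])
    show "integral {0..2*pi} (\<lambda>t. - snd (g (z t)) $ i) = 0" using zero(4)[of 0 i] by (simp add: I_def)
    show "integral {0..2*pi} (\<lambda>t. - snd (g (z t)) $ i * sin (real k * t)) = - real k * integral {0..2*pi} (\<lambda>t. fst (z t) $ i * cos (real k * t))" for k
      using rel(1)[of k i] by (simp add: I_def mult.commute)
    show "integral {0..2*pi} (\<lambda>t. - snd (g (z t)) $ i * cos (real k * t)) = real k * integral {0..2*pi} (\<lambda>t. fst (z t) $ i * sin (real k * t))" for k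
      using zero(1,4)[of k i] by (simp add: I_def mult.commute)
  qed
  have dp: "((\<lambda>t. snd (z t) $ i) has_real_derivative fst (g (z t)) $ i) (at t within {0..2*pi})" if "t \<in> {0..2*pi}" for t i
  proof (rule weak_derivative[OF zc(2,3) _ _ _ that])
    show "integral {0..2*pi} (\<lambda>t. fst (g (z t)) $ i) = 0" using rel(2)[of 0 i] by (simp add: I_def)
    show "integral {0..2*pi} (\<lambda>t. fst (g (z t)) $ i * sin (real k * t)) = - real k * integral {0..2*pi} (\<lambda>t. snd (z t) $ i * cos (real k * t))" for k
      using zero(2,3)[of k i] by (simp add: I_def mult.commute)
    show "integral {0..2*pi} (\<lambda>t. fst (g (z t)) $ i * cos (real k * t)) = real k * integral {0..2*pi} (\<lambda>t. snd (z t) $ i * sin (real k * t))" for k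
      using rel(2)[of k i] by (simp add: I_def mult.commute)
  qed
  have dz: "(z has_vector_derivative (\<lambda>z. (- snd (g z), fst (g z))) (z t)) (at t within {0..2*pi})" if "t \<in> {0..2*pi}" for t
    unfolding has_vector_derivative_def
  proof (subst has_derivative_componentwise_within, rule ballI)
    fix b :: "(real^'n) \<times> (real^'n)" assume "b \<in> Basis"
    then consider i where "b = (axis i 1, 0)" | i where "b = (0, axis i 1)" by (auto simp: Basis_prod_def Basis_vec_def)
    then show "((\<lambda>x. z x \<bullet> b) has_derivative (\<lambda>x. x *\<^sub>R (- snd (g (z t)), fst (g (z t))) \<bullet> b)) (at t within {0..2*pi})"
    proof cases
      case 1
      have "(\<lambda>x. z x \<bullet> b) = (\<lambda>x. fst (z x) $ i)" by (simp add: 1 inner_prod_def inner_axis)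
      moreover have "(\<lambda>x. x *\<^sub>R (- snd (g (z t)), fst (g (z t))) \<bullet> b) = times (- snd (g (z t)) $ i)"
        by (simp add: 1 inner_prod_def inner_axis fun_eq_iff)
      ultimately show ?thesis using dq[OF that, of i] by (simp only: has_field_derivative_def)
    next
      case 2
      have "(\<lambda>x. z x \<bullet> b) = (\<lambda>x. snd (z x) $ i)" by (simp add: 2 inner_prod_def inner_axis)
      moreover have "(\<lambda>x. x *\<^sub>R (- snd (g (z t)), fst (g (z t))) \<bullet> b) = times (fst (g (z t)) $ i)"
        by (simp add: 2 inner_prod_def inner_axis fun_eq_iff)
      ultimately show ?thesis using dp[OF that, of i] by (simp only: has_field_derivative_def)
    qed
  qed
  obtain Z where Z: "\<And>t. t \<in> {0..2*pi} \<Longrightarrow> Z t = z t" and Zper: "\<And>t m. Z (t + of_int m * (2*pi)) = Z t"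
    and dZ: "\<And>t. (Z has_vector_derivative (- snd (g (Z t)), fst (g (Z t)))) (at t)"
    using periodic_extension[of "2*pi" z "\<lambda>z. (- snd (g z), fst (g z))", OF _ zper dz] by auto
  show ?thesis
  proof (rule that[OF dZ])
    show "Z (t + 2 * pi) = Z t" for t using Zper[of t 1] by simp
    show "Z (- t) = (fst (Z t), - snd (Z t))" for t
    proof -
      define m where "m = \<lfloor>t / (2*pi)\<rfloor>"
      define s where "s = t - of_int m * (2*pi)"
      have "of_int m \<le> t / (2*pi)" "t / (2*pi) < of_int m + 1" unfolding m_def by linarith+
      then have s: "s \<in> {0..2*pi}" by (auto simp: s_def field_simps)
      have "Z t = z s" using Zper[of s m] Z[OF s] by (simp add: s_def)
      moreover have "Z (- t) = z (2*pi - s)"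
        using Zper[of "2*pi - s" "- m - 1"] Z[of "2*pi - s"] s by (simp add: s_def algebra_simps)
      ultimately show ?thesis using zsym[OF s] by simp
    qed
    show "\<exists>t. h (Z t) < g (Z t) \<bullet> Z t / 2"
    proof (rule ccontr)
      assume "\<not> ?thesis"
      then have le: "g (z t) \<bullet> z t / 2 - h (z t) \<le> 0" if "t \<in> {0..2*pi}" for t
        using Z[OF that] by (metis diff_le_0_iff_le not_less)
      let ?\<Psi> = "\<lambda>z. g z \<bullet> z / 2 - h z"
      have c\<Psi>: "continuous_on UNIV ?\<Psi>" by (intro continuous_intros cont_g cont_h) auto
      \<comment> \<open>At a critical point the quadratic part is half the mean of
        \<open>g z \<bullet> z\<close>, so the level of \<open>f\<close> is the mean of the
        pointwise action density \<open>?\<Psi>\<close>.\<close>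
      have "f (Suc (r p)) (a (r p)) = gavg (M p) (\<lambda>t. 1 * ?\<Psi> (y p t))" for p
      proof -
        let ?N = "Suc (r p)"
        have "(\<Sum>k\<in>{- int ?N..int ?N}. of_int k * (norm (a (r p) k))\<^sup>2)
          = (\<Sum>k\<in>{- int ?N..int ?N}. a (r p) k \<bullet> coef (2 * ?N + 1) (\<lambda>t. g (trig ?N (a (r p)) t)) k)"
        proof (rule sum.cong[OF refl])
          fix k assume k: "k \<in> {- int ?N..int ?N}"
          show "of_int k * (norm (a (r p) k))\<^sup>2 = a (r p) k \<bullet> coef (2 * ?N + 1) (\<lambda>t. g (trig ?N (a (r p)) t)) k"
            unfolding crit[OF k, symmetric] by (simp add: power2_norm_eq_inner)
        qed
        also have "\<dots> = gavg (2 * ?N + 1) (\<lambda>t. g (trig ?N (a (r p)) t) \<bullet> trig ?N (a (r p)) t)"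
          unfolding gavg_trig_coef[symmetric] by (simp add: inner_commute)
        finally show ?thesis unfolding f_def M_def y_def
          using gavg_cmult[of "2 * ?N + 1" "1/2" "\<lambda>t. g (trig ?N (a (r p)) t) \<bullet> trig ?N (a (r p)) t"]
          by (simp add: gavg_diff)
      qed
      then have "(\<lambda>p. f (Suc (r p)) (a (r p))) \<longlonglongrightarrow> integral {0..2*pi} (\<lambda>t. 1 * ?\<Psi> (z t)) / (2*pi)"
        using lim[OF c\<Psi>, of "\<lambda>_. 1"] by simp
      then have "\<beta> \<le> integral {0..2*pi} (\<lambda>t. 1 * ?\<Psi> (z t)) / (2*pi)"
        by (rule LIMSEQ_le_const) (use a(2) in auto)
      moreover have "integral {0..2*pi} (\<lambda>t. 1 * ?\<Psi> (z t)) \<le> integral {0..2*pi} (\<lambda>t. 0)"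
      proof (rule integral_le)
        show "(\<lambda>t. 1 * ?\<Psi> (z t)) integrable_on {0..2*pi}"
          by (intro integrable_continuous_real continuous_on_mult continuous_on_const continuous_on_compose2[OF c\<Psi> z]) auto
        show "1 * ?\<Psi> (z t) \<le> 0" if "t \<in> {0..2*pi}" for t using le[OF that] by simp
      qed (rule Henstock_Kurzweil_Integration.integrable_0)
      then have "integral {0..2*pi} (\<lambda>t. 1 * ?\<Psi> (z t)) / (2*pi) \<le> 0"
        by (intro divide_nonpos_pos) auto
      ultimately show False using \<beta>(1) by linarith
    qed
  qed
qed

end

section \<open>Symmetric orbits in cylinders over a rectangle\<close>

text \<open>\<open>\<rho>\<close> is the radius of the disc with the area of a rectangle of half
  sides \<open>a\<close> and \<open>b\<close>, and \<open>c\<close> is the abscissa of its centre.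
  Vertically the rectangle is centred at 0, so that the map to it can commute with the reflection in
  \<open>p\<close>.\<close>

locale flat_disc =
  fixes \<rho> a b c :: real and i0 :: "'n::finite"
  assumes pos: "\<rho> > 0" "a > 0" "b > 0" and area: "pi * \<rho>\<^sup>2 = 4 * a * b"
begin

text \<open>The area of the disc between the vertical chords at 0 and \<open>u\<close>, divided by
  the height \<open>2 * b\<close> of the rectangle. If chords go to full vertical segments,
  preservation of area forces this abscissa.\<close>

definition S :: "real \<Rightarrow> real" where
  "S u = (u * sqrt (\<rho>\<^sup>2 - u\<^sup>2) + \<rho>\<^sup>2 * arcsin (u / \<rho>)) / (2 * b)"

definition s1 :: "real \<Rightarrow> real" where "s1 u = sqrt (\<rho>\<^sup>2 - u\<^sup>2) / b"
text \<open>The factor that stretches the chord at \<open>u\<close> to half height \<open>b\<close>.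
  It is the reciprocal of \<open>s1 u\<close>, the derivative of \<open>S\<close>.\<close>

definition t1 :: "real \<Rightarrow> real" where "t1 u = b / sqrt (\<rho>\<^sup>2 - u\<^sup>2)"
definition t2 :: "real \<Rightarrow> real" where "t2 u = b * u / (sqrt (\<rho>\<^sup>2 - u\<^sup>2) * (\<rho>\<^sup>2 - u\<^sup>2))"

lemma disc_pos: "\<bar>u\<bar> < \<rho> \<Longrightarrow> 0 < \<rho>\<^sup>2 - u\<^sup>2"
  using abs_square_less_1[of "u / \<rho>"] pos by (simp add: power_divide abs_divide)

lemma DERIV_S: assumes "\<bar>u\<bar> < \<rho>" shows "(S has_real_derivative s1 u) (at u)"
proof -
  let ?w = "sqrt (\<rho>\<^sup>2 - u\<^sup>2)"
  have w: "?w > 0" "?w * ?w = \<rho>\<^sup>2 - u\<^sup>2" using disc_pos[OF assms] by auto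
  have u1: "-1 < u / \<rho>" "u / \<rho> < 1" using assms pos by (auto simp: field_simps abs_less_iff)
  have "1 - (u / \<rho>)\<^sup>2 = (\<rho>\<^sup>2 - u\<^sup>2) / \<rho>\<^sup>2" using pos by (simp add: power_divide diff_divide_distrib)
  then have "sqrt (1 - (u / \<rho>)\<^sup>2) = ?w / \<rho>" using pos by (simp add: real_sqrt_divide)
  then have "(S has_real_derivative ((?w + u * (- u / ?w)) + \<rho>\<^sup>2 * ((1 / \<rho>) / (?w / \<rho>))) / (2 * b)) (at u)"
    unfolding S_def using u1 w pos
    by (auto intro!: derivative_eq_intros simp: inverse_eq_divide field_simps)
  also have "((?w + u * (- u / ?w)) + \<rho>\<^sup>2 * ((1 / \<rho>) / (?w / \<rho>))) / (2 * b) = (?w * ?w - u\<^sup>2 + \<rho>\<^sup>2) / ?w / (2 * b)"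
    using w(1) pos by (simp add: field_simps power2_eq_square)
  also have "\<dots> = s1 u" unfolding w(2) using w pos by (simp add: s1_def field_simps)
  finally show ?thesis .
qed

lemma DERIV_t1: assumes "\<bar>u\<bar> < \<rho>" shows "(t1 has_real_derivative t2 u) (at u)"
proof -
  let ?w = "sqrt (\<rho>\<^sup>2 - u\<^sup>2)"
  have w: "?w > 0" "?w * ?w = \<rho>\<^sup>2 - u\<^sup>2" "0 < \<rho>\<^sup>2 - u\<^sup>2" using disc_pos[OF assms] by auto
  have "(t1 has_real_derivative - (b * (- u / ?w)) / (?w * ?w)) (at u)"
    unfolding t1_def using w(1,3)
    by (auto intro!: derivative_eq_intros simp: inverse_eq_divide field_simps)
  also have "- (b * (- u / ?w)) / (?w * ?w) = t2 u" using w(3) by (simp add: t2_def)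
  finally show ?thesis .
qed

lemma s1_t1: "\<bar>u\<bar> < \<rho> \<Longrightarrow> s1 u * t1 u = 1"
  using disc_pos[of u] pos by (simp add: s1_def t1_def)

lemma cont_S: "continuous_on {-\<rho>..\<rho>} S"
  unfolding S_def using pos by (intro continuous_intros) (auto simp: field_simps)

lemma S_ends: "S \<rho> = a" "S (- \<rho>) = - a"
  using pos area by (simp_all add: S_def field_simps)

lemma S_mono: assumes "- \<rho> \<le> u" "u < v" "v \<le> \<rho>" shows "S u < S v"
proof (rule DERIV_pos_imp_increasing_open[OF assms(2)])
  fix x assume "u < x" "x < v"
  then have x: "\<bar>x\<bar> < \<rho>" using assms by auto
  moreover have "s1 x > 0" using disc_pos[OF x] pos by (simp add: s1_def)
  ultimately show "\<exists>y. (S has_real_derivative y) (at x) \<and> 0 < y" using DERIV_S by blast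
qed (use assms in \<open>auto intro: continuous_on_subset[OF cont_S]\<close>)

definition T :: "real \<Rightarrow> real" where "T = the_inv_into {-\<rho>..\<rho>} S"

lemma inj_S: "inj_on S {-\<rho>..\<rho>}"
  by (rule linorder_inj_onI) (use S_mono in \<open>auto, fastforce\<close>)

lemma image_S: "S ` {-\<rho>..\<rho>} = {-a..a}"
proof
  have "S u \<le> S v" if "- \<rho> \<le> u" "u \<le> v" "v \<le> \<rho>" for u v
    using S_mono[of u v] that by (cases "u = v") auto
  then show "S ` {-\<rho>..\<rho>} \<subseteq> {-a..a}" using S_ends pos by force
  show "{-a..a} \<subseteq> S ` {-\<rho>..\<rho>}"
  proof
    fix y assume "y \<in> {-a..a}"
    then have "\<exists>x\<ge>-\<rho>. x \<le> \<rho> \<and> S x = y"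
      using S_ends pos by (intro IVT'[OF _ _ _ cont_S]) auto
    then show "y \<in> S ` {-\<rho>..\<rho>}" by force
  qed
qed

lemma S_T: "\<bar>y\<bar> \<le> a \<Longrightarrow> S (T y) = y"
  unfolding T_def by (rule f_the_inv_into_f[OF inj_S]) (auto simp: image_S)

lemma T_S: "\<bar>u\<bar> \<le> \<rho> \<Longrightarrow> T (S u) = u"
  unfolding T_def by (rule the_inv_into_f_f[OF inj_S]) auto

lemma T_range: assumes "\<bar>y\<bar> < a" shows "\<bar>T y\<bar> < \<rho>"
proof -
  have "T y \<in> {-\<rho>..\<rho>}" unfolding T_def using assms by (intro the_inv_into_into[OF inj_S]) (auto simp: image_S)
  moreover have "T y \<noteq> \<rho>" "T y \<noteq> - \<rho>" using S_T[of y] S_ends assms by auto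
  ultimately show ?thesis by (auto simp: abs_less_iff)
qed

lemma cont_T: "continuous_on {-a..a} T"
proof -
  have "\<forall>x\<in>{-\<rho>..\<rho>}. T (S x) = x" using T_S by (auto simp: abs_le_iff)
  from continuous_on_inv[OF cont_S compact_Icc this] show ?thesis by (simp only: image_S)
qed

definition E :: "real^'n" where "E = axis i0 1"

definition Disc :: "((real^'n) \<times> (real^'n)) set" where
  "Disc = {z. (fst z $ i0)\<^sup>2 + (snd z $ i0)\<^sup>2 < \<rho>\<^sup>2}"

text \<open>The cotangent lift of \<open>S\<close> in the plane with index \<open>i0\<close>: it maps the open disc of area
  \<open>4ab\<close> symplectically onto the open rectangle with half sides \<open>a\<close>, \<open>b\<close>.\<close>
definition \<Theta> :: "(real^'n) \<times> (real^'n) \<Rightarrow> (real^'n) \<times> (real^'n)" where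
  "\<Theta> z = (fst z + (c + S (fst z $ i0) - fst z $ i0) *\<^sub>R E,
           snd z + (snd z $ i0 * t1 (fst z $ i0) - snd z $ i0) *\<^sub>R E)"

definition d\<Theta> :: "(real^'n) \<times> (real^'n) \<Rightarrow> (real^'n) \<times> (real^'n) \<Rightarrow> (real^'n) \<times> (real^'n)" where
  "d\<Theta> z w = (fst w + (s1 (fst z $ i0) * fst w $ i0 - fst w $ i0) *\<^sub>R E,
     snd w + (snd w $ i0 * t1 (fst z $ i0) + snd z $ i0 * (t2 (fst z $ i0) * fst w $ i0) - snd w $ i0) *\<^sub>R E)"

text \<open>The transpose of \<open>d\<Theta> z\<close>: it carries the gradient of a function at
  \<open>\<Theta> z\<close> to the gradient at \<open>z\<close> of its composition with
  \<open>\<Theta>\<close>.\<close>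

definition ad\<Theta> :: "(real^'n) \<times> (real^'n) \<Rightarrow> (real^'n) \<times> (real^'n) \<Rightarrow> (real^'n) \<times> (real^'n)" where
  "ad\<Theta> z v = (fst v + (s1 (fst z $ i0) * fst v $ i0 - fst v $ i0 + snd z $ i0 * t2 (fst z $ i0) * snd v $ i0) *\<^sub>R E,
     snd v + (t1 (fst z $ i0) * snd v $ i0 - snd v $ i0) *\<^sub>R E)"

lemma E_simps [simp]: "E $ i0 = 1" "E \<bullet> v = v $ i0" "v \<bullet> E = v $ i0"
  by (simp_all add: E_def inner_axis inner_axis')

lemma Disc_abs: "z \<in> Disc \<Longrightarrow> \<bar>fst z $ i0\<bar> < \<rho>"
  using pos abs_square_less_1[of "fst z $ i0 / \<rho>"] power2_less_imp_less[of "\<bar>fst z $ i0\<bar>" \<rho>]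
  by (auto simp: Disc_def) (smt (verit) zero_le_power2)

lemma open_Disc: "open Disc"
proof -
  have "Disc = (\<lambda>z. (fst z $ i0)\<^sup>2 + (snd z $ i0)\<^sup>2) -` {..<\<rho>\<^sup>2}" by (auto simp: Disc_def)
  moreover have "continuous_on UNIV (\<lambda>z :: (real^'n) \<times> (real^'n). (fst z $ i0)\<^sup>2 + (snd z $ i0)\<^sup>2)"
    by (intro continuous_intros)
  ultimately show ?thesis by (simp add: open_vimage)
qed

lemma has_derivative_\<Theta>:
  assumes "z \<in> Disc" shows "(\<Theta> has_derivative d\<Theta> z) (at z)"
proof -
  have u: "\<bar>fst z $ i0\<bar> < \<rho>" using Disc_abs[OF assms] .
  have l: "((\<lambda>z. fst z $ i0) has_derivative (\<lambda>w. fst w $ i0)) (at z)"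
    "((\<lambda>z. snd z $ i0) has_derivative (\<lambda>w. snd w $ i0)) (at z)"
    by (intro bounded_linear_imp_has_derivative bounded_linear_compose[OF bounded_linear_vec_nth]
        bounded_linear_fst bounded_linear_snd)+
  have S: "((\<lambda>z. S (fst z $ i0)) has_derivative (\<lambda>w. s1 (fst z $ i0) * fst w $ i0)) (at z)"
    using has_derivative_compose[OF l(1) DERIV_S[OF u, unfolded has_field_derivative_def]] .
  have t: "((\<lambda>z. t1 (fst z $ i0)) has_derivative (\<lambda>w. t2 (fst z $ i0) * fst w $ i0)) (at z)"
    using has_derivative_compose[OF l(1) DERIV_t1[OF u, unfolded has_field_derivative_def]] .
  have 1: "((\<lambda>z. c + S (fst z $ i0) - fst z $ i0) has_derivative
      (\<lambda>w. 0 + s1 (fst z $ i0) * fst w $ i0 - fst w $ i0)) (at z)"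
    by (intro has_derivative_diff has_derivative_add has_derivative_const S l)
  have 2: "((\<lambda>z. snd z $ i0 * t1 (fst z $ i0) - snd z $ i0) has_derivative
      (\<lambda>w. (snd z $ i0 * (t2 (fst z $ i0) * fst w $ i0) + snd w $ i0 * t1 (fst z $ i0)) - snd w $ i0)) (at z)"
    by (intro has_derivative_diff has_derivative_mult l t)
  have "(fst has_derivative fst) (at z)" "(snd has_derivative snd) (at z)"
    by (intro bounded_linear_imp_has_derivative bounded_linear_fst bounded_linear_snd)+
  from has_derivative_Pair[OF has_derivative_add[OF this(1) has_derivative_scaleR_left[OF 1]]
      has_derivative_add[OF this(2) has_derivative_scaleR_left[OF 2]]]
  show ?thesis unfolding \<Theta>_def d\<Theta>_def by (simp add: add.commute)
qed

lemma d\<Theta>_adjoint: "v \<bullet> d\<Theta> z w = ad\<Theta> z v \<bullet> w"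
  by (simp add: d\<Theta>_def ad\<Theta>_def inner_prod_def inner_add_left inner_add_right algebra_simps)

text \<open>With \<open>J v = (- snd v, fst v)\<close> this reads
  \<open>d\<Theta> J d\<Theta>^T = J\<close>, so \<open>\<Theta>\<close> maps orbits of the pulled
  back Hamiltonian to orbits. In the plane \<open>i0\<close> it comes down to
  \<open>s1 * t1 = 1\<close>; the \<open>t2\<close> terms cancel.\<close>

lemma d\<Theta>_symplectic:
  assumes "z \<in> Disc"
  shows "d\<Theta> z (- snd (ad\<Theta> z v), fst (ad\<Theta> z v)) = (- snd v, fst v)"
proof -
  let ?u = "fst z $ i0"
  have st: "s1 ?u * t1 ?u = 1" by (rule s1_t1[OF Disc_abs[OF assms]])
  define p where "p = t1 ?u * snd v $ i0 - snd v $ i0"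
  define q where "q = s1 ?u * fst v $ i0 - fst v $ i0 + snd z $ i0 * t2 ?u * snd v $ i0"
  have ad: "ad\<Theta> z v = (fst v + q *\<^sub>R E, snd v + p *\<^sub>R E)" by (simp add: ad\<Theta>_def p_def q_def)
  have sp: "s1 ?u * (snd v $ i0 + p) = snd v $ i0"
    using st by (simp add: p_def flip: mult.assoc)
  then have 1: "s1 ?u * - (snd v $ i0 + p) - - (snd v $ i0 + p) = p"
    unfolding mult_minus_right by linarith
  have tq: "t1 ?u * (fst v $ i0 + q) = fst v $ i0 + snd z $ i0 * t2 ?u * (t1 ?u * snd v $ i0)"
    using st by (simp add: q_def distrib_left mult.commute[of "t1 _" "s1 _"] mult_ac flip: mult.assoc[of "s1 _" "t1 _"])
  have 2: "(fst v $ i0 + q) * t1 ?u + snd z $ i0 * (t2 ?u * - (snd v $ i0 + p)) - (fst v $ i0 + q) = - q"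
    using tq by (simp add: p_def algebra_simps)
  show ?thesis
    by (simp only: ad d\<Theta>_def fst_conv snd_conv vector_uminus_component vector_add_component vector_scaleR_component
        E_simps(1) real_scaleR_def mult_1_right 1 2) simp
qed

lemma \<Theta>_reflect: "\<Theta> (fst z, - snd z) = (fst (\<Theta> z), - snd (\<Theta> z))"
  by (simp add: \<Theta>_def algebra_simps)

lemma reflect_Disc: "(fst z, - snd z) \<in> Disc \<longleftrightarrow> z \<in> Disc"
  by (simp add: Disc_def)

text \<open>The inverse of \<open>\<Theta>\<close> over the open rectangle, written out because its
  continuity carries compact sets back into the disc.\<close>

definition \<Xi> :: "(real^'n) \<times> (real^'n) \<Rightarrow> (real^'n) \<times> (real^'n)" where
  "\<Xi> x = (fst x + (T (fst x $ i0 - c) - fst x $ i0) *\<^sub>R E,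
     snd x + (snd x $ i0 * s1 (T (fst x $ i0 - c)) - snd x $ i0) *\<^sub>R E)"

lemma \<Xi>:
  assumes "\<bar>fst x $ i0 - c\<bar> < a" "\<bar>snd x $ i0\<bar> < b"
  shows "\<Xi> x \<in> Disc" "\<Theta> (\<Xi> x) = x"
proof -
  let ?u = "T (fst x $ i0 - c)"
  have u: "\<bar>?u\<bar> < \<rho>" by (rule T_range[OF assms(1)])
  note w = disc_pos[OF u]
  have "(snd x $ i0)\<^sup>2 < b\<^sup>2" using assms(2) pos by (metis abs_le_square_iff abs_of_pos not_less)
  then have "(snd x $ i0)\<^sup>2 / b\<^sup>2 < 1" using pos by simp
  then have "(\<rho>\<^sup>2 - ?u\<^sup>2) * ((snd x $ i0)\<^sup>2 / b\<^sup>2) < (\<rho>\<^sup>2 - ?u\<^sup>2) * 1" using w by (rule mult_strict_left_mono)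
  moreover have "(snd x $ i0 * s1 ?u)\<^sup>2 = (\<rho>\<^sup>2 - ?u\<^sup>2) * ((snd x $ i0)\<^sup>2 / b\<^sup>2)"
    using w by (simp add: s1_def power_mult_distrib power_divide)
  ultimately show "\<Xi> x \<in> Disc" by (simp add: Disc_def \<Xi>_def)
  show "\<Theta> (\<Xi> x) = x"
    using s1_t1[OF u] S_T[of "fst x $ i0 - c"] assms(1)
    by (simp add: \<Theta>_def \<Xi>_def prod_eq_iff mult.assoc) (simp add: scaleR_add_left[symmetric] add.assoc)
qed

lemma \<Xi>_\<Theta>: "z \<in> Disc \<Longrightarrow> \<Xi> (\<Theta> z) = z"
  using T_S[of "fst z $ i0"] Disc_abs[of z] s1_t1[of "fst z $ i0"]
  by (simp add: \<Theta>_def \<Xi>_def prod_eq_iff mult.assoc mult.commute[of "t1 _"]) (simp add: scaleR_add_left[symmetric] add.assoc)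

lemma cont_\<Xi>: "continuous_on {x. \<bar>fst x $ i0 - c\<bar> < a} \<Xi>"
proof -
  have T: "continuous_on {x. \<bar>fst x $ i0 - c\<bar> < a} (\<lambda>x :: (real^'n) \<times> (real^'n). T (fst x $ i0 - c))"
    by (rule continuous_on_compose2[OF cont_T]) (auto intro!: continuous_intros)
  show ?thesis unfolding \<Xi>_def s1_def using pos by (intro continuous_intros T) auto
qed

end

section \<open>Extension beyond the cylinder by a quadratic form\<close>

lemma DERIV_max0_square: "((\<lambda>x::real. (max 0 x)\<^sup>2) has_real_derivative 2 * max 0 x) (at x)"
proof -
  consider "x > 0" | "x < 0" | "x = 0" by linarith
  then show ?thesis
  proof cases
    case 1
    have "((\<lambda>x::real. x\<^sup>2) has_real_derivative 2 * max 0 x) (at x)"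
      using 1 by (auto intro!: derivative_eq_intros)
    then show ?thesis
      by (rule has_field_derivative_transform_within_open[where S = "{0<..}"]) (use 1 in auto)
  next
    case 2
    have "((\<lambda>x::real. 0) has_real_derivative 2 * max 0 x) (at x)"
      using 2 by (auto intro!: derivative_eq_intros)
    then show ?thesis
      by (rule has_field_derivative_transform_within_open[where S = "{..<0}"]) (use 2 in auto)
  next
    case 3
    have "((\<lambda>y::real. max 0 y) \<longlongrightarrow> max 0 0) (at 0)" by (intro tendsto_intros)
    moreover have "((max 0 y)\<^sup>2 - (max 0 0)\<^sup>2) / (y - 0) = max 0 y" if "y \<noteq> 0" for y :: real
      using that by (auto simp: power2_eq_square max_def)
    ultimately have "((\<lambda>y::real. ((max 0 y)\<^sup>2 - (max 0 0)\<^sup>2) / (y - 0)) \<longlongrightarrow> 0) (at 0)"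
      by (subst LIM_equal[where g = "\<lambda>y. max 0 y"]) simp_all
    then show ?thesis using 3 by (simp add: has_field_derivative_iff)
  qed
qed

text \<open>A reduced Hamiltonian \<open>\<eta>\<close>, negative only inside a cylinder whose cross section is small compared with
  its oscillation \<open>\<mu>\<close>, is extended by a function of a quadratic form whose slope passes the first
  resonance. All orbits outside the support have nonpositive action, so that the orbit of positive
  action found by linking stays inside.\<close>
lemma orbit_in_cylinder:
  fixes \<eta> :: "(real^'n) \<times> (real^'n) \<Rightarrow> real" and k :: "(real^'n) \<times> (real^'n) \<Rightarrow> (real^'n) \<times> (real^'n)"
  assumes d\<eta>: "\<And>z. (\<eta> has_derivative (\<lambda>w. k z \<bullet> w)) (at z)" and ck: "continuous_on UNIV k"
    and K: "compact K" and out: "\<And>z. z \<notin> K \<Longrightarrow> \<eta> z = 0"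
    and bounds: "\<And>z. - \<mu> \<le> \<eta> z" "\<And>z. \<eta> z \<le> 0"
    and cyl: "\<And>z. z \<in> K \<Longrightarrow> (fst z $ i0)\<^sup>2 + (snd z $ i0)\<^sup>2 \<le> \<rho>2" and \<mu>: "0 < \<rho>2" "\<rho>2 / 2 < \<mu>"
    and zero: "\<delta> > 0" "\<And>w. norm w < \<delta> \<Longrightarrow> \<eta> ((q1, 0) + w) = - \<mu>"
    and sym: "\<And>z. \<eta> (fst z, - snd z) = \<eta> z"
  obtains Z where "\<And>t. Z t \<in> K" "\<And>t. (Z has_vector_derivative (- snd (k (Z t)), fst (k (Z t)))) (at t)"
    "\<And>t. Z (t + 2 * pi) = Z t" "\<And>t. Z (- t) = (fst (Z t), - snd (Z t))" "\<exists>t. k (Z t) \<noteq> 0"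
proof -
  have kmax: "k z = 0" if "\<eta> z = 0" for z
  proof -
    have "(\<lambda>w. k z \<bullet> w) = (\<lambda>w. 0)"
      by (rule has_derivative_local_max[OF d\<eta>]) (use bounds(2) that in \<open>auto intro!: always_eventually\<close>)
    then have "k z \<bullet> k z = 0" by (rule fun_cong)
    then show ?thesis by simp
  qed
  define x where "x = 2 * \<mu> / \<rho>2"
  \<comment> \<open>The midpoint of 1 and the smaller of 2 and \<open>x\<close>: beyond the first
    resonance, before the second, and with \<open>A * \<rho>2 / 2 < \<mu>\<close>.\<close>
  define A where "A = (1 + min 2 x) / 2"
  have "1 < x" using \<mu> by (simp add: x_def field_simps)
  then have A: "1 < A" "A < 2" "A < 2 * \<mu> / \<rho>2" unfolding A_def x_def[symmetric] by (auto simp: min_def)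
  define gap where "gap = \<mu> - A * \<rho>2 / 2"
  have gap: "gap > 0" using A(3) \<mu> by (simp add: gap_def field_simps)
  \<comment> \<open>One half of \<open>gap\<close> keeps \<open>q\<close> below \<open>r0\<close> on
    \<open>K\<close>; the other half gives \<open>r0 + gap / 2 = \<mu>\<close>, which makes
    \<open>h = q\<close> and the action density 0 wherever the extension is quadratic.\<close>
  define r0 where "r0 = A * \<rho>2 / 2 + gap / 2"
  have r0: "r0 > 0" "r0 + gap / 2 = \<mu>" using A \<mu> gap by (auto simp: r0_def gap_def intro!: add_pos_pos)
  obtain L where L: "L > 0" "\<And>z. z \<in> K \<Longrightarrow> norm z \<le> L"
    using compact_imp_bounded[OF K] by (auto simp: bounded_pos)
  \<comment> \<open>Small enough for the slope \<open>e\<close> to add at most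
    \<open>gap / 4\<close> to \<open>q\<close> on \<open>K\<close>.\<close>
  define e where "e = min (1/2) (gap / (2 * L\<^sup>2))"
  have e: "0 < e" "e < 1" using gap L by (auto simp: e_def)
  have eL: "e * L\<^sup>2 \<le> gap / 2"
  proof -
    have "e * L\<^sup>2 \<le> gap / (2 * L\<^sup>2) * L\<^sup>2" by (intro mult_right_mono) (auto simp: e_def)
    then show ?thesis using L by simp
  qed
  define D where "D = (\<lambda>v :: real^'n. \<chi> i. (if i = i0 then A else e) * v $ i)"
  define B where "B z = (D (fst z), D (snd z))" for z
  have DI: "D v \<bullet> w = (\<Sum>i\<in>UNIV. (if i = i0 then A else e) * (v $ i * w $ i))" for v w
    by (simp add: D_def inner_vec_def mult.assoc)
  have D_ge: "e * (norm v)\<^sup>2 \<le> D v \<bullet> v" for v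
  proof -
    have "e * (norm v)\<^sup>2 = (\<Sum>i\<in>UNIV. e * (v $ i * v $ i))"
      by (simp add: power2_norm_eq_inner inner_vec_def sum_distrib_left)
    also have "\<dots> \<le> D v \<bullet> v" unfolding DI using A e by (intro sum_mono mult_right_mono) auto
    finally show ?thesis .
  qed
  have D_le: "D v \<bullet> v \<le> A * (v $ i0)\<^sup>2 + e * (norm v)\<^sup>2" for v
  proof -
    have "D v \<bullet> v \<le> (\<Sum>i\<in>UNIV. (if i = i0 then A * (v $ i0)\<^sup>2 else 0) + e * (v $ i * v $ i))"
      unfolding DI using e by (intro sum_mono) (auto simp: power2_eq_square)
    also have "\<dots> = A * (v $ i0)\<^sup>2 + e * (norm v)\<^sup>2"
      by (simp add: sum.distrib power2_norm_eq_inner inner_vec_def sum_distrib_left)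
    finally show ?thesis .
  qed
  define q where "q z = B z \<bullet> z / 2" for z
  have q_ge: "e * (norm z)\<^sup>2 / 2 \<le> q z" for z
    using D_ge[of "fst z"] D_ge[of "snd z"]
    by (simp add: q_def B_def inner_prod_def power2_norm_eq_inner algebra_simps)
  have q_K: "q z < r0" if "z \<in> K" for z
  proof -
    have "2 * q z \<le> A * ((fst z $ i0)\<^sup>2 + (snd z $ i0)\<^sup>2) + e * (norm z)\<^sup>2"
      using D_le[of "fst z"] D_le[of "snd z"]
      by (simp add: q_def B_def inner_prod_def power2_norm_eq_inner algebra_simps)
    moreover have "A * ((fst z $ i0)\<^sup>2 + (snd z $ i0)\<^sup>2) \<le> A * \<rho>2"
      using cyl[OF that] A by (intro mult_left_mono) auto
    moreover have "e * (norm z)\<^sup>2 \<le> e * L\<^sup>2" using L(2)[OF that] e by (intro mult_left_mono power_mono) auto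
    ultimately show ?thesis using eL gap unfolding r0_def by linarith
  qed
  have lin: "bounded_linear B"
    unfolding B_def D_def by (auto intro!: linear_conv_bounded_linear[THEN iffD1] linearI simp: prod_eq_iff vec_eq_iff algebra_simps)
  have dq: "(q has_derivative (\<lambda>w. B z \<bullet> w)) (at z)" for z
  proof -
    have "((\<lambda>z. B z \<bullet> z) has_derivative (\<lambda>w. B z \<bullet> w + B w \<bullet> z)) (at z)"
      by (rule has_derivative_inner[OF bounded_linear_imp_has_derivative[OF lin] has_derivative_ident])
    from has_derivative_mult_right[OF this, of "1/2"]
    have "((\<lambda>z. 1/2 * (B z \<bullet> z)) has_derivative (\<lambda>w. 1/2 * (B z \<bullet> w + B w \<bullet> z))) (at z)" .
    moreover have "B w \<bullet> z = B z \<bullet> w" for w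
      unfolding B_def inner_prod_def fst_conv snd_conv DI by (simp add: mult.commute)
    ultimately show ?thesis unfolding q_def by simp
  qed
  \<comment> \<open>The \<open>C^1\<close> function whose slope rises linearly from 0 to 1 on
    \<open>[0, gap]\<close>.\<close>
  define \<psi> where "\<psi> x = ((max 0 x)\<^sup>2 - (max 0 (x - gap))\<^sup>2) / (2 * gap)" for x
  define \<psi>' where "\<psi>' x = (max 0 x - max 0 (x - gap)) / gap" for x
  have d\<psi>: "(\<psi> has_real_derivative \<psi>' x) (at x)" for x
  proof -
    have "((\<lambda>x. (max 0 (x - gap))\<^sup>2) has_real_derivative 2 * max 0 (x - gap) * 1) (at x)"
      by (rule DERIV_chain2[OF DERIV_max0_square]) (auto intro!: derivative_eq_intros)
    from DERIV_cdivide[OF DERIV_diff[OF DERIV_max0_square this], of "2 * gap"]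
    show ?thesis unfolding \<psi>_def \<psi>'_def using gap by (simp add: diff_divide_distrib)
  qed
  have \<psi>0: "\<psi> x = 0" "\<psi>' x = 0" if "x \<le> 0" for x using that gap by (auto simp: \<psi>_def \<psi>'_def)
  have \<psi>1: "\<psi> x = x - gap / 2" "\<psi>' x = 1" if "x \<ge> gap" for x
    using that gap by (auto simp: \<psi>_def \<psi>'_def power2_eq_square field_simps)
  have \<psi>m: "\<psi> x = x\<^sup>2 / (2 * gap)" "\<psi>' x = x / gap" if "0 \<le> x" "x \<le> gap" for x
    using that gap by (auto simp: \<psi>_def \<psi>'_def)
  have \<psi>_nonneg: "0 \<le> \<psi> x" for x
    using \<psi>0[of x] \<psi>1[of x] \<psi>m[of x] gap by (cases "x \<le> 0"; cases "x \<le> gap") auto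
  \<comment> \<open>The sign of the action density outside \<open>K\<close>: with
    \<open>x = q z - r0\<close>, \<open>g z \<bullet> z / 2\<close> is
    \<open>\<psi>' x * (x + r0)\<close> and \<open>h z\<close> is \<open>\<mu> + \<psi> x\<close>
    there.\<close>
  have tangent: "\<psi>' x * (x + r0) \<le> \<mu> + \<psi> x" if "x > - r0" for x
  proof -
    consider "x \<le> 0" | "0 \<le> x" "x \<le> gap" | "gap \<le> x" by linarith
    then show ?thesis
    proof cases
      case 1
      then show ?thesis using \<psi>0[of x] \<mu> by simp
    next
      case 2
      have "x * (x + 2 * r0) \<le> gap * (gap + 2 * r0)" using 2 gap r0 by (intro mult_mono) auto
      then have "x * (x + 2 * r0) / (2 * gap) \<le> gap / 2 + r0" using gap by (simp add: field_simps)
      moreover have "x / gap * (x + r0) = x\<^sup>2 / (2 * gap) + x * (x + 2 * r0) / (2 * gap)"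
        using gap by (simp add: field_simps power2_eq_square)
      ultimately show ?thesis using \<psi>m[OF 2] r0(2) by simp
    next
      case 3
      then show ?thesis using \<psi>1[of x] r0(2) gap by simp
    qed
  qed
  define h where "h z = \<mu> + \<psi> (q z - r0) + \<eta> z" for z
  define g where "g z = \<psi>' (q z - r0) *\<^sub>R B z + k z" for z
  have g_bal: "g z \<bullet> (- snd (g z), fst (g z)) = 0" for z by (simp add: inner_prod_def inner_commute)
  have dh: "(h has_derivative (\<lambda>w. g z \<bullet> w)) (at z)" for z
  proof -
    have "((\<lambda>z. q z - r0) has_derivative (\<lambda>w. B z \<bullet> w)) (at z)"
      using has_derivative_diff[OF dq has_derivative_const] by simp
    from has_derivative_compose[OF this d\<psi>[unfolded has_field_derivative_def]]
    have "((\<lambda>z. \<psi> (q z - r0)) has_derivative (\<lambda>w. \<psi>' (q z - r0) * (B z \<bullet> w))) (at z)" .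
    from has_derivative_add[OF has_derivative_add[OF has_derivative_const this] d\<eta>]
    show ?thesis unfolding h_def g_def by (simp add: inner_add_left)
  qed
  have cB: "continuous_on UNIV B" using lin by (rule linear_continuous_on)
  have cq: "continuous_on UNIV q" unfolding q_def by (intro continuous_intros cB) auto
  have cg: "continuous_on UNIV g"
    unfolding g_def \<psi>'_def using gap by (intro continuous_intros cB cq ck) auto
  have inside: "h z = \<mu> + \<eta> z" "g z = k z" if "q z < r0" for z
    using \<psi>0[of "q z - r0"] that by (simp_all add: h_def g_def)
  have outside: "g z \<bullet> z / 2 \<le> h z" "\<mu> \<le> h z" if "z \<notin> K" for z
  proof -
    have k0: "\<eta> z = 0" "k z = 0" using out[OF that] kmax by auto
    have "g z \<bullet> z / 2 = \<psi>' (q z - r0) * (q z - r0 + r0)" by (simp add: g_def k0 q_def)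
    also have "\<dots> \<le> h z"
    proof (cases "q z > 0")
      case True
      then show ?thesis using tangent[of "q z - r0"] by (simp add: h_def k0)
    next
      case False
      then show ?thesis using \<psi>0[of "q z - r0"] r0 \<mu> by (simp add: h_def k0)
    qed
    finally show "g z \<bullet> z / 2 \<le> h z" .
    show "\<mu> \<le> h z" using \<psi>_nonneg by (simp add: h_def k0)
  qed
  have h_nonneg: "0 \<le> h z" for z
    using bounds(1)[of z] \<psi>_nonneg[of "q z - r0"] by (simp add: h_def)
  have "hz_hamiltonian h g A e i0 q1"
    unfolding hz_hamiltonian_def
  proof (intro conjI allI)
    define R where "R = L + 1 + sqrt (2 * (r0 + gap) / e)"
    have "h z = B z \<bullet> z / 2 + (\<mu> - r0 - gap / 2) \<and> g z = B z" if z: "R \<le> norm z" for z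
    proof -
      have sq: "0 \<le> 2 * (r0 + gap) / e" using r0 gap e by simp
      have "L < norm z" using z real_sqrt_ge_zero[OF sq] unfolding R_def by linarith
      then have "z \<notin> K" using L(2)[of z] by auto
      then have k0: "\<eta> z = 0" "k z = 0" using out kmax by auto
      have "sqrt (2 * (r0 + gap) / e) \<le> norm z" using z L(1) unfolding R_def by linarith
      then have "2 * (r0 + gap) / e \<le> (norm z)\<^sup>2" by (rule sqrt_le_D)
      then have "gap \<le> q z - r0" using q_ge[of z] e by (simp add: field_simps)
      then show ?thesis using \<psi>1[of "q z - r0"] k0 by (simp add: h_def g_def q_def)
    qed
    then show "\<exists>R c. \<forall>z. R \<le> norm z \<longrightarrow>
       h z = (\<chi> i. (if i = i0 then A else e) * fst z $ i, \<chi> i. (if i = i0 then A else e) * snd z $ i) \<bullet> z / 2 + c \<and>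
       g z = (\<chi> i. (if i = i0 then A else e) * fst z $ i, \<chi> i. (if i = i0 then A else e) * snd z $ i)"
      unfolding B_def D_def by blast
    have "h ((q1, 0) + w) = 0" if "norm w < \<delta>" for w
    proof -
      let ?z = "(q1, 0) + w"
      have "?z \<in> K" using zero(2)[OF that] out[of ?z] \<mu> by force
      then show ?thesis using inside(1)[OF q_K] zero(2)[OF that] by simp
    qed
    then show "\<exists>d>0. \<forall>w. norm w < d \<longrightarrow> h ((q1, 0) + w) = 0" using zero(1) by blast
  qed (use dh cg A e h_nonneg in auto)
  moreover have "h (fst z, - snd z) = h z" for z
  proof -
    have "D (- v) = - D v" for v by (simp add: D_def vec_eq_iff)
    then show ?thesis by (simp add: h_def q_def B_def inner_prod_def sym)
  qed
  ultimately obtain Z where Z: "\<And>t. (Z has_vector_derivative (- snd (g (Z t)), fst (g (Z t)))) (at t)"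
    "\<And>t. Z (t + 2 * pi) = Z t" "\<And>t. Z (- t) = (fst (Z t), - snd (Z t))"
    and "\<exists>t. h (Z t) < g (Z t) \<bullet> Z t / 2"
    by (rule hz_hamiltonian.periodic_solution) blast
  then obtain t0 where t0: "h (Z t0) < g (Z t0) \<bullet> Z t0 / 2" by blast
  \<comment> \<open>Conservation of energy. At \<open>t0\<close> the action density is positive, so
    \<open>Z t0\<close> lies in \<open>K\<close> and turns out to have level below
    \<open>\<mu>\<close>. Since \<open>h\<close> is at least \<open>\<mu>\<close> off
    \<open>K\<close>, the whole orbit stays in \<open>K\<close>.\<close>
  have "((\<lambda>t. h (Z t)) has_real_derivative 0) (at t)" for t
  proof -
    from has_derivative_compose[OF Z(1)[of t, unfolded has_vector_derivative_def] dh]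
    have "((\<lambda>t. h (Z t)) has_derivative (\<lambda>x. g (Z t) \<bullet> (x *\<^sub>R (- snd (g (Z t)), fst (g (Z t)))))) (at t)" .
    then show ?thesis unfolding has_field_derivative_def inner_scaleR_right g_bal by (simp add: lambda_zero)
  qed
  then have const: "h (Z t) = h (Z t0)" for t using DERIV_isconst_all[of "\<lambda>t. h (Z t)"] by blast
  have Zt0: "Z t0 \<in> K" using t0 outside(1)[of "Z t0"] by (cases "Z t0 \<in> K") auto
  have g0: "g (Z t0) \<noteq> 0" using t0 h_nonneg[of "Z t0"] by auto
  then have k0: "k (Z t0) \<noteq> 0" using inside(2)[OF q_K[OF Zt0]] by simp
  then have "\<eta> (Z t0) \<noteq> 0" using kmax by blast
  then have "h (Z t0) < \<mu>" using bounds(2)[of "Z t0"] inside(1)[OF q_K[OF Zt0]] by simp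
  then have ZK: "Z t \<in> K" for t using const[of t] outside(2)[of "Z t"] by (cases "Z t \<in> K") auto
  have gk: "g (Z t) = k (Z t)" for t using inside(2)[OF q_K[OF ZK]] .
  show ?thesis
    by (rule that[OF ZK Z(1)[unfolded gk] Z(2,3)]) (use k0 in blast)
qed


section \<open>Transfer of the orbit from the disc to the rectangle\<close>

context flat_disc begin

text \<open>\<open>H - m\<close> is pulled back by \<open>\<Theta>\<close>, divided by
  \<open>2 * pi\<close> to trade period \<open>2 * pi\<close> for period 1, and extended by 0. The
  condition \<open>4 * a * b < m\<close> becomes \<open>\<rho>\<^sup>2 / 2 < \<mu>\<close>, the
  hypothesis of \<open>orbit_in_cylinder\<close>.\<close>

theorem symmetric_orbit_exists:
  fixes H :: "(real^'n) \<times> (real^'n) \<Rightarrow> real" and G :: "(real^'n) \<times> (real^'n) \<Rightarrow> (real^'n) \<times> (real^'n)"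
  assumes W: "open W" and box: "\<And>z. z \<in> W \<Longrightarrow> \<bar>fst z $ i0 - c\<bar> < a \<and> \<bar>snd z $ i0\<bar> < b"
    and dH: "\<And>z. z \<in> W \<Longrightarrow> (H has_derivative (\<lambda>w. G z \<bullet> w)) (at z)" and cG: "continuous_on W G"
    and K: "compact K" "K \<subseteq> W" and Hm: "\<And>z. z \<in> W - K \<Longrightarrow> H z = m"
    and bnds: "\<And>z. z \<in> W \<Longrightarrow> 0 \<le> H z \<and> H z \<le> m"
    and V: "open V" "V \<subseteq> W" "(q0, 0) \<in> V" "\<And>z. z \<in> V \<Longrightarrow> H z = 0"
    and sym: "\<And>z. z \<in> W \<Longrightarrow> tau0 z \<in> W \<and> H (tau0 z) = H z"
    and m: "4 * a * b < m"
  shows "\<exists>x. sym_periodic_orbit tau0 H W 1 x"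
proof -
  define \<mu> where "\<mu> = m / (2 * pi)"
  define Kt where "Kt = \<Xi> ` K"
  define U where "U = Disc \<inter> \<Theta> -` W"
  define \<eta> where "\<eta> z = (if z \<in> U then (H (\<Theta> z) - m) / (2 * pi) else 0)" for z
  define k where "k z = (if z \<in> U then (1 / (2 * pi)) *\<^sub>R ad\<Theta> z (G (\<Theta> z)) else 0)" for z
  have c\<Theta>: "continuous_on Disc \<Theta>"
    using has_derivative_\<Theta> has_derivative_continuous continuous_at_imp_continuous_on by blast
  have U: "open U" unfolding U_def by (rule continuous_open_preimage[OF c\<Theta> open_Disc W])
  have Kt: "compact Kt" unfolding Kt_def
    by (rule compact_continuous_image[OF continuous_on_subset[OF cont_\<Xi>] K(1)]) (use K(2) box in auto)
  have KtU: "z \<in> U \<and> \<Theta> z \<in> K" if "z \<in> Kt" for z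
    using that \<Xi> box K(2) by (auto simp: Kt_def U_def)
  have Kt_iff: "\<Theta> z \<notin> K" if "z \<notin> Kt" "z \<in> Disc" for z
    using that \<Xi>_\<Theta>[of z] by (auto simp: Kt_def image_iff)
  have out: "\<eta> z = 0" if "z \<notin> Kt" for z
    using that Kt_iff[OF that] Hm by (auto simp: \<eta>_def U_def)
  have dH\<Theta>: "((\<lambda>z. (H (\<Theta> z) - m) / (2 * pi)) has_derivative (\<lambda>w. (1 / (2 * pi)) *\<^sub>R ad\<Theta> z (G (\<Theta> z)) \<bullet> w)) (at z)" if "z \<in> U" for z
  proof -
    have "((\<lambda>z. H (\<Theta> z)) has_derivative (\<lambda>w. G (\<Theta> z) \<bullet> d\<Theta> z w)) (at z)"
      using that by (intro has_derivative_compose[OF has_derivative_\<Theta> dH]) (auto simp: U_def)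
    from has_derivative_mult_right[OF has_derivative_diff[OF this has_derivative_const[of m]], of "1 / (2 * pi)"]
    show ?thesis by (simp add: d\<Theta>_adjoint)
  qed
  \<comment> \<open>On the open set \<open>U - Kt\<close> the pulled back function vanishes
    identically, so by uniqueness of derivatives its gradient does too.\<close>
  have k0: "k z = 0" if "z \<notin> Kt" for z
  proof (cases "z \<in> U")
    case True
    have "open (U - Kt)" using U Kt by (intro open_Diff compact_imp_closed)
    have "((\<lambda>z. 0) has_derivative (\<lambda>w. (1 / (2 * pi)) *\<^sub>R ad\<Theta> z (G (\<Theta> z)) \<bullet> w)) (at z)"
    proof (rule has_derivative_transform_within_open[OF dH\<Theta>[OF True] \<open>open (U - Kt)\<close>])
      show "(H (\<Theta> y) - m) / (2 * pi) = 0" if "y \<in> U - Kt" for y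
        using out[of y] that unfolding \<eta>_def by (simp only: Diff_iff if_True not_False_eq_True)
    qed (use True that in simp)
    from has_derivative_unique[OF this has_derivative_const]
    have "((1 / (2 * pi)) *\<^sub>R ad\<Theta> z (G (\<Theta> z))) \<bullet> ((1 / (2 * pi)) *\<^sub>R ad\<Theta> z (G (\<Theta> z))) = 0" by (rule fun_cong)
    then show ?thesis using True by (simp add: k_def)
  qed (simp add: k_def)
  have d\<eta>: "(\<eta> has_derivative (\<lambda>w. k z \<bullet> w)) (at z)" for z
  proof (cases "z \<in> Kt")
    case True
    then have zU: "z \<in> U" using KtU by blast
    show ?thesis
      by (rule has_derivative_transform_within_open[OF _ U zU]) (use dH\<Theta>[OF zU] zU in \<open>auto simp: \<eta>_def k_def\<close>)
  next
    case False
    have "open (- Kt)" using Kt compact_imp_closed by blast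
    show ?thesis unfolding k0[OF False]
      by (rule has_derivative_transform_within_open[of "\<lambda>_. 0" _ _ _ "- Kt"])
        (use False out \<open>open (- Kt)\<close> in auto)
  qed
  have ck: "continuous_on UNIV k"
  proof -
    have nz: "sqrt (\<rho>\<^sup>2 - (fst z $ i0)\<^sup>2) \<noteq> 0" "\<rho>\<^sup>2 - (fst z $ i0)\<^sup>2 \<noteq> 0" if "z \<in> U" for z
      using disc_pos[OF Disc_abs[of z]] that by (auto simp: U_def)
    have cG\<Theta>: "continuous_on U (\<lambda>z. G (\<Theta> z))"
      by (rule continuous_on_compose2[OF cG continuous_on_subset[OF c\<Theta>]]) (auto simp: U_def)
    have "continuous_on U (\<lambda>z. (1 / (2 * pi)) *\<^sub>R ad\<Theta> z (G (\<Theta> z)))"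
      unfolding ad\<Theta>_def s1_def t1_def t2_def using pos nz by (intro continuous_intros cG\<Theta>) auto
    then have "continuous_on U k" by (rule continuous_on_eq) (simp add: k_def)
    moreover have "continuous_on (- Kt) k"
      by (rule continuous_on_eq[OF continuous_on_const[of _ 0]]) (simp add: k0)
    moreover have "open (- Kt)" using Kt compact_imp_closed by blast
    ultimately have "continuous_on (U \<union> - Kt) k" using U by (intro continuous_on_open_Un)
    moreover have "U \<union> - Kt = UNIV" using KtU by blast
    ultimately show ?thesis by simp
  qed
  have mpos: "m > 0" using m pos by (smt (verit) mult_pos_pos)
  have q1: "\<Xi> (q0, 0) \<in> Disc" "\<Theta> (\<Xi> (q0, 0)) = (q0, 0)" using \<Xi>[of "(q0, 0)"] box[of "(q0, 0)"] V by auto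
  define q1 where "q1 = fst (\<Xi> (q0, 0))"
  have q1eq: "\<Xi> (q0, 0) = (q1, 0)" by (simp add: q1_def \<Xi>_def)
  have "open (Disc \<inter> \<Theta> -` V)" by (rule continuous_open_preimage[OF c\<Theta> open_Disc V(1)])
  moreover have "(q1, 0) \<in> Disc \<inter> \<Theta> -` V" using q1 V(3) by (simp add: q1eq)
  ultimately obtain \<delta> where \<delta>: "\<delta> > 0" "ball (q1, 0) \<delta> \<subseteq> Disc \<inter> \<Theta> -` V" by (meson open_contains_ball)
  have zero: "\<eta> ((q1, 0) + w) = - \<mu>" if "norm w < \<delta>" for w
  proof -
    have "(q1, 0) + w \<in> ball (q1, 0) \<delta>" using that by (simp add: dist_norm)
    then have "(q1, 0) + w \<in> Disc \<inter> \<Theta> -` V" using \<delta>(2) by blast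
    then have "(q1, 0) + w \<in> U" "\<Theta> ((q1, 0) + w) \<in> V" using V(2) by (auto simp only: U_def Int_iff vimage_eq)
    then show ?thesis using V(4) by (simp add: \<eta>_def \<mu>_def)
  qed
  have refl: "\<eta> (fst z, - snd z) = \<eta> z" for z
  proof -
    have T1: "\<Theta> (tau0 z) = tau0 (\<Theta> z)" unfolding tau0_def by (rule \<Theta>_reflect)
    have T2: "tau0 (tau0 y) = y" for y :: "(real^'n) \<times> (real^'n)" by (simp add: tau0_def)
    have T3: "tau0 z \<in> Disc \<longleftrightarrow> z \<in> Disc" unfolding tau0_def by (rule reflect_Disc)
    have T4: "tau0 y \<in> W \<longleftrightarrow> y \<in> W" for y using sym[of y] sym[of "tau0 y"] unfolding T2 by blast
    have T5: "tau0 z \<in> U \<longleftrightarrow> z \<in> U" unfolding U_def Int_iff vimage_eq T1 T3 T4 ..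
    have "z \<in> U \<Longrightarrow> H (tau0 (\<Theta> z)) = H (\<Theta> z)" using sym[of "\<Theta> z"] unfolding U_def Int_iff vimage_eq by blast
    then have "\<eta> (tau0 z) = \<eta> z" unfolding \<eta>_def T5 T1 by simp
    then show ?thesis unfolding tau0_def .
  qed
  have lo: "- \<mu> \<le> \<eta> z" and up: "\<eta> z \<le> 0" for z
    using bnds[of "\<Theta> z"] mpos by (auto simp: \<eta>_def \<mu>_def U_def field_simps)
  have cyl: "(fst z $ i0)\<^sup>2 + (snd z $ i0)\<^sup>2 \<le> \<rho>\<^sup>2" if "z \<in> Kt" for z
    using KtU[OF that] by (auto simp: U_def Disc_def)
  have "\<rho>\<^sup>2 / 2 = 4 * a * b / (2 * pi)" using area by (simp add: field_simps)
  also have "\<dots> < \<mu>" unfolding \<mu>_def by (rule divide_strict_right_mono[OF m]) simp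
  finally have \<mu>: "\<rho>\<^sup>2 / 2 < \<mu>" .
  have \<rho>2: "0 < \<rho>\<^sup>2" using pos by simp
  obtain Z where ZK: "\<And>t. Z t \<in> Kt" and dZ: "\<And>t. (Z has_vector_derivative (- snd (k (Z t)), fst (k (Z t)))) (at t)"
    and Zper: "\<And>t. Z (t + 2 * pi) = Z t" and Zsym: "\<And>t. Z (- t) = (fst (Z t), - snd (Z t))" and kn: "\<exists>t. k (Z t) \<noteq> 0"
  proof (rule orbit_in_cylinder[where \<eta> = \<eta> and k = k and K = Kt and \<mu> = \<mu> and \<delta> = \<delta> and ?i0.0 = i0 and ?q1.0 = q1 and ?\<rho>2.0 = "\<rho>\<^sup>2"])
    fix z w :: "(real^'n) \<times> (real^'n)"
    show "(\<eta> has_derivative (\<lambda>w. k z \<bullet> w)) (at z)" by (rule d\<eta>)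
    show "continuous_on UNIV k" "compact Kt" "0 < \<rho>\<^sup>2" "\<rho>\<^sup>2 / 2 < \<mu>" "0 < \<delta>" by (fact ck Kt \<rho>2 \<mu> \<delta>(1))+
    show "- \<mu> \<le> \<eta> z" "\<eta> z \<le> 0" "\<eta> (fst z, - snd z) = \<eta> z" by (fact lo up refl)+
    show "\<eta> z = 0" if "z \<notin> Kt" using that by (rule out)
    show "(fst z $ i0)\<^sup>2 + (snd z $ i0)\<^sup>2 \<le> \<rho>\<^sup>2" if "z \<in> Kt" using that by (rule cyl)
    show "\<eta> ((q1, 0) + w) = - \<mu>" if "norm w < \<delta>" using that by (rule zero)
  qed (rule that)
  define x where "x t = \<Theta> (Z (2 * pi * t))" for t
  have ZU: "Z t \<in> U" "Z t \<in> Disc" "\<Theta> (Z t) \<in> W" for t using KtU[OF ZK[of t]] by (auto simp: U_def)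
  have dx: "(x has_vector_derivative (- snd (G (x t)), fst (G (x t)))) (at t)" for t
  proof -
    let ?s = "2 * pi * t"
    have "((\<lambda>t. Z (2 * pi * t)) has_vector_derivative (2 * pi) *\<^sub>R (- snd (k (Z ?s)), fst (k (Z ?s)))) (at t)"
    proof (rule vector_diff_chain_at[where f = "\<lambda>t. 2 * pi * t" and g = Z, unfolded o_def])
      show "((\<lambda>t. 2 * pi * t) has_vector_derivative 2 * pi) (at t)" by (auto intro!: derivative_eq_intros)
    qed (rule dZ)
    also have "(2 * pi) *\<^sub>R (- snd (k (Z ?s)), fst (k (Z ?s))) = (- snd (ad\<Theta> (Z ?s) (G (x t))), fst (ad\<Theta> (Z ?s) (G (x t))))"
      using ZU(1)[of ?s] by (simp add: k_def x_def)
    finally have "((\<lambda>t. Z (2 * pi * t)) has_derivative (\<lambda>y. y *\<^sub>R (- snd (ad\<Theta> (Z ?s) (G (x t))), fst (ad\<Theta> (Z ?s) (G (x t)))))) (at t)"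
      by (simp only: has_vector_derivative_def)
    from has_derivative_compose[OF this has_derivative_\<Theta>[OF ZU(2)]]
    have "(x has_derivative (\<lambda>y. d\<Theta> (Z ?s) (y *\<^sub>R (- snd (ad\<Theta> (Z ?s) (G (x t))), fst (ad\<Theta> (Z ?s) (G (x t))))))) (at t)"
      unfolding x_def .
    moreover have "d\<Theta> (Z ?s) (y *\<^sub>R w) = y *\<^sub>R d\<Theta> (Z ?s) w" for y w
      using has_derivative_linear[OF has_derivative_\<Theta>[OF ZU(2)]] by (rule linear_scale)
    ultimately show ?thesis unfolding has_vector_derivative_def by (simp only: d\<Theta>_symplectic[OF ZU(2)])
  qed
  have xW: "x t \<in> W" for t using ZU(3) by (simp add: x_def)
  have "ham_orbit H W x"
    unfolding ham_orbit_def
  proof (intro allI conjI xW exI)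
    fix t show "(x has_vector_derivative (- snd (G (x t)), fst (G (x t)))) (at t)" by (rule dx)
    fix v
    have "frechet_derivative H (at (x t)) = (\<lambda>w. G (x t) \<bullet> w)"
      using frechet_derivative_at[OF dH[OF xW]] by simp
    then show "omega0 (- snd (G (x t)), fst (G (x t))) v = - frechet_derivative H (at (x t)) v"
      by (simp add: omega0_def inner_prod_def)
  qed
  moreover have "x (t + 1) = x t" for t using Zper[of "2 * pi * t"] by (simp add: x_def distrib_left)
  moreover have "x (- t) = tau0 (x t)" for t
    using Zsym[of "2 * pi * t"] \<Theta>_reflect[of "Z (2 * pi * t)"] by (simp add: x_def tau0_def)
  moreover have "x (1 - t) = x (- t)" for t using Zper[of "- (2 * pi * t)"] by (simp add: x_def algebra_simps)
  \<comment> \<open>A constant orbit would make \<open>G\<close> vanish along \<open>x\<close>,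
    hence \<open>k\<close> along \<open>Z\<close>, against \<open>kn\<close>.\<close>
  moreover have "\<exists>s t. x s \<noteq> x t"
  proof (rule ccontr)
    assume "\<not> ?thesis"
    then have "x = (\<lambda>t. x 0)" by auto
    then have "(x has_vector_derivative 0) (at t)" for t by (metis has_vector_derivative_const)
    then have "(- snd (G (x t)), fst (G (x t))) = 0" for t using dx vector_derivative_unique_at by blast
    then have G0: "G (x t) = 0" for t by (metis fst_conv neg_equal_0_iff_equal prod_eqI snd_conv zero_prod_def)
    have "k (Z t) = 0" for t
    proof -
      have "G (\<Theta> (Z t)) = 0" using G0[of "t / (2 * pi)"] by (simp add: x_def)
      then show ?thesis by (simp add: k_def ad\<Theta>_def zero_prod_def)
    qed
    then show False using kn by blast
  qed
  ultimately have "sym_periodic_orbit tau0 H W 1 x"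
    unfolding sym_periodic_orbit_def by blast
  then show ?thesis by blast
qed

end

section \<open>From admissible functions to upper bounds on the capacities\<close>

lemma smooth_fun_on_gradient:
  fixes H :: "'a::euclidean_space \<Rightarrow> real"
  assumes "smooth_fun_on U H"
  obtains G where "continuous_on U G" "\<And>z. z \<in> U \<Longrightarrow> (H has_derivative (\<lambda>w. G z \<bullet> w)) (at z)"
proof
  let ?G = "\<lambda>z. \<Sum>b\<in>Basis. dderiv b H z *\<^sub>R b"
  have "continuous_on U (dderiv b H)" for b
  proof (rule continuous_at_imp_continuous_on, rule ballI)
    fix z assume "z \<in> U"
    then have "iter_dderiv [b] H differentiable at z" using assms unfolding smooth_fun_on_def by blast
    then show "isCont (dderiv b H) z" using differentiable_imp_continuous_within by auto
  qed
  then show "continuous_on U ?G" by (intro continuous_intros)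
  fix z assume "z \<in> U"
  then have "iter_dderiv [] H differentiable at z" using assms unfolding smooth_fun_on_def by blast
  then have d: "(H has_derivative frechet_derivative H (at z)) (at z)" by (simp add: frechet_derivative_works)
  interpret bounded_linear "frechet_derivative H (at z)" using d by (rule has_derivative_bounded_linear)
  have "frechet_derivative H (at z) w = ?G z \<bullet> w" for w
  proof -
    have "frechet_derivative H (at z) w = frechet_derivative H (at z) (\<Sum>b\<in>Basis. (w \<bullet> b) *\<^sub>R b)"
      by (simp add: euclidean_representation)
    also have "\<dots> = ?G z \<bullet> w"
      by (simp add: sum scaleR dderiv_def inner_sum_left) (simp add: inner_commute[of w] mult.commute)
    finally show ?thesis .
  qed
  then have "frechet_derivative H (at z) = (\<lambda>w. ?G z \<bullet> w)" by (rule ext)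
  then show "(H has_derivative (\<lambda>w. ?G z \<bullet> w)) (at z)" using d by simp
qed

text \<open>Off the compact set \<open>K\<close> the function dominates all its values, so it equals
  the attained maximum \<open>m\<close> there. Among the excluded periods, 1 is the one that the
  existence theorem produces.\<close>

lemma HZ_admissible_data:
  assumes "HZ_admissible \<tau> U H" "\<forall>z\<in>U. H z \<le> m" "z1 \<in> U" "H z1 = m"
  shows "\<exists>G K V z0. continuous_on U G \<and> (\<forall>z\<in>U. (H has_derivative (\<lambda>w. G z \<bullet> w)) (at z)) \<and>
    compact K \<and> K \<subseteq> U \<and> (\<forall>z\<in>U - K. H z = m) \<and> (\<forall>z\<in>U. 0 \<le> H z \<and> H z \<le> m) \<and>
    open V \<and> V \<subseteq> U \<and> \<tau> z0 = z0 \<and> z0 \<in> V \<and> (\<forall>z\<in>V. H z = 0) \<and>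
    (\<forall>z\<in>U. H (\<tau> z) = H z) \<and> (\<forall>x. \<not> sym_periodic_orbit \<tau> H U 1 x)"
proof -
  have smooth: "smooth_fun_on U H" using assms(1) unfolding HZ_admissible_def by blast
  obtain G where G: "continuous_on U G" "\<And>z. z \<in> U \<Longrightarrow> (H has_derivative (\<lambda>w. G z \<bullet> w)) (at z)"
    by (rule smooth_fun_on_gradient[OF smooth], rule that)
  obtain K where K: "compact K" "K \<subseteq> U" "\<And>z y. z \<in> U - K \<Longrightarrow> y \<in> U \<Longrightarrow> H y \<le> H z"
    using assms(1) unfolding HZ_admissible_def by blast
  have Km: "H z = m" if "z \<in> U - K" for z
    using K(3)[OF that assms(3)] assms(2,4) that by (auto intro: antisym)
  have "\<exists>V. open V \<and> V \<subseteq> U \<and> V \<inter> Fix \<tau> \<noteq> {} \<and> (\<forall>z\<in>V. H z = 0)"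
    using assms(1) unfolding HZ_admissible_def by (elim conjE)
  then obtain V where V': "open V" "V \<subseteq> U" "V \<inter> Fix \<tau> \<noteq> {}" "\<forall>z\<in>V. H z = 0" by (elim exE conjE)
  then obtain z0 where z0: "z0 \<in> V" "\<tau> z0 = z0" unfolding Fix_def by blast
  have no: "\<not> sym_periodic_orbit \<tau> H U 1 x" for x
    using assms(1) unfolding HZ_admissible_def by (metis less_numeral_extra(1) order_refl)
  have inv: "\<forall>z\<in>U. H (\<tau> z) = H z" and nonneg: "\<forall>z\<in>U. 0 \<le> H z"
    using assms(1) unfolding HZ_admissible_def by blast+
  have 1: "\<forall>z\<in>U. (H has_derivative (\<lambda>w. G z \<bullet> w)) (at z)"
    by (rule ballI) (rule G(2))
  have 2: "\<forall>z\<in>U - K. H z = m" by (rule ballI) (rule Km)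
  have 3: "\<forall>z\<in>U. 0 \<le> H z \<and> H z \<le> m" using nonneg assms(2) by simp
  have 5: "\<forall>x. \<not> sym_periodic_orbit \<tau> H U 1 x" by (rule allI) (rule no)
  show ?thesis
    by (rule exI[of _ G], rule exI[of _ K], rule exI[of _ V], rule exI[of _ z0])
      (intro conjI G(1) 1 K(1,2) 2 3 V'(1,2,4) z0 inv 5)
qed

lemma flat_disc_exists:
  assumes "0 < a" "0 < b"
  shows "flat_disc (sqrt (4 * a * b / pi)) a b"
  using assms by unfold_locales (auto simp: power2_eq_square[symmetric])

text \<open>A maximum above \<open>4 * a * b\<close> would, by
  \<open>symmetric_orbit_exists\<close>, come with a symmetric orbit of period 1, which
  admissibility excludes.\<close>

lemma c_HZ_tau_tau0_le:
  fixes U :: "'n::finite phase set"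
  assumes U: "open U" "\<And>z. z \<in> U \<Longrightarrow> tau0 z \<in> U"
    and box: "\<And>z. z \<in> U \<Longrightarrow> \<bar>fst z $ i0 - c\<bar> < a \<and> \<bar>snd z $ i0\<bar> < b" and pos: "0 < a" "0 < b"
  shows "c_HZ_tau tau0 U \<le> ereal (4 * a * b)"
  unfolding c_HZ_tau_def
proof (rule Sup_least)
  fix y assume "y \<in> {ereal m |m. \<exists>H. HZ_admissible tau0 U H \<and> (\<forall>z\<in>U. H z \<le> m) \<and> (\<exists>z\<in>U. H z = m)}"
  then obtain m H z1 where y: "y = ereal m" and adm: "HZ_admissible tau0 U H"
    and m: "\<forall>z\<in>U. H z \<le> m" "z1 \<in> U" "H z1 = m" by blast
  interpret flat_disc "sqrt (4 * a * b / pi)" a b c i0 by (rule flat_disc_exists[OF pos])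
  obtain G K V z0 where data: "continuous_on U G \<and> (\<forall>z\<in>U. (H has_derivative (\<lambda>w. G z \<bullet> w)) (at z)) \<and>
    compact K \<and> K \<subseteq> U \<and> (\<forall>z\<in>U - K. H z = m) \<and> (\<forall>z\<in>U. 0 \<le> H z \<and> H z \<le> m) \<and>
    open V \<and> V \<subseteq> U \<and> tau0 z0 = z0 \<and> z0 \<in> V \<and> (\<forall>z\<in>V. H z = 0) \<and>
    (\<forall>z\<in>U. H (tau0 z) = H z) \<and> (\<forall>x. \<not> sym_periodic_orbit tau0 H U 1 x)"
    using HZ_admissible_data[OF adm m] by (elim exE) (rule that)
  have *: "continuous_on U G" "\<And>z. z \<in> U \<Longrightarrow> (H has_derivative (\<lambda>w. G z \<bullet> w)) (at z)"
    "compact K" "K \<subseteq> U" "\<And>z. z \<in> U - K \<Longrightarrow> H z = m" "\<And>z. z \<in> U \<Longrightarrow> 0 \<le> H z \<and> H z \<le> m"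
    "open V" "V \<subseteq> U" "tau0 z0 = z0" "z0 \<in> V" "\<And>z. z \<in> V \<Longrightarrow> H z = 0"
    "\<And>z. z \<in> U \<Longrightarrow> H (tau0 z) = H z" "\<And>x. \<not> sym_periodic_orbit tau0 H U 1 x"
    using data by blast+
  have z0: "z0 = (fst z0, 0)" using *(9) by (simp add: tau0_def prod_eq_iff vec_eq_iff)
  show "y \<le> ereal (4 * a * b)"
    unfolding y
  proof (rule ccontr)
    assume "\<not> ereal m \<le> ereal (4 * a * b)"
    then have m4: "4 * a * b < m" by simp
    have "\<exists>x. sym_periodic_orbit tau0 H U 1 x"
    proof (rule symmetric_orbit_exists[where V = V and K = K and G = G and m = m and ?q0.0 = "fst z0"])
      show "(fst z0, 0) \<in> V" using *(10) z0 by simp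
      show "tau0 z \<in> U \<and> H (tau0 z) = H z" if "z \<in> U" for z using U(2) *(12) that by blast
    qed (fact U(1) *(1-4,7,8) m4 | rule box *(2,5,6,11); assumption)+
    then show False using *(13) by blast
  qed
qed

text \<open>The symplectic rotation \<open>J (q, p) = (- p, q)\<close> conjugates
  \<open>tau0\<close> into \<open>hat_tau0\<close>. It exchanges the sides of the rectangle, so now
  the side in \<open>q\<close> is the one to be centred at 0.\<close>

lemma c_HZ_tau_hat_tau0_le:
  fixes U :: "'n::finite phase set"
  assumes U: "open U" "\<And>z. z \<in> U \<Longrightarrow> hat_tau0 z \<in> U"
    and box: "\<And>z. z \<in> U \<Longrightarrow> \<bar>fst z $ i0\<bar> < a \<and> \<bar>snd z $ i0\<bar> < b" and pos: "0 < a" "0 < b"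
  shows "c_HZ_tau hat_tau0 U \<le> ereal (4 * a * b)"
  unfolding c_HZ_tau_def
proof (rule Sup_least)
  fix y assume "y \<in> {ereal m |m. \<exists>H. HZ_admissible hat_tau0 U H \<and> (\<forall>z\<in>U. H z \<le> m) \<and> (\<exists>z\<in>U. H z = m)}"
  then obtain m H z1 where y: "y = ereal m" and adm: "HZ_admissible hat_tau0 U H"
    and m: "\<forall>z\<in>U. H z \<le> m" "z1 \<in> U" "H z1 = m" by blast
  \<comment> \<open>The half sides are exchanged; the centre is 0 because the new abscissa is the
    old \<open>p\<close>.\<close>
  interpret flat_disc "sqrt (4 * b * a / pi)" b a 0 i0 by (rule flat_disc_exists[OF pos(2,1)])
  obtain G K V z0 where data: "continuous_on U G \<and> (\<forall>z\<in>U. (H has_derivative (\<lambda>w. G z \<bullet> w)) (at z)) \<and>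
    compact K \<and> K \<subseteq> U \<and> (\<forall>z\<in>U - K. H z = m) \<and> (\<forall>z\<in>U. 0 \<le> H z \<and> H z \<le> m) \<and>
    open V \<and> V \<subseteq> U \<and> hat_tau0 z0 = z0 \<and> z0 \<in> V \<and> (\<forall>z\<in>V. H z = 0) \<and>
    (\<forall>z\<in>U. H (hat_tau0 z) = H z) \<and> (\<forall>x. \<not> sym_periodic_orbit hat_tau0 H U 1 x)"
    using HZ_admissible_data[OF adm m] by (elim exE) (rule that)
  have *: "continuous_on U G" "\<And>z. z \<in> U \<Longrightarrow> (H has_derivative (\<lambda>w. G z \<bullet> w)) (at z)"
    "compact K" "K \<subseteq> U" "\<And>z. z \<in> U - K \<Longrightarrow> H z = m" "\<And>z. z \<in> U \<Longrightarrow> 0 \<le> H z \<and> H z \<le> m"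
    "open V" "V \<subseteq> U" "hat_tau0 z0 = z0" "z0 \<in> V" "\<And>z. z \<in> V \<Longrightarrow> H z = 0"
    "\<And>z. z \<in> U \<Longrightarrow> H (hat_tau0 z) = H z" "\<And>x. \<not> sym_periodic_orbit hat_tau0 H U 1 x"
    using data by blast+
  define J :: "'n phase \<Rightarrow> 'n phase" where "J z = (- snd z, fst z)" for z
  define J' :: "'n phase \<Rightarrow> 'n phase" where "J' z = (snd z, - fst z)" for z
  have JJ [simp]: "J (J' z) = z" "J' (J z) = z" for z by (simp_all add: J_def J'_def)
  have blJ: "bounded_linear J" "bounded_linear J'"
    unfolding J_def J'_def by (intro bounded_linear_Pair bounded_linear_minus bounded_linear_fst bounded_linear_snd)+
  have Jtau: "J (tau0 z) = hat_tau0 (J z)" for z by (simp add: J_def tau0_def hat_tau0_def)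
  have Jadj: "v \<bullet> J w = J' v \<bullet> w" for v w by (simp add: J_def J'_def inner_prod_def)
  have Jom: "omega0 (J v) (J w) = omega0 v w" for v w by (simp add: J_def omega0_def inner_commute)
  have cont: "continuous_on S J" "continuous_on S J'" for S using blJ by (simp_all add: linear_continuous_on)
  define W where "W = J -` U"
  have dJ: "((\<lambda>z. H (J z)) has_derivative (\<lambda>w. J' (G (J z)) \<bullet> w)) (at z)" if "z \<in> W" for z
    using has_derivative_compose[OF bounded_linear_imp_has_derivative[OF blJ(1)] *(2), of z] that
    by (simp add: W_def Jadj)
  have z0: "J' z0 = (snd z0, 0)"
    using *(9) by (simp add: J'_def hat_tau0_def prod_eq_iff vec_eq_iff)
  have no: "\<not> sym_periodic_orbit tau0 (\<lambda>z. H (J z)) W 1 x" for x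
  proof
    assume x: "sym_periodic_orbit tau0 (\<lambda>z. H (J z)) W 1 x"
    have "sym_periodic_orbit hat_tau0 H U 1 (\<lambda>t. J (x t))"
      unfolding sym_periodic_orbit_def ham_orbit_def
    proof (intro conjI allI)
      fix t
      have xt: "x t \<in> W" using x by (simp add: sym_periodic_orbit_def ham_orbit_def)
      then show "J (x t) \<in> U" by (simp add: W_def)
      obtain w where w: "(x has_vector_derivative w) (at t)" "\<And>v. omega0 w v = - frechet_derivative (\<lambda>z. H (J z)) (at (x t)) v"
        using x unfolding sym_periodic_orbit_def ham_orbit_def by blast
      show "\<exists>w. ((\<lambda>t. J (x t)) has_vector_derivative w) (at t) \<and> (\<forall>v. omega0 w v = - frechet_derivative H (at (J (x t))) v)"
      proof (intro exI conjI allI)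
        show "((\<lambda>t. J (x t)) has_vector_derivative J w) (at t)"
          by (rule bounded_linear.has_vector_derivative[OF blJ(1) w(1)])
        fix v
        have "omega0 (J w) v = omega0 w (J' v)" using Jom[of w "J' v"] by simp
        also have "\<dots> = - (J' (G (J (x t))) \<bullet> J' v)"
          using w(2) frechet_derivative_at[OF dJ[OF xt]] by metis
        also have "\<dots> = - (G (J (x t)) \<bullet> v)" using Jadj[of "G (J (x t))" "J' v"] by simp
        also have "\<dots> = - frechet_derivative H (at (J (x t))) v"
          using frechet_derivative_at[OF *(2)[OF \<open>J (x t) \<in> U\<close>]] by metis
        finally show "omega0 (J w) v = - frechet_derivative H (at (J (x t))) v" .
      qed
    next
      obtain s t where "x s \<noteq> x t" using x unfolding sym_periodic_orbit_def by blast
      then have "J (x s) \<noteq> J (x t)" using JJ(2) by metis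
      then show "\<exists>s t. J (x s) \<noteq> J (x t)" by blast
    qed (use x in \<open>auto simp: sym_periodic_orbit_def simp flip: Jtau\<close>)
    then show False using *(13) by blast
  qed
  have img: "z \<in> J' ` S \<longleftrightarrow> J z \<in> S" for z S by (metis JJ image_iff)
  show "y \<le> ereal (4 * a * b)"
    unfolding y
  proof (rule ccontr)
    assume "\<not> ereal m \<le> ereal (4 * a * b)"
    then have "4 * b * a < m" by (simp add: mult_ac)
    then have "\<exists>x. sym_periodic_orbit tau0 (\<lambda>z. H (J z)) W 1 x"
    proof (rule symmetric_orbit_exists[where V = "J -` V" and K = "J' ` K" and G = "\<lambda>z. J' (G (J z))" and ?q0.0 = "snd z0", rotated -1])
      show "open W" "open (J -` V)" unfolding W_def using U(1) *(7) cont by (auto intro: open_vimage)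
      show "compact (J' ` K)" using *(3) cont by (intro compact_continuous_image)
      show "continuous_on W (\<lambda>z. J' (G (J z)))"
        by (rule continuous_on_compose2[OF cont(2) continuous_on_compose2[OF *(1) cont(1)]]) (auto simp: W_def)
      show "\<bar>fst z $ i0 - 0\<bar> < b \<and> \<bar>snd z $ i0\<bar> < a" if "z \<in> W" for z
        using box[of "J z"] that by (simp add: W_def J_def)
      show "(snd z0, 0) \<in> J -` V" using *(10) by (simp flip: z0)
      show "J' ` K \<subseteq> W" using *(4) by (auto simp: W_def)
      show "J -` V \<subseteq> W" using *(8) by (auto simp: W_def)
      show "H (J z) = m" if "z \<in> W - J' ` K" for z using *(5)[of "J z"] that by (simp add: W_def img)
      show "0 \<le> H (J z) \<and> H (J z) \<le> m" if "z \<in> W" for z using *(6)[of "J z"] that by (simp add: W_def)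
      show "H (J z) = 0" if "z \<in> J -` V" for z using *(11) that by simp
      show "tau0 z \<in> W \<and> H (J (tau0 z)) = H (J z)" if "z \<in> W" for z
        using U(2) *(12) that by (simp add: W_def Jtau)
      show "((\<lambda>z. H (J z)) has_derivative (\<lambda>w. J' (G (J z)) \<bullet> w)) (at z)" if "z \<in> W" for z
        using that by (rule dJ)
    qed
    then show False using no by blast
  qed
qed

section \<open>Smooth functions\<close>

lemma iter_dderiv_append: "iter_dderiv (vs @ [v]) f = iter_dderiv vs (dderiv v f)"
  by (induction vs) auto

lemma smooth_fun_on_differentiable: "smooth_fun_on U f \<Longrightarrow> x \<in> U \<Longrightarrow> f differentiable at x"
  unfolding smooth_fun_on_def by (metis iter_dderiv.simps(1))

lemma smooth_fun_on_dderiv: "smooth_fun_on U f \<Longrightarrow> smooth_fun_on U (dderiv v f)"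
  unfolding smooth_fun_on_def by (metis iter_dderiv_append)

lemma dderiv_eq: "(f has_derivative f') (at x) \<Longrightarrow> dderiv v f x = f' v"
  unfolding dderiv_def using frechet_derivative_at by metis

lemma dderiv_cong_open:
  assumes "open U" "x \<in> U" "\<And>y. y \<in> U \<Longrightarrow> f y = g y" "f differentiable at x"
  shows "dderiv v f x = dderiv v g x" "g differentiable at x"
proof -
  obtain f' where f': "(f has_derivative f') (at x)" using assms(4) unfolding differentiable_def by blast
  have "(g has_derivative f') (at x)"
    by (rule has_derivative_transform_within_open[OF f' assms(1,2)]) (rule assms(3))
  then show "dderiv v f x = dderiv v g x" "g differentiable at x"
    using dderiv_eq[OF f'] dderiv_eq[of g f' x] by (auto simp: differentiable_def)
qed

text \<open>Smoothness is the largest property of functions that implies differentiability and is stable under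
  directional derivatives.\<close>
lemma smooth_fun_on_coinduct:
  assumes "g \<in> \<F>" "open U" and diff: "\<And>f x. f \<in> \<F> \<Longrightarrow> x \<in> U \<Longrightarrow> f differentiable at x"
    and cl: "\<And>f v. f \<in> \<F> \<Longrightarrow> \<exists>f'\<in>\<F>. \<forall>x\<in>U. dderiv v f x = f' x"
  shows "smooth_fun_on U g"
proof -
  have "\<exists>f\<in>\<F>. \<forall>x\<in>U. f x = iter_dderiv vs g x" for vs
  proof (induction vs)
    case Nil
    then show ?case using assms(1) by auto
  next
    case (Cons v vs)
    then obtain f where f: "f \<in> \<F>" "\<And>x. x \<in> U \<Longrightarrow> f x = iter_dderiv vs g x" by blast
    obtain f' where f': "f' \<in> \<F>" "\<forall>x\<in>U. dderiv v f x = f' x" using cl[OF f(1)] by blast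
    have "f' x = iter_dderiv (v # vs) g x" if "x \<in> U" for x
      using dderiv_cong_open(1)[OF assms(2) that f(2) diff[OF f(1) that], of v] f'(2) that by simp
    then show ?case using f'(1) by blast
  qed
  then show ?thesis
    unfolding smooth_fun_on_def using dderiv_cong_open(2)[OF assms(2)] diff by metis
qed

text \<open>By the sum rule and the Leibniz rule, stability under directional derivatives only has
  to be checked on the generators.\<close>

inductive_set function_algebra :: "('a \<Rightarrow> real) set \<Rightarrow> ('a \<Rightarrow> real) set" for \<G> where
  gen: "f \<in> \<G> \<Longrightarrow> f \<in> function_algebra \<G>"
| const: "(\<lambda>_. c) \<in> function_algebra \<G>"
| add: "f \<in> function_algebra \<G> \<Longrightarrow> g \<in> function_algebra \<G> \<Longrightarrow> (\<lambda>x. f x + g x) \<in> function_algebra \<G>"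
| mult: "f \<in> function_algebra \<G> \<Longrightarrow> g \<in> function_algebra \<G> \<Longrightarrow> (\<lambda>x. f x * g x) \<in> function_algebra \<G>"

text \<open>The algebra itself serves as the coinduction set. Derivatives of generators are compared
  with members of the algebra on \<open>U\<close> only, as off \<open>U\<close> nothing is known
  about them.\<close>

lemma smooth_fun_on_algebra:
  fixes \<G> :: "('a::real_normed_vector \<Rightarrow> real) set"
  assumes g: "g \<in> function_algebra \<G>" and U: "open U"
    and diff: "\<And>f x. f \<in> \<G> \<Longrightarrow> x \<in> U \<Longrightarrow> f differentiable at x"
    and cl: "\<And>f v. f \<in> \<G> \<Longrightarrow> \<exists>f'\<in>function_algebra \<G>. \<forall>x\<in>U. dderiv v f x = f' x"
  shows "smooth_fun_on U g"
proof (rule smooth_fun_on_coinduct[OF g U])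
  have *: "f differentiable at x" if "f \<in> function_algebra \<G>" "x \<in> U" for f x
    using that by induction (auto intro: diff)
  then show "\<And>f x. f \<in> function_algebra \<G> \<Longrightarrow> x \<in> U \<Longrightarrow> f differentiable at x" .
  fix f v assume "f \<in> function_algebra \<G>"
  then show "\<exists>f'\<in>function_algebra \<G>. \<forall>x\<in>U. dderiv v f x = f' x"
  proof induction
    case (gen f)
    then show ?case by (rule cl)
  next
    case (const c)
    have "dderiv v (\<lambda>_. c) x = 0" for x :: 'a by (rule dderiv_eq) (rule has_derivative_const)
    then show ?case by (intro bexI[OF _ function_algebra.const[of 0]]) auto
  next
    case (add f g)
    then obtain f' g' where fg: "f' \<in> function_algebra \<G>" "g' \<in> function_algebra \<G>"
      "\<And>x. x \<in> U \<Longrightarrow> dderiv v f x = f' x" "\<And>x. x \<in> U \<Longrightarrow> dderiv v g x = g' x" by blast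
    moreover have "dderiv v (\<lambda>x. f x + g x) x = dderiv v f x + dderiv v g x" if "x \<in> U" for x
      using *[OF add.hyps(1) that] *[OF add.hyps(2) that]
      by (intro dderiv_eq[THEN trans]) (auto simp: frechet_derivative_works dderiv_def intro!: has_derivative_add)
    ultimately show ?case by (intro bexI[OF _ function_algebra.add[OF fg(1,2)]]) auto
  next
    case (mult f g)
    then obtain f' g' where fg: "f' \<in> function_algebra \<G>" "g' \<in> function_algebra \<G>"
      "\<And>x. x \<in> U \<Longrightarrow> dderiv v f x = f' x" "\<And>x. x \<in> U \<Longrightarrow> dderiv v g x = g' x" by blast
    moreover have "dderiv v (\<lambda>x. f x * g x) x = f x * dderiv v g x + dderiv v f x * g x" if "x \<in> U" for x
      using *[OF mult.hyps(1) that] *[OF mult.hyps(2) that]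
      by (intro dderiv_eq[THEN trans]) (auto simp: frechet_derivative_works dderiv_def intro!: has_derivative_mult)
    ultimately show ?case
      by (intro bexI[OF _ function_algebra.add[OF function_algebra.mult[OF mult.hyps(1) fg(2)] function_algebra.mult[OF fg(1) mult.hyps(2)]]]) auto
  qed
qed

lemma smooth_fun_on_in_algebra:
  assumes "g \<in> function_algebra {f. smooth_fun_on U f}" "open U"
  shows "smooth_fun_on U g"
  by (rule smooth_fun_on_algebra[OF assms])
    (auto intro: smooth_fun_on_differentiable intro!: bexI[OF _ function_algebra.gen] smooth_fun_on_dderiv)

lemma smooth_fun_on_const: "open U \<Longrightarrow> smooth_fun_on U (\<lambda>_. c)"
  by (intro smooth_fun_on_in_algebra function_algebra.const)

lemma smooth_fun_on_add: "open U \<Longrightarrow> smooth_fun_on U f \<Longrightarrow> smooth_fun_on U g \<Longrightarrow> smooth_fun_on U (\<lambda>x. f x + g x)"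
  by (intro smooth_fun_on_in_algebra function_algebra.add function_algebra.gen) auto

lemma smooth_fun_on_mult: "open U \<Longrightarrow> smooth_fun_on U f \<Longrightarrow> smooth_fun_on U g \<Longrightarrow> smooth_fun_on U (\<lambda>x. f x * g x)"
  by (intro smooth_fun_on_in_algebra function_algebra.mult function_algebra.gen) auto

lemma smooth_fun_on_power: "open U \<Longrightarrow> smooth_fun_on U f \<Longrightarrow> smooth_fun_on U (\<lambda>x. f x ^ n)"
  by (induction n) (auto intro: smooth_fun_on_const smooth_fun_on_mult)

lemma smooth_fun_on_sum:
  assumes "finite I" "open U" "\<And>i. i \<in> I \<Longrightarrow> smooth_fun_on U (f i)"
  shows "smooth_fun_on U (\<lambda>x. \<Sum>i\<in>I. f i x)"
  using assms by (induction I rule: finite_induct) (auto intro: smooth_fun_on_const smooth_fun_on_add)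

lemma smooth_fun_on_affine:
  assumes "bounded_linear L" "open U" shows "smooth_fun_on U (\<lambda>x. L x + c)"
proof (rule smooth_fun_on_algebra[where \<G> = "{L}"])
  show "(\<lambda>x. L x + c) \<in> function_algebra {L}"
    by (intro function_algebra.add function_algebra.gen function_algebra.const) simp
  fix f v assume "f \<in> {L}"
  then have "\<forall>x\<in>U. dderiv v f x = L v"
    using dderiv_eq[OF bounded_linear_imp_has_derivative[OF assms(1)]] by auto
  then show "\<exists>f'\<in>function_algebra {L}. \<forall>x\<in>U. dderiv v f x = f' x"
    by (intro bexI[OF _ function_algebra.const[of "L v"]])
qed (use assms in \<open>auto intro!: bounded_linear_imp_differentiable\<close>)

lemma has_real_derivative_dderiv:
  "f differentiable at x \<Longrightarrow> (f has_real_derivative dderiv 1 f x) (at x)" for f :: "real \<Rightarrow> real"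
proof -
  assume "f differentiable at x"
  then obtain c where c: "(f has_real_derivative c) (at x)" using real_differentiable_def by blast
  then have "dderiv 1 f x = c * 1" by (intro dderiv_eq) (simp add: has_field_derivative_def)
  then show ?thesis using c by simp
qed

lemma dderiv_compose:
  fixes \<phi> :: "real \<Rightarrow> real"
  assumes "(\<phi> has_real_derivative d) (at (f x))" "f differentiable at x"
  shows "dderiv v (\<lambda>x. \<phi> (f x)) x = d * dderiv v f x" "(\<lambda>x. \<phi> (f x)) differentiable at x"
proof -
  obtain f' where f': "(f has_derivative f') (at x)" using assms(2) unfolding differentiable_def by blast
  have c: "((\<lambda>x. \<phi> (f x)) has_derivative (\<lambda>w. d * f' w)) (at x)"
    using has_derivative_compose[OF f' assms(1)[unfolded has_field_derivative_def]] .
  then show "(\<lambda>x. \<phi> (f x)) differentiable at x" unfolding differentiable_def by blast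
  show "dderiv v (\<lambda>x. \<phi> (f x)) x = d * dderiv v f x" using dderiv_eq[OF c] dderiv_eq[OF f'] by simp
qed

text \<open>The generators are the smooth functions on \<open>U\<close> and all compositions of a
  smooth function on \<open>V\<close> with the fixed \<open>f\<close>; the chain rule sends a
  generator to a generator or a product of two.\<close>

lemma smooth_fun_on_compose:
  fixes \<phi> :: "real \<Rightarrow> real"
  assumes "smooth_fun_on V \<phi>" "smooth_fun_on U f" "open U" and sub: "\<And>x. x \<in> U \<Longrightarrow> f x \<in> V"
  shows "smooth_fun_on U (\<lambda>x. \<phi> (f x))"
proof -
  let ?\<G> = "{h. smooth_fun_on U h} \<union> {\<lambda>x. \<phi> (f x) |\<phi>. smooth_fun_on V \<phi>}"
  show ?thesis
  proof (rule smooth_fun_on_algebra[where \<G> = ?\<G>])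
    show "(\<lambda>x. \<phi> (f x)) \<in> function_algebra ?\<G>" using assms by (intro function_algebra.gen) blast
    have fd: "f differentiable at x" if "x \<in> U" for x using smooth_fun_on_differentiable[OF assms(2) that] .
    fix h v assume h: "h \<in> ?\<G>"
    show "h differentiable at x" if "x \<in> U" for x
      using h smooth_fun_on_differentiable[of U h] that
        dderiv_compose(2)[OF has_real_derivative_dderiv[OF smooth_fun_on_differentiable[OF _ sub[OF that]]] fd[OF that]]
      by blast
    show "\<exists>f'\<in>function_algebra ?\<G>. \<forall>x\<in>U. dderiv v h x = f' x"
    proof (cases "smooth_fun_on U h")
      case True
      then have "dderiv v h \<in> function_algebra ?\<G>" using smooth_fun_on_dderiv by (intro function_algebra.gen) blast
      then show ?thesis by blast
    next
      case False
      then obtain \<phi> where \<phi>: "h = (\<lambda>x. \<phi> (f x))" "smooth_fun_on V \<phi>" using h by blast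
      have "(\<lambda>x. dderiv 1 \<phi> (f x) * dderiv v f x) \<in> function_algebra ?\<G>"
        using smooth_fun_on_dderiv[OF \<phi>(2), of 1] smooth_fun_on_dderiv[OF assms(2), of v]
        by (intro function_algebra.mult function_algebra.gen) blast+
      moreover have "dderiv v h x = dderiv 1 \<phi> (f x) * dderiv v f x" if "x \<in> U" for x
        unfolding \<phi>(1)
        by (rule dderiv_compose(1)[OF has_real_derivative_dderiv[OF smooth_fun_on_differentiable[OF \<phi>(2) sub[OF that]]] fd[OF that]])
      ultimately show ?thesis by (intro bexI) auto
    qed
  qed (rule assms(3))
qed

text \<open>For families such as the real powers or \<open>flat\<close>, whose derivatives are
  polynomials in members of the family: all members are shown to be smooth at once.\<close>

lemma smooth_fun_on_real_family:
  fixes D :: "'i \<Rightarrow> real \<Rightarrow> real"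
  assumes "open U" and D: "\<And>i x. x \<in> U \<Longrightarrow> (D i has_real_derivative D' i x) (at x)"
    and D': "\<And>i. \<exists>d\<in>function_algebra (range D). \<forall>x\<in>U. D' i x = d x"
  shows "smooth_fun_on U (D i)"
proof (rule smooth_fun_on_algebra[where \<G> = "range D"])
  show "D i \<in> function_algebra (range D)" by (intro function_algebra.gen) simp
  fix f v assume "f \<in> range D"
  then obtain j where j: "f = D j" by blast
  show "f differentiable at x" if "x \<in> U" for x
    using D[OF that] j real_differentiable_def by blast
  obtain d where d: "d \<in> function_algebra (range D)" "\<forall>x\<in>U. D' j x = d x" using D' by blast
  have "\<forall>x\<in>U. dderiv v f x = v * d x"
  proof
    fix x assume x: "x \<in> U"
    have "dderiv v f x = D' j x * v"
      using D[OF x, of j] unfolding j by (intro dderiv_eq) (simp add: has_field_derivative_def)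
    then show "dderiv v f x = v * d x" using d(2) x by simp
  qed
  then show "\<exists>f'\<in>function_algebra (range D). \<forall>x\<in>U. dderiv v f x = f' x"
    by (intro bexI[OF _ function_algebra.mult[OF function_algebra.const[of v] d(1)]])
qed (rule assms(1))

lemma smooth_fun_on_powr: "smooth_fun_on {0<..} (\<lambda>x::real. x powr a)"
proof (rule smooth_fun_on_real_family[where D' = "\<lambda>a x. a * x powr (a - 1)"])
  fix a x :: real assume "x \<in> {0<..}"
  then show "((\<lambda>x. x powr a) has_real_derivative a * x powr (a - 1)) (at x)"
    by (auto intro!: has_real_derivative_powr)
next
  fix a :: real
  show "\<exists>d\<in>function_algebra (range (\<lambda>a x. x powr a)). \<forall>x\<in>{0<..}. a * x powr (a - 1) = d x"
    by (intro bexI[OF _ function_algebra.mult[OF function_algebra.const[of a] function_algebra.gen[of "\<lambda>x. x powr (a - 1)"]]]) auto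
qed auto

text \<open>The usual flat function \<open>exp (- (1 / x))\<close>, with all negative powers of
  \<open>x\<close> attached because differentiation produces them.\<close>

definition flat :: "nat \<Rightarrow> real \<Rightarrow> real" where
  "flat n x = (if x \<le> 0 then 0 else exp (- (1 / x)) / x ^ n)"

text \<open>From \<open>exp y \<ge> (y / m) ^ m\<close> with \<open>y = 1 / x\<close> and
  \<open>m = n + 2\<close>. The two spare powers of \<open>x\<close> give derivative 0 at the
  origin.\<close>

lemma flat_le: "\<bar>flat n x\<bar> \<le> real (n + 2) ^ (n + 2) * x\<^sup>2"
proof (cases "x \<le> 0")
  case False
  then have x: "x > 0" by simp
  define m where "m = n + 2"
  have m: "real m > 0" by (simp add: m_def)
  have "(1 / x) / real m \<le> exp ((1 / x) / real m)" using exp_ge_add_one_self[of "(1 / x) / real m"] by linarith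
  then have "((1 / x) / real m) ^ m \<le> exp ((1 / x) / real m) ^ m" using x m by (intro power_mono) auto
  also have "\<dots> = exp (1 / x)" using m by (simp flip: exp_of_nat_mult)
  finally have "1 / (real m ^ m * x ^ m) \<le> exp (1 / x)" by (simp add: power_divide power_mult_distrib mult.commute)
  then have "exp (- (1 / x)) \<le> real m ^ m * x ^ m"
    using x m by (simp add: exp_minus field_simps)
  then have "exp (- (1 / x)) / x ^ n \<le> real m ^ m * x ^ m / x ^ n" using x by (intro divide_right_mono) auto
  also have "\<dots> = real m ^ m * x\<^sup>2" using x by (simp add: m_def power_add power2_eq_square)
  finally show ?thesis using x by (simp add: flat_def m_def)
qed (simp add: flat_def)

lemma DERIV_flat: "(flat n has_real_derivative flat (n + 2) x - real n * flat (n + 1) x) (at x)"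
proof -
  consider "x > 0" | "x < 0" | "x = 0" by linarith
  then show ?thesis
  proof cases
    case 1
    have "((\<lambda>x. exp (- (1 / x)) / x ^ n) has_real_derivative
        (exp (- (1 / x)) * (1 / x\<^sup>2) * x ^ n - exp (- (1 / x)) * (real n * x ^ (n - 1))) / (x ^ n * x ^ n)) (at x)"
      using 1 by (auto intro!: derivative_eq_intros simp: power2_eq_square)
    also have "(exp (- (1 / x)) * (1 / x\<^sup>2) * x ^ n - exp (- (1 / x)) * (real n * x ^ (n - 1))) / (x ^ n * x ^ n)
      = flat (n + 2) x - real n * flat (n + 1) x"
      using 1 by (cases n) (auto simp: flat_def field_simps power2_eq_square)
    finally show ?thesis
      by (rule has_field_derivative_transform_within_open[where S = "{0<..}"]) (use 1 in \<open>auto simp: flat_def\<close>)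
  next
    case 2
    have "((\<lambda>x::real. 0) has_real_derivative flat (n + 2) x - real n * flat (n + 1) x) (at x)"
      using 2 by (auto simp: flat_def intro!: derivative_eq_intros)
    then show ?thesis
      by (rule has_field_derivative_transform_within_open[where S = "{..<0}"]) (use 2 in \<open>auto simp: flat_def\<close>)
  next
    case 3
    define C where "C = real (n + 2) ^ (n + 2)"
    have "((\<lambda>y. (flat n y - flat n 0) / (y - 0)) \<longlongrightarrow> 0) (at 0)"
    proof (rule Lim_null_comparison)
      show "((\<lambda>y. C * \<bar>y\<bar>) \<longlongrightarrow> 0) (at 0)" by (auto intro!: tendsto_eq_intros)
      have "norm ((flat n y - flat n 0) / (y - 0)) \<le> C * \<bar>y\<bar>" if "y \<noteq> 0" for y
        using flat_le[of n y] that by (simp add: flat_def[of n 0] C_def abs_divide divide_le_eq power2_eq_square mult.assoc)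
      then show "\<forall>\<^sub>F y in at 0. norm ((flat n y - flat n 0) / (y - 0)) \<le> C * \<bar>y\<bar>"
        by (simp add: eventually_at_filter)
    qed
    then show ?thesis using 3 by (simp add: has_field_derivative_iff flat_def[of _ 0])
  qed
qed

lemma smooth_flat: "smooth_fun_on UNIV (flat n)"
proof (rule smooth_fun_on_real_family)
  show "(flat n has_real_derivative flat (n + 2) x - real n * flat (n + 1) x) (at x)" for n x by (rule DERIV_flat)
  fix n
  have f: "flat k \<in> function_algebra (range flat)" for k by (intro function_algebra.gen) simp
  show "\<exists>d\<in>function_algebra (range flat). \<forall>x\<in>UNIV. flat (n + 2) x - real n * flat (n + 1) x = d x"
    by (intro bexI[OF _ function_algebra.add[OF f[of "n + 2"] function_algebra.mult[OF function_algebra.const[of "- real n"] f[of "n + 1"]]]]) auto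
qed auto

lemma smooth_antiderivative:
  fixes g \<nu> :: "real \<Rightarrow> real"
  assumes \<nu>: "smooth_fun_on UNIV \<nu>" and d: "\<And>x. (g has_real_derivative \<nu> x) (at x)"
  shows "smooth_fun_on UNIV g"
proof (rule smooth_fun_on_algebra[where \<G> = "insert g {f. smooth_fun_on UNIV f}"])
  let ?\<G> = "insert g {f. smooth_fun_on UNIV f}"
  fix f v assume f: "f \<in> ?\<G>"
  show "f differentiable at x" for x
    using f d smooth_fun_on_differentiable[of UNIV f x] real_differentiable_def by blast
  show "\<exists>f'\<in>function_algebra ?\<G>. \<forall>x\<in>UNIV. dderiv v f x = f' x"
  proof (cases "f = g")
    case True
    have "dderiv v g x = \<nu> x * v" for x using d by (intro dderiv_eq) (simp add: has_field_derivative_def)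
    then show ?thesis using True \<nu>
      by (intro bexI[OF _ function_algebra.mult[OF function_algebra.gen[of \<nu>] function_algebra.const[of v]]]) auto
  next
    case False
    then show ?thesis using f smooth_fun_on_dderiv[of UNIV f v]
      by (intro bexI[OF _ function_algebra.gen[of "dderiv v f"]]) auto
  qed
qed (auto intro: function_algebra.gen)

text \<open>The standard quotient of \<open>flat 0 x\<close> by
  \<open>flat 0 x + flat 0 (1 - x)\<close>, whose denominator never vanishes. The division is
  written as a power with exponent -1 so that smoothness of \<open>powr\<close> applies.\<close>

lemma smooth_step:
  obtains \<beta> :: "real \<Rightarrow> real" where "smooth_fun_on UNIV \<beta>" "\<And>x. 0 \<le> \<beta> x" "\<And>x. \<beta> x \<le> 1"
    "\<And>x. x \<le> 0 \<Longrightarrow> \<beta> x = 0" "\<And>x. 1 \<le> x \<Longrightarrow> \<beta> x = 1"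
proof
  let ?s = "\<lambda>x. flat 0 x + flat 0 (- x + 1)"
  let ?\<beta> = "\<lambda>x. flat 0 x * ?s x powr (-1)"
  have nn: "0 \<le> flat 0 x" for x by (simp add: flat_def)
  have pos: "0 < ?s x" for x
    by (cases "x \<le> 0") (auto simp: flat_def intro!: add_pos_nonneg add_nonneg_pos)
  then have eq: "?\<beta> x = flat 0 x / ?s x" for x by (simp add: powr_minus less_imp_le inverse_eq_divide)
  have r: "smooth_fun_on UNIV (\<lambda>x::real. - x + 1)" by (intro smooth_fun_on_affine bounded_linear_minus bounded_linear_ident) auto
  have "smooth_fun_on UNIV (\<lambda>x. flat 0 (- x + 1))" by (rule smooth_fun_on_compose[OF smooth_flat r]) auto
  then have s: "smooth_fun_on UNIV ?s" by (intro smooth_fun_on_add smooth_flat) auto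
  have "smooth_fun_on UNIV (\<lambda>x. ?s x powr (-1))" by (rule smooth_fun_on_compose[OF smooth_fun_on_powr s]) (use pos in auto)
  then show "smooth_fun_on UNIV ?\<beta>" by (intro smooth_fun_on_mult smooth_flat) auto
  show "0 \<le> ?\<beta> x" for x unfolding eq using nn pos[of x] by simp
  show "?\<beta> x \<le> 1" for x unfolding eq using nn[of "- x + 1"] pos[of x] by simp
  show "?\<beta> x = 0" if "x \<le> 0" for x using that by (simp add: flat_def)
  show "?\<beta> x = 1" if "1 \<le> x" for x 
  proof -
    have "flat 0 (- x + 1) = 0" using that by (simp add: flat_def)
    then show ?thesis unfolding eq using pos[of x] by simp
  qed
qed

text \<open>The integral of a bump between 0 and 1 that is 1 on all but the ends of the unit
  interval: the slope never exceeds 1, yet the height is close to 1.\<close>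

lemma smooth_ramp:
  fixes \<delta> :: real
  assumes \<delta>: "0 < \<delta>" "\<delta> < 1/4"
  shows "\<exists>g \<nu>. smooth_fun_on UNIV g \<and> (\<forall>x. (g has_real_derivative \<nu> x) (at x)) \<and> (\<forall>x. 0 \<le> \<nu> x) \<and> (\<forall>x. \<nu> x \<le> 1) \<and>
    (\<forall>x\<le>\<delta>. g x = 0) \<and> (\<forall>x\<ge>1 - \<delta>. g x = g 1) \<and> 1 - 4 * \<delta> \<le> g 1 \<and> mono g"
proof -
  obtain \<beta> :: "real \<Rightarrow> real" where \<beta>: "smooth_fun_on UNIV \<beta>" "\<And>x. 0 \<le> \<beta> x" "\<And>x. \<beta> x \<le> 1"
    and \<beta>0: "\<And>x. x \<le> 0 \<Longrightarrow> \<beta> x = 0" and \<beta>1: "\<And>x. 1 \<le> x \<Longrightarrow> \<beta> x = 1" using smooth_step by metis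
  \<comment> \<open>A step rising from \<open>\<delta>\<close> to \<open>2 * \<delta>\<close> times
    one falling from \<open>1 - 2 * \<delta>\<close> to \<open>1 - \<delta>\<close>.\<close>
  define \<nu> where "\<nu> u = \<beta> (1 / \<delta> * u + - 1) * \<beta> (- (1 / \<delta>) * u + (1 / \<delta> - 1))" for u
  have af: "smooth_fun_on UNIV (\<lambda>u::real. c * u + d)" for c d
    by (intro smooth_fun_on_affine bounded_linear_mult_right) auto
  have s\<nu>: "smooth_fun_on UNIV \<nu>"
    unfolding \<nu>_def by (intro smooth_fun_on_mult smooth_fun_on_compose[OF \<beta>(1) af]) auto
  have \<nu>01: "0 \<le> \<nu> x" "\<nu> x \<le> 1" for x
    using \<beta>(2,3) by (auto simp: \<nu>_def mult_le_one)
  have \<nu>0: "\<nu> x = 0" if "x \<le> \<delta> \<or> 1 - \<delta> \<le> x" for x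
  proof -
    have "1 / \<delta> * x + - 1 = (x - \<delta>) / \<delta>" "- (1 / \<delta>) * x + (1 / \<delta> - 1) = (1 - \<delta> - x) / \<delta>"
      using \<delta> by (simp_all add: diff_divide_distrib)
    then have "1 / \<delta> * x + - 1 \<le> 0 \<or> - (1 / \<delta>) * x + (1 / \<delta> - 1) \<le> 0"
      using that \<delta> by (auto simp: divide_le_0_iff)
    then show ?thesis using \<beta>0 by (auto simp: \<nu>_def)
  qed
  have \<nu>1: "\<nu> x = 1" if "2 * \<delta> \<le> x" "x \<le> 1 - 2 * \<delta>" for x
  proof -
    have "1 / \<delta> * x + - 1 = (x - \<delta>) / \<delta>" "- (1 / \<delta>) * x + (1 / \<delta> - 1) = (1 - \<delta> - x) / \<delta>"
      using \<delta> by (simp_all add: diff_divide_distrib)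
    then have "1 \<le> 1 / \<delta> * x + - 1" "1 \<le> - (1 / \<delta>) * x + (1 / \<delta> - 1)"
      using that \<delta> by (simp_all add: le_divide_eq_1_pos)
    then show ?thesis using \<beta>1 by (simp add: \<nu>_def)
  qed
  have c\<nu>: "continuous_on S \<nu>" for S
    using smooth_fun_on_differentiable[OF s\<nu>] by (meson UNIV_I continuous_at_imp_continuous_on differentiable_imp_continuous_within)
  \<comment> \<open>The base point -1 keeps every \<open>x \<ge> \<delta>\<close> in the interior of
    the interval of integration.\<close>
  define g where "g u = integral {-1..u} \<nu>" for u
  have g0: "g u = 0" if "u \<le> \<delta>" for u
  proof -
    have "g u = integral {-1..u} (\<lambda>_. 0)" unfolding g_def by (rule integral_cong) (use that \<nu>0 in auto)
    then show ?thesis by simp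
  qed
  have dg: "(g has_real_derivative \<nu> x) (at x)" for x
  proof (cases "x < \<delta>")
    case True
    have "((\<lambda>x::real. 0) has_real_derivative \<nu> x) (at x)" using \<nu>0[of x] True by simp
    then show ?thesis
      by (rule has_field_derivative_transform_within_open[where S = "{..<\<delta>}"]) (use True g0 in auto)
  next
    case False
    have "(g has_real_derivative \<nu> x) (at x within {-1..x + 1})"
      unfolding g_def by (rule integral_has_real_derivative[OF c\<nu>]) (use False \<delta> in auto)
    moreover have "x \<in> interior {-1..x + 1}" using False \<delta> by simp
    then have "at x within {-1..x + 1} = at x" by (rule at_within_interior)
    ultimately show ?thesis by simp
  qed
  have mono: "g x \<le> g y" if "x \<le> y" for x y
    by (rule DERIV_nonneg_imp_nondecreasing[OF that]) (use dg \<nu>01 in blast)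
  have g1: "g x = g 1" if "1 - \<delta> \<le> x" for x
  proof -
    have *: "g y = g (1 - \<delta>)" if "1 - \<delta> \<le> y" for y
    proof (cases "y = 1 - \<delta>")
      case False
      then have "1 - \<delta> < y" using that by simp
      then show ?thesis
      proof (rule DERIV_isconst_end)
        show "continuous_on {1 - \<delta>..y} g" using dg DERIV_continuous by (intro continuous_at_imp_continuous_on) blast
        show "(g has_real_derivative 0) (at x)" if "1 - \<delta> < x" for x using dg[of x] \<nu>0[of x] that by simp
      qed
    qed simp
    show ?thesis using *[OF that] *[of 1] \<delta> by simp
  qed
  have "1 - 4 * \<delta> \<le> g 1"
  proof -
    have "2 * \<delta> < 1 - 2 * \<delta>" using \<delta> by simp
    from MVT2[OF this, of g \<nu>] dg
    obtain z where z: "2 * \<delta> < z" "z < 1 - 2 * \<delta>" "g (1 - 2 * \<delta>) - g (2 * \<delta>) = (1 - 2 * \<delta> - 2 * \<delta>) * \<nu> z" by blast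
    have "g (2 * \<delta>) \<ge> g 0" "g 0 = 0" "g (1 - 2 * \<delta>) \<le> g 1"
      using mono[of 0 "2 * \<delta>"] g0[of 0] mono[of "1 - 2 * \<delta>" 1] \<delta> by auto
    then show ?thesis using z \<nu>1[of z] by simp
  qed
  show ?thesis
    by (intro exI[of _ g] exI[of _ \<nu>] conjI allI impI monoI smooth_antiderivative[OF s\<nu> dg] dg \<nu>01 g0 g1
        \<open>1 - 4 * \<delta> \<le> g 1\<close> mono)
qed

section \<open>The lower bound\<close>

text \<open>Initial data in a line stay on that line: the component orthogonal to it solves a linear
  system with zero initial data.\<close>
lemma linear_system_zero:
  fixes a b \<alpha> \<beta> :: "real \<Rightarrow> real"
  assumes da: "\<And>t. (a has_real_derivative - (\<alpha> t * b t)) (at t)" and db: "\<And>t. (b has_real_derivative \<beta> t * a t) (at t)"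
    and bd: "\<And>t. \<bar>\<alpha> t\<bar> \<le> K" "\<And>t. \<bar>\<beta> t\<bar> \<le> K" and init: "a 0 = 0" "b 0 = 0" and t: "t \<ge> 0"
  shows "a t = 0 \<and> b t = 0"
proof -
  \<comment> \<open>Gronwall in differential form: the exponential factor absorbs the largest
    possible growth rate of the squared norm, so \<open>E\<close> cannot increase from its initial
    value 0.\<close>
  define E where "E t = exp (- (2 * K * t)) * ((a t)\<^sup>2 + (b t)\<^sup>2)" for t
  have K0: "0 \<le> K" using bd(1)[of 0] by linarith
  have dE: "(E has_real_derivative exp (- (2 * K * t)) * (- (2 * K) * ((a t)\<^sup>2 + (b t)\<^sup>2) + 2 * (\<beta> t - \<alpha> t) * (a t * b t))) (at t)" for t
    unfolding E_def by (auto intro!: derivative_eq_intros da db simp: algebra_simps power2_eq_square)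
  have neg: "- (2 * K) * ((a t)\<^sup>2 + (b t)\<^sup>2) + 2 * (\<beta> t - \<alpha> t) * (a t * b t) \<le> 0" for t
  proof -
    have "2 * (\<beta> t - \<alpha> t) * (a t * b t) \<le> \<bar>2 * (\<beta> t - \<alpha> t) * (a t * b t)\<bar>" by simp
    also have "\<dots> = \<bar>\<beta> t - \<alpha> t\<bar> * (2 * \<bar>a t\<bar> * \<bar>b t\<bar>)"
      by (simp only: abs_mult abs_numeral mult_ac)
    also have "\<dots> \<le> (2 * K) * ((a t)\<^sup>2 + (b t)\<^sup>2)"
    proof (rule mult_mono)
      show "\<bar>\<beta> t - \<alpha> t\<bar> \<le> 2 * K" using bd(1)[of t] bd(2)[of t] by linarith
      show "2 * \<bar>a t\<bar> * \<bar>b t\<bar> \<le> (a t)\<^sup>2 + (b t)\<^sup>2"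
        using sum_squares_bound[of "\<bar>a t\<bar>" "\<bar>b t\<bar>"] by simp
    qed (use K0 in auto)
    finally show ?thesis by simp
  qed
  have "E t \<le> E 0"
    by (rule DERIV_nonpos_imp_nonincreasing[OF t])
      (use dE neg in \<open>blast intro: mult_nonneg_nonpos exp_ge_zero\<close>)
  then have "(a t)\<^sup>2 + (b t)\<^sup>2 \<le> 0" using init by (simp add: E_def mult_le_0_iff)
  then show ?thesis by (simp add: sum_power2_le_zero_iff)
qed

lemma linear_system_zero':
  fixes a b \<alpha> \<beta> :: "real \<Rightarrow> real"
  assumes da: "\<And>t. (a has_real_derivative - (\<alpha> t * b t)) (at t)" and db: "\<And>t. (b has_real_derivative \<beta> t * a t) (at t)"
    and bd: "\<And>t. \<bar>\<alpha> t\<bar> \<le> K" "\<And>t. \<bar>\<beta> t\<bar> \<le> K" and init: "a 0 = 0" "b 0 = 0"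
  shows "a t = 0 \<and> b t = 0"
proof (cases "t \<ge> 0")
  case True
  then show ?thesis using linear_system_zero[OF da db bd init] by blast
next
  case False
  have "a (- (- t)) = 0 \<and> b (- (- t)) = 0"
  proof (rule linear_system_zero[where a = "\<lambda>t. a (- t)" and b = "\<lambda>t. b (- t)" and t = "- t" and \<alpha> = "\<lambda>t. - \<alpha> (- t)" and \<beta> = "\<lambda>t. - \<beta> (- t)" and K = K])
    show "((\<lambda>t. a (- t)) has_real_derivative - (- \<alpha> (- t) * b (- t))) (at t)" for t
      using DERIV_chain2[OF da DERIV_minus[OF DERIV_ident]] by simp
    show "((\<lambda>t. b (- t)) has_real_derivative - \<beta> (- t) * a (- t)) (at t)" for t
      using DERIV_chain2[OF db DERIV_minus[OF DERIV_ident]] by simp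
  qed (use bd init False in auto)
  then show ?thesis by simp
qed

lemma DERIV_bound_time:
  fixes f :: "real \<Rightarrow> real"
  assumes "s \<le> t" "\<And>x. (f has_real_derivative f' x) (at x)" "\<And>x. \<bar>f' x\<bar> \<le> v"
  shows "\<bar>f t - f s\<bar> \<le> v * (t - s)"
proof -
  have "norm (f t - f s) \<le> v * norm (t - s)"
    by (rule field_differentiable_bound[where S = UNIV and f' = f']) (use assms in auto)
  then show ?thesis using assms(1) by simp
qed

text \<open>Between the zeros of \<open>\<eta>\<close>, \<open>\<xi>\<close> descends through \<open>c\<close> and \<open>-c\<close>, where \<open>|\<eta>| = c\<close> as well. So \<open>\<eta>\<close>, \<open>\<xi>\<close>, \<open>\<eta>\<close>
  travel the distances \<open>c\<close>, \<open>2c\<close>, \<open>c\<close> one after the other, at speed at most \<open>\<mu> R\<^bsup>2k-1\<^esup>\<close>.\<close>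
lemma quarter_turns:
  fixes \<xi> \<eta> :: "real \<Rightarrow> real"
  assumes d\<xi>: "\<And>t. (\<xi> has_real_derivative - (\<mu> * \<eta> t ^ (2*k-1))) (at t)"
    and d\<eta>: "\<And>t. (\<eta> has_real_derivative \<mu> * \<xi> t ^ (2*k-1)) (at t)"
    and k: "k \<ge> 1" and lev: "\<And>t. \<xi> t ^ (2*k) + \<eta> t ^ (2*k) = R ^ (2*k)" and R: "R > 0" and \<mu>: "\<mu> > 0"
    and c: "0 < c" "c ^ (2*k) * 2 = R ^ (2*k)"
    and bdry: "\<eta> 0 = 0" "\<eta> h = 0" "\<xi> 0 > 0" and h: "h > 0"
  shows "4 * c \<le> \<mu> * R ^ (2*k-1) * h"
proof -
  have even: "x ^ (2*k) = \<bar>x\<bar> ^ (2*k)" for x :: real by (simp add: power_even_abs)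
  have odd: "odd (2*k-1)" using k by simp
  have le_R: "\<bar>\<xi> t\<bar> \<le> R" "\<bar>\<eta> t\<bar> \<le> R" for t
  proof -
    have "0 \<le> \<bar>\<xi> t\<bar> ^ (2*k)" "0 \<le> \<bar>\<eta> t\<bar> ^ (2*k)" by simp_all
    then have "\<bar>\<xi> t\<bar> ^ (2*k) \<le> R ^ (2*k)" "\<bar>\<eta> t\<bar> ^ (2*k) \<le> R ^ (2*k)"
      using lev[of t] even[of "\<xi> t"] even[of "\<eta> t"] by linarith+
    then show "\<bar>\<xi> t\<bar> \<le> R" "\<bar>\<eta> t\<bar> \<le> R" using R k by (metis abs_ge_zero less_imp_le power_le_imp_le_base power_mono_iff mult_pos_pos zero_less_numeral less_le_trans zero_less_one)+
  qed
  define v where "v = \<mu> * R ^ (2*k-1)"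
  have v: "v > 0" using \<mu> R by (simp add: v_def)
  have speed: "\<bar>- (\<mu> * \<eta> t ^ (2*k-1))\<bar> \<le> v" "\<bar>\<mu> * \<xi> t ^ (2*k-1)\<bar> \<le> v" for t
    using le_R[of t] \<mu> by (auto simp: v_def abs_mult power_abs intro!: mult_left_mono power_mono)
  have cR: "c < R"
  proof (rule ccontr)
    assume "\<not> c < R"
    then have "R ^ (2*k) \<le> c ^ (2*k)" using R by (intro power_mono) auto
    moreover have "R ^ (2*k) > 0" using R by simp
    ultimately show False using c(2) by linarith
  qed
  have at0: "\<bar>\<xi> t\<bar> = R" if "\<eta> t = 0" for t
  proof -
    have "\<xi> t ^ (2*k) = R ^ (2*k)" using lev[of t] that k by (simp add: power_0_left)
    then have "\<bar>\<xi> t\<bar> ^ (2*k) = R ^ (2*k)" using even[of "\<xi> t"] by linarith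
    then show ?thesis by (rule power_eq_imp_eq_base) (use R k in auto)
  qed
  have atc: "\<bar>\<eta> t\<bar> = c" if "\<bar>\<xi> t\<bar> = c" for t
  proof -
    have "\<bar>\<eta> t\<bar> ^ (2*k) = c ^ (2*k)" using lev[of t] that c(2) even[of "\<xi> t"] even[of "\<eta> t"] by simp
    then show ?thesis by (rule power_eq_imp_eq_base) (use c(1) k in auto)
  qed
  have cont: "continuous_on S \<xi>" for S using d\<xi> by (meson DERIV_continuous continuous_at_imp_continuous_on)
  \<comment> \<open>Suppose the minimum of \<open>\<xi>\<close> exceeds \<open>- c\<close>. If it is
    at least \<open>c\<close>, then \<open>\<eta>\<close> increases strictly and cannot return to 0.
    Otherwise it is attained in the interior, where the equation gives \<open>\<eta> = 0\<close> and
    hence \<open>|\<xi>| = R > c\<close>.\<close>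
  have "\<exists>t2\<in>{0..h}. \<xi> t2 \<le> - c"
  proof (rule ccontr)
    assume "\<not> ?thesis"
    then have gt: "\<xi> t > - c" if "t \<in> {0..h}" for t using that by (meson not_le)
    obtain tm where tm: "tm \<in> {0..h}" "\<And>t. t \<in> {0..h} \<Longrightarrow> \<xi> tm \<le> \<xi> t"
      using continuous_attains_inf[of "{0..h}" \<xi>] cont h by auto
    show False
    proof (cases "\<xi> tm \<ge> c")
      case True
      have "\<eta> 0 < \<eta> h"
      proof (rule DERIV_pos_imp_increasing[OF h])
        fix t assume "0 \<le> t" "t \<le> h"
        then have "\<xi> t > 0" using tm(2)[of t] True c(1) by auto
        then have "\<mu> * \<xi> t ^ (2*k-1) > 0" using \<mu> by simp
        then show "\<exists>y. (\<eta> has_real_derivative y) (at t) \<and> 0 < y" using d\<eta> by blast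
      qed
      then show False using bdry by simp
    next
      case False
      then have small: "\<bar>\<xi> tm\<bar> < c" using gt[OF tm(1)] by auto
      then have "tm \<noteq> 0" "tm \<noteq> h" using at0[of tm] bdry(1,2) cR by auto
      then have tm': "0 < tm" "tm < h" using tm(1) by auto
      define d where "d = min tm (h - tm)"
      have "- (\<mu> * \<eta> tm ^ (2*k-1)) = 0"
      proof (rule DERIV_local_min[OF d\<xi>])
        show "0 < d" using tm' by (simp add: d_def)
        show "\<forall>y. \<bar>tm - y\<bar> < d \<longrightarrow> \<xi> tm \<le> \<xi> y" using tm(2) by (auto simp: d_def abs_less_iff)
      qed
      then have "\<eta> tm = 0" using \<mu> by simp
      then show False using at0[of tm] small cR by simp
    qed
  qed
  then obtain t2 where t2: "t2 \<in> {0..h}" "\<xi> t2 \<le> - c" by blast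
  have x0: "\<xi> 0 \<ge> c" using at0[OF bdry(1)] bdry(3) cR by simp
  obtain t3 where t3: "0 \<le> t3" "t3 \<le> t2" "\<xi> t3 = - c"
    using IVT2'[of \<xi> t2 "- c" 0] t2 x0 c(1) cont by auto
  obtain t1 where t1: "0 \<le> t1" "t1 \<le> t3" "\<xi> t1 = c"
    using IVT2'[of \<xi> t3 c 0] t3 x0 c(1) cont by auto
  have "c \<le> v * (t1 - 0)" using DERIV_bound_time[OF t1(1) d\<eta> speed(2)] bdry(1) atc[of t1] t1(3) c(1) by simp
  moreover have "2 * c \<le> v * (t3 - t1)" using DERIV_bound_time[OF t1(2) d\<xi> speed(1)] t1(3) t3(3) c(1) by simp
  moreover have "c \<le> v * (h - t3)"
    using DERIV_bound_time[of t3 h, OF _ d\<eta> speed(2)] bdry(2) atc[of t3] t3 t2(1) c(1) by simp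
  ultimately have "4 * c \<le> v * (t1 - 0) + v * (t3 - t1) + v * (h - t3)" by linarith
  also have "\<dots> = v * h" by (simp add: algebra_simps)
  finally show ?thesis by (simp add: v_def)
qed

text \<open>The same for motion in several dimensions started at rest, where conservation of angular momentum forces the motion onto a line.\<close>
lemma half_period_bound:
  fixes X Y :: "real \<Rightarrow> 'a::real_inner"
  assumes dX: "\<And>t. (X has_vector_derivative - ((\<mu> * norm (Y t) ^ (2*k-2)) *\<^sub>R Y t)) (at t)"
    and dY: "\<And>t. (Y has_vector_derivative (\<mu> * norm (X t) ^ (2*k-2)) *\<^sub>R X t) (at t)"
    and k: "k \<ge> 1" and lev: "\<And>t. norm (X t) ^ (2*k) + norm (Y t) ^ (2*k) = R ^ (2*k)" and R: "R > 0" and \<mu>: "\<mu> > 0"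
    and c: "0 < c" "c ^ (2*k) * 2 = R ^ (2*k)" and bdry: "Y 0 = 0" "Y h = 0" and h: "h > 0"
  shows "4 * c \<le> \<mu> * R ^ (2*k-1) * h"
proof -
  have X0: "norm (X 0) ^ (2*k) = R ^ (2*k)" using lev[of 0] bdry(1) k by (simp add: power_0_left)
  have nX: "norm (X 0) = R" by (rule power_eq_imp_eq_base[OF X0]) (use R k in auto)
  define e where "e = (1 / R) *\<^sub>R X 0"
  have e: "e \<bullet> e = 1" using nX R by (simp add: e_def power2_norm_eq_inner[symmetric] power2_eq_square)
  have le: "norm (X t) \<le> R" "norm (Y t) \<le> R" for t
  proof -
    have "norm (X t) ^ (2*k) \<le> R ^ (2*k)" "norm (Y t) ^ (2*k) \<le> R ^ (2*k)"
      using lev[of t] zero_le_power[OF norm_ge_zero, of "X t" "2*k"] zero_le_power[OF norm_ge_zero, of "Y t" "2*k"] by linarith+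
    then show "norm (X t) \<le> R" "norm (Y t) \<le> R"
      using R k power_mono_iff[of "norm (X t)" R "2*k"] power_mono_iff[of "norm (Y t)" R "2*k"] by auto
  qed
  have dXw: "((\<lambda>t. X t \<bullet> w) has_real_derivative - ((\<mu> * norm (Y t) ^ (2*k-2)) * (Y t \<bullet> w))) (at t)" for t w
    using bounded_linear.has_vector_derivative[OF bounded_linear_inner_left dX]
    by (simp add: has_real_derivative_iff_has_vector_derivative)
  have dYw: "((\<lambda>t. Y t \<bullet> w) has_real_derivative (\<mu> * norm (X t) ^ (2*k-2)) * (X t \<bullet> w)) (at t)" for t w
    using bounded_linear.has_vector_derivative[OF bounded_linear_inner_left dY]
    by (simp add: has_real_derivative_iff_has_vector_derivative)
  \<comment> \<open>Components along \<open>w\<close> solve a linear system with bounded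
    coefficients; the initial data vanish because \<open>w\<close> is orthogonal to
    \<open>X 0\<close> and \<open>Y 0 = 0\<close>.\<close>
  have ortho: "X t \<bullet> w = 0 \<and> Y t \<bullet> w = 0" if "w \<bullet> e = 0" for w t
  proof (rule linear_system_zero'[OF dXw dYw, where K = "\<mu> * R ^ (2*k-2)"])
    show "X 0 \<bullet> w = 0" using that(1) R by (simp add: e_def inner_commute)
  qed (use \<mu> le in \<open>auto simp: abs_mult bdry intro!: mult_left_mono power_mono\<close>)
  have line: "X t = (X t \<bullet> e) *\<^sub>R e" "Y t = (Y t \<bullet> e) *\<^sub>R e" for t
  proof -
    have 1: "(X t - (X t \<bullet> e) *\<^sub>R e) \<bullet> e = 0" "(Y t - (Y t \<bullet> e) *\<^sub>R e) \<bullet> e = 0" using e by (simp_all add: inner_diff_left)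
    have 2: "w \<bullet> w = 0" if "w = v - c *\<^sub>R e" "w \<bullet> e = 0" "v \<bullet> w = 0" for v w c
    proof -
      have "w \<bullet> w = (v - c *\<^sub>R e) \<bullet> w" using that(1) by (rule arg_cong)
      also have "\<dots> = v \<bullet> w - c * (w \<bullet> e)" unfolding inner_diff_left inner_scaleR_left inner_commute[of e] ..
      finally show ?thesis using that(2,3) by simp
    qed
    show "X t = (X t \<bullet> e) *\<^sub>R e" using 2[OF refl 1(1)] ortho[OF 1(1), of t] by simp
    show "Y t = (Y t \<bullet> e) *\<^sub>R e" using 2[OF refl 1(2)] ortho[OF 1(2), of t] by simp
  qed
  have ne: "norm e = 1" using e by (simp add: norm_eq_1)
  have nXY: "norm (X t) = \<bar>X t \<bullet> e\<bar>" "norm (Y t) = \<bar>Y t \<bullet> e\<bar>" for t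
    using arg_cong[OF line(1)[of t], of norm] arg_cong[OF line(2)[of t], of norm] ne by simp_all
  have pw: "\<bar>x\<bar> ^ (2*k-2) * x = x ^ (2*k-1)" "\<bar>x\<bar> ^ (2*k) = x ^ (2*k)" for x :: real
  proof -
    have "even (2*k-2)" by simp
    then have "\<bar>x\<bar> ^ (2*k-2) = x ^ (2*k-2)" by (rule power_even_abs)
    moreover have "2*k-1 = Suc (2*k-2)" using k by simp
    ultimately show "\<bar>x\<bar> ^ (2*k-2) * x = x ^ (2*k-1)" by (simp del: power_Suc add: power_Suc2)
  qed (simp add: power_even_abs)
  show ?thesis
  proof (rule quarter_turns[where \<xi> = "\<lambda>t. X t \<bullet> e" and \<eta> = "\<lambda>t. Y t \<bullet> e"])
    show "((\<lambda>t. X t \<bullet> e) has_real_derivative - (\<mu> * (Y t \<bullet> e) ^ (2*k-1))) (at t)" for t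
      using dXw[of e t] unfolding nXY mult.assoc pw .
    show "((\<lambda>t. Y t \<bullet> e) has_real_derivative \<mu> * (X t \<bullet> e) ^ (2*k-1)) (at t)" for t
      using dYw[of e t] unfolding nXY mult.assoc pw .
    show "(X t \<bullet> e) ^ (2*k) + (Y t \<bullet> e) ^ (2*k) = R ^ (2*k)" for t using lev[of t] unfolding nXY pw .
    show "X 0 \<bullet> e > 0" using nX R by (simp add: e_def power2_norm_eq_inner[symmetric])
  qed (use k R \<mu> c bdry h in auto)
qed

text \<open>The symmetry makes \<open>x 0\<close> and \<open>x (T / 2)\<close> fixed points of
  \<open>\<tau>\<close>, so \<open>p\<close> (for \<open>tau0\<close>) or \<open>q\<close> (for
  \<open>hat_tau0\<close>) vanishes at these times. These are the boundary data of
  \<open>half_period_bound\<close> for the time \<open>T / 2\<close>; dividing \<open>q - q0\<close>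
  by \<open>r\<close> gives both halves of the system the same factor.\<close>

lemma symmetric_period_bound:
  fixes x :: "real \<Rightarrow> 'n::finite phase" and l :: real
  assumes d: "\<And>t. (x has_vector_derivative
      (- ((l * (2 * real k) * norm (snd (x t)) ^ (2*k-2)) *\<^sub>R snd (x t)),
       (l * (2 * real k) * (norm (fst (x t) - q0) / r) ^ (2*k-2) / r\<^sup>2) *\<^sub>R (fst (x t) - q0))) (at t)"
    and sym: "\<And>t. x (T - t) = x (- t) \<and> x (- t) = \<tau> (x t)"
    and \<tau>: "\<tau> = tau0 \<or> \<tau> = hat_tau0 \<and> q0 = 0"
    and k: "k \<ge> 1" and r: "r > 0" and l: "l > 0" and T: "T > 0" and R: "R > 0"
    and lev: "\<And>t. (norm (fst (x t) - q0) / r) ^ (2*k) + norm (snd (x t)) ^ (2*k) = R ^ (2*k)"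
    and c: "0 < c" "c ^ (2*k) * 2 = R ^ (2*k)"
  shows "4 * c \<le> (l * (2 * real k) / r) * R ^ (2*k-1) * (T / 2)"
proof -
  define \<mu> where "\<mu> = l * (2 * real k) / r"
  have \<mu>: "\<mu> > 0" using l k r by (simp add: \<mu>_def)
  define X where "X t = (1 / r) *\<^sub>R (fst (x t) - q0)" for t
  define Y where "Y t = snd (x t)" for t
  have nX: "norm (X t) = norm (fst (x t) - q0) / r" for t using r by (simp add: X_def)
  have dq: "((\<lambda>t. fst (x t)) has_vector_derivative - ((l * (2 * real k) * norm (snd (x t)) ^ (2*k-2)) *\<^sub>R snd (x t))) (at t)" for t
    using bounded_linear.has_vector_derivative[OF bounded_linear_fst d[of t]] by (simp only: fst_conv)
  have dX: "(X has_vector_derivative - ((\<mu> * norm (Y t) ^ (2*k-2)) *\<^sub>R Y t)) (at t)" for t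
  proof -
    have "((\<lambda>t. (1 / r) *\<^sub>R (fst (x t) - q0)) has_vector_derivative
        (1 / r) *\<^sub>R (- ((l * (2 * real k) * norm (snd (x t)) ^ (2*k-2)) *\<^sub>R snd (x t)) - 0)) (at t)"
      by (intro bounded_linear.has_vector_derivative[OF bounded_linear_scaleR_right] has_vector_derivative_diff dq has_vector_derivative_const)
    then show ?thesis unfolding X_def Y_def \<mu>_def by (simp add: mult_ac)
  qed
  have dY: "(Y has_vector_derivative (\<mu> * norm (X t) ^ (2*k-2)) *\<^sub>R X t) (at t)" for t
  proof -
    have "((\<lambda>t. snd (x t)) has_vector_derivative (l * (2 * real k) * (norm (fst (x t) - q0) / r) ^ (2*k-2) / r\<^sup>2) *\<^sub>R (fst (x t) - q0)) (at t)"
      using bounded_linear.has_vector_derivative[OF bounded_linear_snd d[of t]] by (simp only: snd_conv)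
    moreover have "(l * (2 * real k) * (norm (fst (x t) - q0) / r) ^ (2*k-2) / r\<^sup>2) *\<^sub>R (fst (x t) - q0) = (\<mu> * norm (X t) ^ (2*k-2)) *\<^sub>R X t"
      unfolding nX by (simp add: X_def \<mu>_def power2_eq_square)
    ultimately show ?thesis unfolding Y_def[abs_def] by (simp only:)
  qed
  have sym0: "x 0 = \<tau> (x 0)" "x (T / 2) = \<tau> (x (T / 2))" 
  proof -
    show "x 0 = \<tau> (x 0)" using sym[of 0] unfolding minus_zero by (rule conjunct2)
    have "T - T / 2 = T / 2" by simp
    then show "x (T / 2) = \<tau> (x (T / 2))" using sym[of "T / 2"] by metis
  qed
  have vec0: "v = 0" if "v = - v" for v :: "real^'n" using that by (simp add: vec_eq_iff)
  show ?thesis unfolding \<mu>_def[symmetric]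
  proof (cases "\<tau> = tau0")
    case True
    then have "Y 0 = - Y 0" "Y (T / 2) = - Y (T / 2)" using sym0 by (simp_all add: Y_def tau0_def prod_eq_iff)
    then have "Y 0 = 0" "Y (T / 2) = 0" using vec0 by auto
    then show "4 * c \<le> \<mu> * R ^ (2*k-1) * (T / 2)"
      using lev T by (intro half_period_bound[OF dX dY k _ R \<mu> c]) (auto simp: nX Y_def)
  next
    case False
    then have q0: "q0 = 0" "\<tau> = hat_tau0" using \<tau> by auto
    then have "X 0 = - X 0" "X (T / 2) = - X (T / 2)" using sym0 by (simp_all add: X_def hat_tau0_def prod_eq_iff flip: scaleR_minus_right)
    then have X0: "- X 0 = 0" "- X (T / 2) = 0" using vec0 by auto
    \<comment> \<open>Passing from \<open>(X, Y)\<close> to \<open>(Y, - X)\<close> preserves the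
      form of the system and moves the vanishing component to the second place.\<close>
    show "4 * c \<le> \<mu> * R ^ (2*k-1) * (T / 2)"
    proof (rule half_period_bound[where X = Y and Y = "\<lambda>t. - X t"])
      show "(Y has_vector_derivative - ((\<mu> * norm (- X t) ^ (2*k-2)) *\<^sub>R - X t)) (at t)" for t using dY[of t] by simp
      show "((\<lambda>t. - X t) has_vector_derivative (\<mu> * norm (Y t) ^ (2*k-2)) *\<^sub>R Y t) (at t)" for t
        using has_vector_derivative_minus[OF dX[of t]] by simp
      show "norm (Y t) ^ (2*k) + norm (- X t) ^ (2*k) = R ^ (2*k)" for t using lev[of t] by (simp add: nX Y_def)
    qed (use k R \<mu> c X0 T in auto)
  qed
qed

section \<open>The test Hamiltonian in the product of balls\<close>

lemma smooth_fun_on_norm_square: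
  fixes L :: "'a::real_normed_vector \<Rightarrow> 'b::euclidean_space"
  assumes "bounded_linear L" "open U"
  shows "smooth_fun_on U (\<lambda>z. (L z - a) \<bullet> (L z - a))"
proof -
  have "(\<lambda>z. (L z - a) \<bullet> (L z - a)) = (\<lambda>z. \<Sum>b\<in>Basis. (L z \<bullet> b + - (a \<bullet> b)) * (L z \<bullet> b + - (a \<bullet> b)))"
    by (rule ext, subst euclidean_inner) (simp add: inner_diff_left)
  moreover have "bounded_linear (\<lambda>z. L z \<bullet> b)" for b
    by (rule bounded_linear_compose[OF bounded_linear_inner_left assms(1)])
  ultimately show ?thesis
    using assms(2) by (simp only:) (intro smooth_fun_on_sum smooth_fun_on_mult smooth_fun_on_affine; simp)
qed

lemma has_derivative_inner_power:
  fixes f :: "'a::real_normed_vector \<Rightarrow> 'b::real_inner" and c :: real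
  assumes f: "bounded_linear f"
  shows "((\<lambda>z. ((f z - a) \<bullet> (f z - a) * c) ^ k) has_derivative
    (\<lambda>v. 2 * real k * c * ((f z - a) \<bullet> (f z - a) * c) ^ (k - 1) * ((f z - a) \<bullet> f v))) (at z)"
proof -
  have "((\<lambda>z. f z - a) has_derivative (\<lambda>v. f v - 0)) (at z)"
    by (intro has_derivative_diff has_derivative_const bounded_linear_imp_has_derivative f)
  from has_derivative_power[OF has_derivative_mult_left[OF has_derivative_inner[OF this this], of c], of k]
  show ?thesis by (rule has_derivative_eq_rhs) (simp add: fun_eq_iff inner_commute[of "f _" "f z - a"])
qed

text \<open>Apart from \<open>\<theta>\<close>, \<open>w\<close> is homogeneous of degree 2 about
  \<open>(q0, 0)\<close>, so the bound on speed divided by amplitude is the same on all levels. A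
  symmetric orbit of period at most 1 would force \<open>4 * r * \<kappa> \<le> C\<close>, which a
  large \<open>k\<close> prevents since \<open>\<kappa>\<close> tends to 1.\<close>

lemma admissible_in_product:
  fixes U :: "'n::finite phase set"
  assumes U: "\<And>z. norm (fst z - q0) < r \<Longrightarrow> norm (snd z) < 1 \<Longrightarrow> z \<in> U" "open U"
    and \<tau>: "\<tau> = tau0 \<or> \<tau> = hat_tau0 \<and> q0 = 0" and r: "r > 0" and C0: "0 < C0" "C0 < 4 * r"
  shows "\<exists>H m. HZ_admissible \<tau> U H \<and> (\<forall>z\<in>U. H z \<le> m) \<and> (\<exists>z\<in>U. H z = m) \<and> C0 \<le> m"
proof -
  \<comment> \<open>Strictly between \<open>C0\<close> and \<open>4 * r\<close>: the room above
    \<open>C0\<close> pays for the flat ends of the ramp, the room below \<open>4 * r\<close> for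
    \<open>\<kappa> < 1\<close>.\<close>
  define C where "C = (C0 + 4 * r) / 2"
  have C: "0 < C" "C0 < C" "C < 4 * r" using C0 r by (auto simp: C_def)
  have "C / (4 * r) < 1" "0 \<le> C / (4 * r)" using C r by auto
  then obtain j where j: "(C / (4 * r)) ^ j < 1/2" using real_arch_pow_inv[of "1/2" "C / (4 * r)"] by auto
  define k where "k = Suc j"
  have k: "k \<ge> 1" by (simp add: k_def)
  have "(C / (4 * r)) ^ (2 * k) \<le> (C / (4 * r)) ^ j"
    using C r by (intro power_decreasing) (auto simp: k_def)
  then have ck: "(C / (4 * r)) ^ (2 * k) < 1/2" using j by linarith
  \<comment> \<open>On the level \<open>N = R ^ (2 * k)\<close>, \<open>R * \<kappa>\<close> is the
    size of both components when they are equal: the \<open>c\<close> of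
    \<open>quarter_turns\<close>.\<close>
  define \<kappa> where "\<kappa> = root (2 * k) (1/2)"
  have \<kappa>: "\<kappa> > 0" "\<kappa> ^ (2 * k) = 1/2" using k by (auto simp: \<kappa>_def)
  have C\<kappa>: "C < 4 * r * \<kappa>"
  proof -
    have "(C / (4 * r)) ^ (2 * k) < \<kappa> ^ (2 * k)" using ck \<kappa>(2) by simp
    then have "C / (4 * r) < \<kappa>" by (rule power_less_imp_less_base) (use \<kappa> in simp)
    then show ?thesis using r by (simp add: field_simps)
  qed
  \<comment> \<open>The flat ends cost the fraction \<open>4 * \<delta>\<close> of the height; this
    choice leaves at least \<open>C0\<close>.\<close>
  define \<delta> where "\<delta> = min (1/8) ((C - C0) / (4 * C))"
  have \<delta>: "0 < \<delta>" "\<delta> < 1/4" using C by (auto simp: \<delta>_def)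
  have C\<delta>: "C0 \<le> C * (1 - 4 * \<delta>)"
  proof -
    have "\<delta> \<le> (C - C0) / (4 * C)" by (simp add: \<delta>_def)
    then have "4 * C * \<delta> \<le> C - C0" using C by (simp add: field_simps)
    then show ?thesis by (simp add: algebra_simps)
  qed
  obtain g \<nu> where ramp: "smooth_fun_on UNIV g \<and> (\<forall>x. (g has_real_derivative \<nu> x) (at x)) \<and> (\<forall>x. 0 \<le> \<nu> x) \<and> (\<forall>x. \<nu> x \<le> 1) \<and>
    (\<forall>x\<le>\<delta>. g x = 0) \<and> (\<forall>x\<ge>1 - \<delta>. g x = g 1) \<and> 1 - 4 * \<delta> \<le> g 1 \<and> mono g"
    using smooth_ramp[OF \<delta>] by (elim exE) (rule that)
  then have g: "smooth_fun_on UNIV g" "\<And>x. (g has_real_derivative \<nu> x) (at x)" "\<And>x. 0 \<le> \<nu> x" "\<And>x. \<nu> x \<le> 1"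
    "\<And>x. x \<le> \<delta> \<Longrightarrow> g x = 0" "\<And>x. 1 - \<delta> \<le> x \<Longrightarrow> g x = g 1" "1 - 4 * \<delta> \<le> g 1" "\<And>x y. x \<le> y \<Longrightarrow> g x \<le> g y"
    by (blast dest: monoD)+
  \<comment> \<open>Positive, so that the power \<open>1 / k\<close> is smooth even where
    \<open>N = 0\<close>; below \<open>\<delta> ^ k\<close>, so that \<open>w \<le> \<delta>\<close>
    and \<open>H = 0\<close> near \<open>(q0, 0)\<close>.\<close>
  define \<theta> where "\<theta> = (\<delta> / 2) ^ k"
  have \<theta>: "0 < \<theta>" "\<theta> < \<delta> ^ k" using \<delta> k by (auto simp: \<theta>_def intro!: power_strict_mono)
  define N where "N z = ((fst z - q0) \<bullet> (fst z - q0) * (1 / r\<^sup>2)) ^ k + ((snd z - 0) \<bullet> (snd z - 0)) ^ k" for z :: "'n phase"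
  have N_eq: "N z = (norm (fst z - q0) / r) ^ (2*k) + norm (snd z) ^ (2*k)" for z
    by (simp add: N_def power_mult power2_norm_eq_inner power_divide)
  have N0: "0 \<le> N z" for z by (simp add: N_eq r less_imp_le)
  define w where "w z = (N z + \<theta>) powr (1 / real k)" for z
  define H where "H z = C * g (w z)" for z
  define m where "m = C * g 1"
  have sN: "smooth_fun_on UNIV N" unfolding N_def
    by (intro smooth_fun_on_add smooth_fun_on_power smooth_fun_on_mult smooth_fun_on_const
        smooth_fun_on_norm_square bounded_linear_fst bounded_linear_snd) auto
  have sH: "smooth_fun_on UNIV H"
  proof -
    have "smooth_fun_on UNIV (\<lambda>z. N z + \<theta>)" by (intro smooth_fun_on_add sN smooth_fun_on_const) auto
    then have "smooth_fun_on UNIV w" unfolding w_def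
      by (rule smooth_fun_on_compose[OF smooth_fun_on_powr]) (use N0 \<theta> in \<open>auto intro: add_nonneg_pos\<close>)
    then have "smooth_fun_on UNIV (\<lambda>z. g (w z))" by (rule smooth_fun_on_compose[OF g(1)]) auto
    then show ?thesis unfolding H_def by (intro smooth_fun_on_mult smooth_fun_on_const) auto
  qed
  have cN: "continuous_on S N" for S unfolding N_def by (intro continuous_intros)
  have powk: "(x ^ k) powr (1 / real k) = x" if "x > 0" for x :: real
    using that k by (simp add: powr_powr flip: powr_realpow)
  have w_le: "w z \<le> x" if "N z + \<theta> \<le> x ^ k" "x > 0" for z x
    unfolding w_def using powr_mono2[of "1 / real k" "N z + \<theta>" "x ^ k"] that powk[of x] N0[of z] \<theta> by simp
  have w_ge: "x \<le> w z" if "x ^ k \<le> N z" "x > 0" for z x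
    unfolding w_def using powr_mono2[of "1 / real k" "x ^ k" "N z + \<theta>"] that powk[of x] \<theta> by simp
  have inside: "norm (fst z - q0) < r \<and> norm (snd z) < 1" if "N z < 1" for z
  proof -
    have "(norm (fst z - q0) / r) ^ (2*k) < 1" "norm (snd z) ^ (2*k) < 1"
    proof -
      have "0 \<le> (norm (fst z - q0) / r) ^ (2*k)" "0 \<le> norm (snd z) ^ (2*k)" using r by simp_all
      then show "(norm (fst z - q0) / r) ^ (2*k) < 1" "norm (snd z) ^ (2*k) < 1"
        using that unfolding N_eq by linarith+
    qed
    then have "norm (fst z - q0) / r < 1" "norm (snd z) < 1"
      using one_le_power[of "norm (fst z - q0) / r" "2*k"] one_le_power[of "norm (snd z)" "2*k"] by (meson not_le)+
    then show ?thesis using r by simp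
  qed
  have g_le: "g x \<le> g 1" for x using g(8)[of x 1] g(6)[of x] \<delta> by (cases "x \<le> 1") auto
  have g_ge: "0 \<le> g x" for x using g(8)[of "min x \<delta>" x] g(5)[of "min x \<delta>"] by simp
  have H_le: "H z \<le> m" for z using g_le C by (simp add: H_def m_def)
  have H_out: "H z = m" if "(1 - \<delta>) ^ k \<le> N z" for z
    using g(6)[OF w_ge[OF that]] \<delta> by (simp add: H_def m_def)
  have N\<tau>: "N (\<tau> z) = N z" for z
    using \<tau> by (auto simp: N_eq tau0_def hat_tau0_def)
  have Cm: "C0 \<le> m" unfolding m_def using C\<delta> g(7) C(1) by (meson less_imp_le mult_left_mono order_trans)
  have dk1: "(1 - \<delta>) ^ k < 1" using \<delta> k by (intro power_less_one_iff[THEN iffD2]) auto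
  have att: "\<exists>z\<in>U. H z = m"
  proof -
    \<comment> \<open>This puts \<open>N\<close> at \<open>(1 - \<delta> / 2) ^ k\<close>: on the
      plateau of the ramp and still inside \<open>U\<close>.\<close>
    define s where "s = sqrt (1 - \<delta> / 2)"
    have s: "0 \<le> s" "s < 1" "s\<^sup>2 = 1 - \<delta> / 2" using \<delta> by (auto simp: s_def)
    let ?z = "(q0, s *\<^sub>R axis undefined 1) :: 'n phase"
    have "N ?z = (s\<^sup>2) ^ k" using k s by (simp add: N_eq norm_axis_1 power_mult power_0_left)
    moreover have "(1 - \<delta>) ^ k \<le> (s\<^sup>2) ^ k" unfolding s using \<delta> by (intro power_mono) auto
    ultimately have "H ?z = m" by (intro H_out) simp
    moreover have "?z \<in> U" using s r by (intro U) (auto simp: norm_axis_1)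
    ultimately show ?thesis by blast
  qed
  have adm: "HZ_admissible \<tau> U H"
    unfolding HZ_admissible_def
  proof (intro conjI allI impI)
    show "\<forall>z\<in>U. H (\<tau> z) = H z" by (simp add: H_def w_def N\<tau>)
    show "smooth_fun_on U H" using sH unfolding smooth_fun_on_def by blast
    show "\<forall>z\<in>U. 0 \<le> H z" using g_ge C by (simp add: H_def)
    show "\<exists>V. open V \<and> V \<subseteq> U \<and> V \<inter> Fix \<tau> \<noteq> {} \<and> (\<forall>z\<in>V. H z = 0)"
    proof (intro exI conjI ballI)
      let ?V = "{z. N z + \<theta> < \<delta> ^ k}"
      show "open ?V" by (intro open_Collect_less continuous_intros cN)
      have "\<delta> ^ k \<le> 1" using \<delta> by (intro power_le_one) auto
      then have "N z < 1" if "z \<in> ?V" for z using that \<theta> by simp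
      then show "?V \<subseteq> U" using inside U(1) by blast
      have "(q0, 0) \<in> ?V" using \<theta> k by (simp add: N_eq power_0_left)
      moreover have "(q0, 0) \<in> Fix \<tau>" using \<tau> by (auto simp: Fix_def tau0_def hat_tau0_def)
      ultimately show "?V \<inter> Fix \<tau> \<noteq> {}" by blast
      show "H z = 0" if "z \<in> ?V" for z
        using w_le[of z \<delta>] that \<delta> g(5) by (simp add: H_def)
    qed
    show "\<exists>K. compact K \<and> K \<subseteq> U \<and> (\<forall>z\<in>U - K. \<forall>y\<in>U. H y \<le> H z)"
    proof (intro exI conjI ballI)
      let ?K = "{z. N z \<le> (1 - \<delta>) ^ k}"
      have K1: "N z < 1" if "z \<in> ?K" for z using that dk1 by simp
      then show "?K \<subseteq> U" using inside U(1) by blast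
      have "?K \<subseteq> cball q0 r \<times> cball 0 1"
        using inside K1 by (auto simp: dist_norm norm_minus_commute less_imp_le) (metis fst_conv snd_conv less_imp_le)+
      then have "bounded ?K" by (rule bounded_subset[rotated]) (intro bounded_Times bounded_cball)
      moreover have "closed ?K" by (intro closed_Collect_le continuous_intros cN)
      ultimately show "compact ?K" by (simp add: compact_eq_bounded_closed)
      show "H y \<le> H z" if "z \<in> U - ?K" for z y using H_out[of z] H_le[of y] that by simp
    qed
  next
    fix T :: real and x assume T: "0 < T \<and> T \<le> 1"
    show "\<not> sym_periodic_orbit \<tau> H U T x"
    proof
      assume x: "sym_periodic_orbit \<tau> H U T x"
      \<comment> \<open>The derivative of \<open>H\<close> as a function of the value of
        \<open>N\<close>. It is constant along an orbit because \<open>N\<close> is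
        conserved.\<close>
      define lm where "lm z = C * (\<nu> (w z) * ((1 / real k) * (N z + \<theta>) powr (1 / real k - 1)))" for z
      define Nq where "Nq z = (2 * real k * (norm (fst z - q0) / r) ^ (2*k-2) / r\<^sup>2) *\<^sub>R (fst z - q0)" for z :: "'n phase"
      define Np where "Np z = (2 * real k * norm (snd z) ^ (2*k-2)) *\<^sub>R snd z" for z :: "'n phase"
      have dN: "(N has_derivative (\<lambda>v. Nq z \<bullet> fst v + Np z \<bullet> snd v)) (at z)" for z
      proof -
        have pw: "(y\<^sup>2) ^ (k - 1) = y ^ (2*k-2)" for y :: real
          by (simp add: power_mult[symmetric] right_diff_distrib')
        have nq: "(fst z - q0) \<bullet> (fst z - q0) * (1 / r\<^sup>2) = (norm (fst z - q0) / r)\<^sup>2"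
          by (simp add: power_divide power2_norm_eq_inner)
        have np: "(snd z - 0) \<bullet> (snd z - 0) = (norm (snd z))\<^sup>2" by (simp add: power2_norm_eq_inner)
        have "(N has_derivative (\<lambda>v. 2 * real k * (1 / r\<^sup>2) * ((fst z - q0) \<bullet> (fst z - q0) * (1 / r\<^sup>2)) ^ (k - 1) * ((fst z - q0) \<bullet> fst v)
            + 2 * real k * 1 * ((snd z - 0) \<bullet> (snd z - 0)) ^ (k - 1) * ((snd z - 0) \<bullet> snd v))) (at z)"
          using has_derivative_add[OF has_derivative_inner_power[OF bounded_linear_fst, of q0 "1 / r\<^sup>2" k z]
            has_derivative_inner_power[OF bounded_linear_snd, of 0 1 k z]]
          unfolding N_def[abs_def] by (simp only: mult_1_right)
        then show ?thesis unfolding nq np pw Nq_def Np_def by (simp add: mult.commute mult.left_commute)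
      qed
      have dH: "(H has_derivative (\<lambda>v. lm z * (Nq z \<bullet> fst v + Np z \<bullet> snd v))) (at z)" for z
      proof -
        have "((\<lambda>y. (y + \<theta>) powr (1 / real k)) has_real_derivative (1 / real k) * (N z + \<theta>) powr (1 / real k - 1)) (at (N z))"
          using N0[of z] \<theta> by (auto intro!: derivative_eq_intros)
        from DERIV_cmult[OF DERIV_chain2[OF g(2) this], of C]
        have "((\<lambda>y. C * g ((y + \<theta>) powr (1 / real k))) has_real_derivative lm z) (at (N z))"
          by (simp add: lm_def w_def)
        from has_derivative_compose[OF dN this[unfolded has_field_derivative_def]]
        show ?thesis unfolding H_def w_def .
      qed
      have dx: "(x has_vector_derivative (- (lm (x t) *\<^sub>R Np (x t)), lm (x t) *\<^sub>R Nq (x t))) (at t)" for t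
      proof -
        obtain u where u: "(x has_vector_derivative u) (at t)" "\<And>v. omega0 u v = - frechet_derivative H (at (x t)) v"
          using x unfolding sym_periodic_orbit_def ham_orbit_def by blast
        have om: "fst u \<bullet> snd v - snd u \<bullet> fst v = - (lm (x t) * (Nq (x t) \<bullet> fst v + Np (x t) \<bullet> snd v))" for v
          using u(2)[of v] unfolding omega0_def frechet_derivative_at[OF dH[of "x t"], symmetric] .
        have "(fst u + lm (x t) *\<^sub>R Np (x t)) \<bullet> v = 0" for v using om[of "(0, v)"] by (simp add: inner_add_left)
        then have "fst u + lm (x t) *\<^sub>R Np (x t) = 0" using inner_eq_zero_iff by blast
        moreover have "(snd u - lm (x t) *\<^sub>R Nq (x t)) \<bullet> v = 0" for v using om[of "(v, 0)"] by (simp add: inner_diff_left)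
        then have "snd u - lm (x t) *\<^sub>R Nq (x t) = 0" using inner_eq_zero_iff by blast
        ultimately have "u = (- (lm (x t) *\<^sub>R Np (x t)), lm (x t) *\<^sub>R Nq (x t))"
          by (simp add: prod_eq_iff add_eq_0_iff2)
        then show ?thesis using u(1) by simp
      qed
      have "((\<lambda>t. N (x t)) has_real_derivative 0) (at t)" for t
        using has_derivative_compose[OF dx[of t, unfolded has_vector_derivative_def] dN]
        by (simp add: has_field_derivative_def lambda_zero inner_commute)
      then have Nc: "N (x t) = N (x 0)" for t using DERIV_isconst_all[of "\<lambda>t. N (x t)"] by blast
      define s where "s = N (x 0)"
      define l where "l = lm (x 0)"
      have lm_c: "lm (x t) = l" for t unfolding l_def lm_def w_def Nc[of t] ..
      have l0: "0 \<le> l" using g(3) C by (simp add: l_def lm_def)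
      obtain t1 t2 where nc: "x t1 \<noteq> x t2" using x unfolding sym_periodic_orbit_def by blast
      have ln: "l \<noteq> 0"
      proof
        assume "l = 0"
        then have "(x has_vector_derivative 0) (at t)" for t using dx[of t] by (simp add: lm_c zero_prod_def)
        then obtain c where "\<And>t. t \<in> UNIV \<Longrightarrow> x t = c"
          using has_vector_derivative_zero_constant[OF convex_UNIV, of x] by metis
        then show False using nc by simp
      qed
      have sn: "s \<noteq> 0"
      proof
        assume "s = 0"
        then have "N (x t) = 0" for t using Nc by (simp add: s_def)
        then have "(norm (fst (x t) - q0) / r) ^ (2*k) = 0 \<and> norm (snd (x t)) ^ (2*k) = 0" for t
          unfolding N_eq using r by (subst (asm) add_nonneg_eq_0_iff) auto
        then have "x t = (q0, 0)" for t using k r by (simp add: prod_eq_iff)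
        then show False using nc by metis
      qed
      have s0: "s > 0" using sn N0[of "x 0"] by (simp add: s_def)
      define R where "R = root (2 * k) s"
      have R: "R > 0" "R ^ (2*k) = s" using s0 k by (auto simp: R_def)
      \<comment> \<open>Together with \<open>T \<le> 1\<close> and slope at most 1 of the ramp this
        becomes \<open>4 * (R * \<kappa>) \<le> C * R / r\<close>, against the choice of
        \<open>k\<close>.\<close>
      have "4 * (R * \<kappa>) \<le> (l * (2 * real k) / r) * R ^ (2*k-1) * (T / 2)"
      proof (rule symmetric_period_bound[where \<tau> = \<tau> and ?q0.0 = q0 and x = x])
        show "(x has_vector_derivative
          (- ((l * (2 * real k) * norm (snd (x t)) ^ (2*k-2)) *\<^sub>R snd (x t)),
           (l * (2 * real k) * (norm (fst (x t) - q0) / r) ^ (2*k-2) / r\<^sup>2) *\<^sub>R (fst (x t) - q0))) (at t)" for t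
          using dx[of t] unfolding lm_c Np_def Nq_def by (simp add: mult.assoc)
        show "x (T - t) = x (- t) \<and> x (- t) = \<tau> (x t)" for t using x unfolding sym_periodic_orbit_def by blast
        show "(norm (fst (x t) - q0) / r) ^ (2*k) + norm (snd (x t)) ^ (2*k) = R ^ (2*k)" for t
          using Nc[of t] unfolding N_eq[symmetric] R(2) s_def .
        show "(R * \<kappa>) ^ (2*k) * 2 = R ^ (2*k)" using \<kappa>(2) by (simp add: power_mult_distrib)
      qed (use \<tau> k r l0 ln T R \<kappa> in auto)
      also have "\<dots> \<le> (l * (2 * real k) / r) * R ^ (2*k-1) * (1 / 2)"
        using T l0 R r by (intro mult_left_mono) auto
      also have "\<dots> = (l * real k) * R ^ (2*k-1) / r" by simp
      also have "\<dots> \<le> C * R / r"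
      proof (rule divide_right_mono)
        \<comment> \<open>The exponent is at most 0, so dropping \<open>\<theta>\<close> can only
          increase the power. As \<open>s = R ^ (2 * k)\<close>, its product with
          \<open>R ^ (2 * k - 1)\<close> is then exactly \<open>R\<close>.\<close>
        have "(s + \<theta>) powr (1 / real k - 1) \<le> s powr (1 / real k - 1)"
          using s0 \<theta> k by (intro powr_mono2') auto
        moreover have "\<nu> (w (x 0)) * (s + \<theta>) powr (1 / real k - 1) \<le> 1 * (s + \<theta>) powr (1 / real k - 1)"
          using g(4) by (intro mult_right_mono) auto
        ultimately have "C * (\<nu> (w (x 0)) * (s + \<theta>) powr (1 / real k - 1)) \<le> C * s powr (1 / real k - 1)"
          using C by (intro mult_left_mono) auto
        then have "l * real k \<le> C * s powr (1 / real k - 1)" using k by (simp add: l_def lm_def s_def)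
        then have "(l * real k) * R ^ (2*k-1) \<le> (C * s powr (1 / real k - 1)) * R ^ (2*k-1)"
          using R by (intro mult_right_mono) auto
        also have "\<dots> = C * R"
        proof -
          have "s powr (1 / real k - 1) * s = s powr (1 / real k)" using s0 powr_add[of s "1 / real k - 1" 1] by simp
          also have "\<dots> = ((R\<^sup>2) ^ k) powr (1 / real k)" using R by (simp flip: power_mult)
          also have "\<dots> = R * R" using powk[of "R\<^sup>2"] R by (simp add: power2_eq_square)
          finally have eq: "s powr (1 / real k - 1) * s = R * R" .
          have "R ^ (2*k-1) * R = s" unfolding R(2)[symmetric] using k by (intro power_minus_mult) simp
          with eq have "(s powr (1 / real k - 1) * R ^ (2*k-1)) * R = R * R" by (simp only: mult.assoc)
          then have "s powr (1 / real k - 1) * R ^ (2*k-1) = R" using R by simp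
          then show ?thesis by (simp add: mult.assoc)
        qed
        finally show "(l * real k) * R ^ (2*k-1) \<le> C * R" .
      qed (use r in simp)
      finally have "4 * (R * \<kappa>) \<le> C * R / r" .
      then have "R * (4 * r * \<kappa>) \<le> R * C" using r by (simp add: field_simps)
      then have "4 * r * \<kappa> \<le> C" using R by simp
      then show False using C\<kappa> by simp
    qed
  qed
  show ?thesis using adm H_le att Cm by blast
qed

section \<open>Inradius and circumradius\<close>

lemma interior_times_cball:
  "interior (\<Delta> \<times> cball 0 1) = interior \<Delta> \<times> ball (0::real^'n) 1" for \<Delta> :: "(real^'n) set"
  by (simp add: interior_Times)

text \<open>Maxima at least \<open>C0\<close> are available for every \<open>C0\<close> strictly
  below \<open>4 * r\<close>, hence the passage through \<open>dense_le\<close>.\<close>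

lemma zeta_ge:
  fixes \<Delta> :: "(real^'n) set"
  assumes \<Delta>: "cball q r \<subseteq> \<Delta>" and r: "r > 0" and \<tau>: "\<tau> = tau0 \<or> \<tau> = hat_tau0 \<and> q = 0"
  shows "ereal (4 * r) \<le> zeta \<tau> \<Delta>"
proof (rule dense_le)
  fix y :: ereal assume y: "y < ereal (4 * r)"
  \<comment> \<open>The maximum with \<open>2 * r\<close> keeps \<open>C0\<close> positive when
    \<open>y\<close> is nonpositive or minus infinity.\<close>
  define C0 where "C0 = max (2 * r) (real_of_ereal y)"
  have yC: "y \<le> ereal C0" using y by (cases y) (auto simp: C0_def)
  have C0: "0 < C0" "C0 < 4 * r" using y r by (cases y; auto simp: C0_def)+
  let ?U = "interior (\<Delta> \<times> cball (0::real^'n) 1)"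
  have "ball q r \<subseteq> interior \<Delta>" using interior_mono[OF \<Delta>] by simp
  then have U: "z \<in> ?U" if "norm (fst z - q) < r" "norm (snd z) < 1" for z
    using that unfolding interior_times_cball mem_Times_iff by (auto simp: dist_norm norm_minus_commute)
  obtain H m where H: "HZ_admissible \<tau> ?U H \<and> (\<forall>z\<in>?U. H z \<le> m) \<and> (\<exists>z\<in>?U. H z = m) \<and> C0 \<le> m"
  proof -
    have "\<exists>H m. HZ_admissible \<tau> ?U H \<and> (\<forall>z\<in>?U. H z \<le> m) \<and> (\<exists>z\<in>?U. H z = m) \<and> C0 \<le> m"
      by (rule admissible_in_product[of q r]) (fact | rule U | rule open_interior)+
    then show thesis by (elim exE) (rule that)
  qed
  have "ereal m \<le> zeta \<tau> \<Delta>"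
    unfolding zeta_def c_EHZ_tau_def c_HZ_tau_def using H by (intro Sup_upper) blast
  moreover have "ereal C0 \<le> ereal m" using H by simp
  ultimately show "y \<le> zeta \<tau> \<Delta>" using yC by order
qed

text \<open>On any coordinate axis a ball of radius \<open>R\<close> projects to an interval of half
  length \<open>R\<close>, and the unit ball in \<open>p\<close> to one of half length 1. The index
  \<open>undefined\<close> stands for an arbitrary coordinate.\<close>

lemma zeta_tau0_le:
  fixes \<Delta> :: "(real^'n) set"
  assumes \<Delta>: "\<Delta> \<subseteq> cball q R" and R: "R > 0"
  shows "zeta tau0 \<Delta> \<le> ereal (4 * R)"
proof -
  let ?U = "interior (\<Delta> \<times> cball (0::real^'n) 1)"
  have in_ball: "interior \<Delta> \<subseteq> ball q R" using interior_mono[OF \<Delta>] by simp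
  have "c_HZ_tau tau0 ?U \<le> ereal (4 * R * 1)"
  proof (rule c_HZ_tau_tau0_le[where c = "q $ undefined" and ?i0.0 = undefined])
    show "tau0 z \<in> ?U" if "z \<in> ?U" for z
      using that unfolding interior_times_cball mem_Times_iff by (simp add: tau0_def)
    show "\<bar>fst z $ undefined - q $ undefined\<bar> < R \<and> \<bar>snd z $ undefined\<bar> < 1" if "z \<in> ?U" for z
    proof -
      have "norm (fst z - q) < R" "norm (snd z) < 1"
        using that in_ball unfolding interior_times_cball mem_Times_iff by (auto simp: dist_norm norm_minus_commute)
      then show ?thesis
        using component_le_norm_cart[of "fst z - q" undefined] component_le_norm_cart[of "snd z" undefined] by simp
    qed
  qed (use R in auto)
  then show ?thesis by (simp add: zeta_def c_EHZ_tau_def)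
qed

text \<open>Central symmetry is what makes the domain invariant under
  \<open>hat_tau0\<close>.\<close>

lemma zeta_hat_tau0_le:
  fixes \<Delta> :: "(real^'n) set"
  assumes \<Delta>: "\<Delta> \<subseteq> cball 0 R" and R: "R > 0" and sym: "uminus ` \<Delta> = \<Delta>"
  shows "zeta hat_tau0 \<Delta> \<le> ereal (4 * R)"
proof -
  let ?U = "interior (\<Delta> \<times> cball (0::real^'n) 1)"
  have in_ball: "interior \<Delta> \<subseteq> ball 0 R" using interior_mono[OF \<Delta>] by simp
  have "uminus ` interior \<Delta> = interior \<Delta>" using interior_negations[of \<Delta>] sym by simp
  then have neg: "- v \<in> interior \<Delta>" if "v \<in> interior \<Delta>" for v using that by blast
  have "c_HZ_tau hat_tau0 ?U \<le> ereal (4 * R * 1)"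
  proof (rule c_HZ_tau_hat_tau0_le[where ?i0.0 = undefined])
    show "hat_tau0 z \<in> ?U" if "z \<in> ?U" for z
      using that neg unfolding interior_times_cball mem_Times_iff by (simp add: hat_tau0_def)
    show "\<bar>fst z $ undefined\<bar> < R \<and> \<bar>snd z $ undefined\<bar> < 1" if "z \<in> ?U" for z
    proof -
      have "norm (fst z) < R" "norm (snd z) < 1"
        using that in_ball unfolding interior_times_cball mem_Times_iff by (auto simp: subset_iff)
      then show ?thesis
        using component_le_norm_cart[of "fst z" undefined] component_le_norm_cart[of "snd z" undefined] by simp
    qed
  qed (use R in auto)
  then show ?thesis by (simp add: zeta_def c_EHZ_tau_def)
qed

text \<open>The inradius is a supremum, so the estimate passes through balls of almost that radius.
  Nonempty interior and boundedness ensure that the set of radii is nonempty and bounded.\<close>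

lemma ereal_inradius_le:
  fixes \<Delta> :: "'a::euclidean_space set"
  assumes "convex_body \<Delta>" and le: "\<And>q r. r > 0 \<Longrightarrow> cball q r \<subseteq> \<Delta> \<Longrightarrow> ereal (4 * r) \<le> Z"
  shows "ereal (4 * inradius \<Delta>) \<le> Z"
proof (rule dense_le)
  fix y :: ereal assume y: "y < ereal (4 * inradius \<Delta>)"
  let ?S = "{r. r > 0 \<and> (\<exists>q. cball q r \<subseteq> \<Delta>)}"
  have \<Delta>: "bounded \<Delta>" "interior \<Delta> \<noteq> {}" using assms(1) compact_imp_bounded by (auto simp: convex_body_def)
  obtain p e where "e > 0" "cball p e \<subseteq> \<Delta>" using \<Delta>(2) by (auto simp: mem_interior_cball)
  then have ne: "?S \<noteq> {}" by blast
  obtain B where B: "\<Delta> \<subseteq> ball 0 B" using bounded_subset_ballD[OF \<Delta>(1), of 0] by blast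
  have "r \<le> B" if r: "r \<in> ?S" for r
  proof -
    obtain q where q: "cball q r \<subseteq> \<Delta>" "r > 0" using r by auto
    have "cball q r \<subseteq> cball 0 B" using q(1) B ball_subset_cball[of 0 B] by (meson order_trans)
    with q(2) have "dist q 0 + r \<le> B" unfolding cball_subset_cball_iff by simp
    then show "r \<le> B" using zero_le_dist[of q 0] by linarith
  qed
  then have bdd: "bdd_above ?S" by (rule bdd_aboveI)
  obtain s where s: "y < ereal s" "s < 4 * inradius \<Delta>" using ereal_dense2[OF y] by auto
  then have "s / 4 < Sup ?S" unfolding inradius_def by simp
  then obtain r where r: "r \<in> ?S" "s / 4 < r" using less_cSup_iff[OF ne bdd] by blast
  then have "ereal (4 * r) \<le> Z" using le by blast
  moreover have "ereal s < ereal (4 * r)" using r(2) by simp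
  ultimately show "y \<le> Z" using s(1) by order
qed

lemma le_ereal_circumradius:
  fixes \<Delta> :: "'a::euclidean_space set"
  assumes "convex_body \<Delta>" and le: "\<And>q R. R > 0 \<Longrightarrow> \<Delta> \<subseteq> cball q R \<Longrightarrow> Z \<le> ereal (4 * R)"
  shows "Z \<le> ereal (4 * circumradius \<Delta>)"
proof (rule dense_ge)
  fix y assume y: "ereal (4 * circumradius \<Delta>) < y"
  let ?S = "{R. R > 0 \<and> (\<exists>q. \<Delta> \<subseteq> cball q R)}"
  have "bounded \<Delta>" using assms(1) compact_imp_bounded by (auto simp: convex_body_def)
  then obtain B where "0 < B" "\<Delta> \<subseteq> cball 0 B" using bounded_subset_ballD[of \<Delta> 0] ball_subset_cball by blast
  then have ne: "?S \<noteq> {}" by blast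
  have bdd: "bdd_below ?S" by (rule bdd_belowI[of _ 0]) auto
  obtain s where s: "4 * circumradius \<Delta> < s" "ereal s < y" using ereal_dense2[OF y] by auto
  then have "Inf ?S < s / 4" unfolding circumradius_def by simp
  then obtain R where R: "R \<in> ?S" "R < s / 4" using cInf_less_iff[OF ne bdd] by blast
  then have "Z \<le> ereal (4 * R)" using le by blast
  moreover have "ereal (4 * R) < ereal s" using R(2) by simp
  ultimately show "Z \<le> y" using s(2) by order
qed

text \<open>\<open>x\<close> is the midpoint of \<open>q + x\<close> and \<open>x - q\<close>, the
  latter being the reflection of \<open>q - x\<close>.\<close>

lemma symmetric_centre_inner:
  fixes \<Delta> :: "'a::real_normed_vector set"
  assumes "convex \<Delta>" and sym: "uminus ` \<Delta> = \<Delta>" and q: "\<And>x. norm x \<le> r \<Longrightarrow> q + x \<in> \<Delta>"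
    and x: "norm x \<le> r"
  shows "x \<in> \<Delta>"
proof -
  have "q + - x \<in> \<Delta>" using x by (intro q) simp
  then have "- (q + - x) \<in> \<Delta>" using sym by blast
  then have "(1/2) *\<^sub>R (q + x) + (1/2) *\<^sub>R (- (q + - x)) \<in> \<Delta>"
    using q[OF x] by (intro convexD[OF assms(1)]) auto
  then show "x \<in> \<Delta>" by (simp add: algebra_simps flip: scaleR_add_left)
qed

lemma symmetric_cball_centre:
  fixes \<Delta> :: "'a::real_normed_vector set"
  assumes "convex \<Delta>" "uminus ` \<Delta> = \<Delta>" "cball q r \<subseteq> \<Delta>"
  shows "cball 0 r \<subseteq> \<Delta>"
proof -
  have q: "q + x \<in> \<Delta>" if "norm x \<le> r" for x using assms(3) that by (auto simp: subset_iff dist_norm)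
  have "x \<in> \<Delta>" if "norm x \<le> r" for x
    by (rule symmetric_centre_inner[OF assms(1,2) q that])
  then show ?thesis by auto
qed

text \<open>An open ball is a union of closed ones: recentring the closed ball of radius
  \<open>norm x\<close> already captures \<open>x\<close>.\<close>

lemma symmetric_ball_centre:
  fixes \<Delta> :: "'a::real_normed_vector set"
  assumes "convex \<Delta>" "uminus ` \<Delta> = \<Delta>" "ball q r \<subseteq> \<Delta>"
  shows "ball 0 r \<subseteq> \<Delta>"
proof
  fix x :: 'a assume "x \<in> ball 0 r"
  then have x: "norm x < r" by simp
  have "cball q (norm x) \<subseteq> \<Delta>" using x assms(3) by (auto simp: subset_iff)
  then show "x \<in> \<Delta>" using symmetric_cball_centre[OF assms(1,2), of q "norm x"] by auto
qed

text \<open>\<open>2 x\<close> is the difference of \<open>q + x\<close> and \<open>q - x\<close>,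
  both of norm at most \<open>R\<close>.\<close>

lemma symmetric_enclosing_centre:
  fixes \<Delta> :: "'a::real_normed_vector set"
  assumes sym: "uminus ` \<Delta> = \<Delta>" and "\<Delta> \<subseteq> cball q R"
  shows "\<Delta> \<subseteq> cball 0 R"
proof
  fix x assume x: "x \<in> \<Delta>"
  then have "- x \<in> \<Delta>" using sym by blast
  then have "norm (q - x) \<le> R" "norm (q - - x) \<le> R" using assms(2) x by (auto simp: subset_iff dist_norm)
  then have "norm ((q - - x) - (q - x)) \<le> R + R" using norm_triangle_ineq4[of "q - - x" "q - x"] by linarith
  moreover have "(q - - x) - (q - x) = 2 *\<^sub>R x" by (simp add: scaleR_2)
  ultimately show "x \<in> cball 0 R" by simp
qed

theorem theorem1p35:
  fixes \<Delta> :: "(real^'n) set"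
  assumes "convex_body \<Delta>"
  shows "ereal (4 * inradius \<Delta>) \<le> zeta tau0 \<Delta> \<and> zeta tau0 \<Delta> \<le> ereal (4 * circumradius \<Delta>) \<and>
    (uminus ` \<Delta> = \<Delta> \<longrightarrow>
      (\<forall>q r. ball q r \<subseteq> \<Delta> \<longrightarrow> ball 0 r \<subseteq> \<Delta>) \<and>
      (\<forall>q R. \<Delta> \<subseteq> cball q R \<longrightarrow> \<Delta> \<subseteq> cball 0 R) \<and>
      ereal (4 * inradius \<Delta>) \<le> zeta hat_tau0 \<Delta> \<and> zeta hat_tau0 \<Delta> \<le> ereal (4 * circumradius \<Delta>))"
proof (intro conjI impI)
  show "ereal (4 * inradius \<Delta>) \<le> zeta tau0 \<Delta>"
    by (rule ereal_inradius_le[OF assms]) (rule zeta_ge; simp)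
  show "zeta tau0 \<Delta> \<le> ereal (4 * circumradius \<Delta>)"
    by (rule le_ereal_circumradius[OF assms]) (rule zeta_tau0_le)
next
  assume sym: "uminus ` \<Delta> = \<Delta>"
  have conv: "convex \<Delta>" using assms by (simp add: convex_body_def)
  show "\<forall>q r. ball q r \<subseteq> \<Delta> \<longrightarrow> ball 0 r \<subseteq> \<Delta>"
    using symmetric_ball_centre[OF conv sym] by blast
  show "\<forall>q R. \<Delta> \<subseteq> cball q R \<longrightarrow> \<Delta> \<subseteq> cball 0 R"
    using symmetric_enclosing_centre[OF sym] by blast
  show "ereal (4 * inradius \<Delta>) \<le> zeta hat_tau0 \<Delta>"
  proof (rule ereal_inradius_le[OF assms])
    fix q r assume "r > 0" "cball q r \<subseteq> \<Delta>"
    then show "ereal (4 * r) \<le> zeta hat_tau0 \<Delta>"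
      using symmetric_cball_centre[OF conv sym] by (intro zeta_ge[where q = 0]) auto
  qed
  show "zeta hat_tau0 \<Delta> \<le> ereal (4 * circumradius \<Delta>)"
  proof (rule le_ereal_circumradius[OF assms])
    fix q R assume "R > 0" "\<Delta> \<subseteq> cball q R"
    then show "zeta hat_tau0 \<Delta> \<le> ereal (4 * R)"
      using symmetric_enclosing_centre[OF sym] sym by (intro zeta_hat_tau0_le) auto
  qed
qed

end
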